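(* Let $\mathcal{C}$ be the monoidal category of finite dimensional complex $\mathfrak{sl}_2$-modules, and let $\mathcal{X}$ be an admissible (locally finitary) simple transitive $\mathcal{C}$-module category of type $T_\infty$. Then $\mathcal{X}$ is a semi-simple category.
   Context: Everything is over $\mathbb{C}$. $\mathcal{C}$ is the monoidal category (under $\otimes_{\mathbb{C}}$) of finite dimensional $\mathfrak{sl}_2$-modules; $L(1)$ is the simple module of dimension $2$. A $\mathcal{C}$-module category $\mathcal{M}$ is locally finitary if it is $\mathbb{C}$-linear, additive, idempotent split, Krull-Schmidt, has at most countably many indecomposable objects up to isomorphism, and has finite dimensional hom-spaces. It is simple transitive if it has no non-trivial $\mathcal{C}$-invariant ideals (ideals other than $0$ and $\mathcal{M}$). It is of type $T_\infty$ if its indecomposables, up to isomorphism, can be listed without repetition as $X_0,X_1,X_2,\dots$ so that $L(1)\cdot X_0\cong X_0\oplus X_1$ and $L(1)\cdot X_i\cong X_{i-1}\oplus X_{i+1}$ for $i\geq 1$. Semi-simple means that the radical of the category is zero. The projective abelianization $\overline{\mathcal{M}}$ has as objects diagrams $X\to Y$ over $\mathcal{M}$ and as morphisms commutative squares modulo those whose component $Y\to Y'$ factors through $X'\to Y'$. $\mathcal{M}$ is called admissible if it has weak kernels; equivalently, $\overline{\mathcal{M}}$ is abelian, with $\mathcal{M}$ embedded, via $P\mapsto (0\to P)$, as the category of projective objects. *)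

theory Defs
  imports "Jordan_Normal_Form.VS_Connect" "HOL-Library.Countable_Set"
begin

section \<open>Linear categories\<close>

text \<open>
  The morphisms from \<open>X\<close> to \<open>Y\<close> form the complex vector space \<open>Mor C X Y\<close>.  The spaces for different
  pairs of objects need not be disjoint, so composition is indexed by objects: \<open>Cmp C X Y Z g f\<close> is
  the composite of \<open>f\<close> from \<open>X\<close> to \<open>Y\<close> followed by \<open>g\<close> from \<open>Y\<close> to \<open>Z\<close>.
\<close>

record ('o, 'm) lin_cat =
  Ob :: "'o set"
  Mor :: "'o \<Rightarrow> 'o \<Rightarrow> (complex, 'm) module"
  Cmp :: "'o \<Rightarrow> 'o \<Rightarrow> 'o \<Rightarrow> 'm \<Rightarrow> 'm \<Rightarrow> 'm"
  Idn :: "'o \<Rightarrow> 'm"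

abbreviation mors :: "('o, 'm, 'x) lin_cat_scheme \<Rightarrow> 'o \<Rightarrow> 'o \<Rightarrow> 'm set" where
  "mors C X Y \<equiv> carrier (Mor C X Y)"

abbreviation zero_mor :: "('o, 'm, 'x) lin_cat_scheme \<Rightarrow> 'o \<Rightarrow> 'o \<Rightarrow> 'm" where
  "zero_mor C X Y \<equiv> \<zero>\<^bsub>Mor C X Y\<^esub>"

locale linear_category =
  fixes C :: "('o, 'm, 'x) lin_cat_scheme"
  assumes hom_vectorspace:
      "\<lbrakk>X \<in> Ob C; Y \<in> Ob C\<rbrakk> \<Longrightarrow> vectorspace class_ring (Mor C X Y)"
    and id_closed: "X \<in> Ob C \<Longrightarrow> Idn C X \<in> mors C X X"
    and comp_linear_right:
      "\<lbrakk>X \<in> Ob C; Y \<in> Ob C; Z \<in> Ob C; g \<in> mors C Y Z\<rbrakk>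
        \<Longrightarrow> linear_map class_ring (Mor C X Y) (Mor C X Z) (\<lambda>f. Cmp C X Y Z g f)"
    and comp_linear_left:
      "\<lbrakk>X \<in> Ob C; Y \<in> Ob C; Z \<in> Ob C; f \<in> mors C X Y\<rbrakk>
        \<Longrightarrow> linear_map class_ring (Mor C Y Z) (Mor C X Z) (\<lambda>g. Cmp C X Y Z g f)"
    and comp_id_left:
      "\<lbrakk>X \<in> Ob C; Y \<in> Ob C; f \<in> mors C X Y\<rbrakk> \<Longrightarrow> Cmp C X Y Y (Idn C Y) f = f"
    and comp_id_right:
      "\<lbrakk>X \<in> Ob C; Y \<in> Ob C; f \<in> mors C X Y\<rbrakk> \<Longrightarrow> Cmp C X X Y f (Idn C X) = f"
    and comp_assoc:
      "\<lbrakk>W \<in> Ob C; X \<in> Ob C; Y \<in> Ob C; Z \<in> Ob C;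
        f \<in> mors C W X; g \<in> mors C X Y; h \<in> mors C Y Z\<rbrakk>
        \<Longrightarrow> Cmp C W Y Z h (Cmp C W X Y g f) = Cmp C W X Z (Cmp C X Y Z h g) f"

definition isos :: "('o, 'm, 'x) lin_cat_scheme \<Rightarrow> 'o \<Rightarrow> 'o \<Rightarrow> 'm set" where
  "isos C X Y = {f \<in> mors C X Y. \<exists>g \<in> mors C Y X.
     Cmp C X Y X g f = Idn C X \<and> Cmp C Y X Y f g = Idn C Y}"

definition isomorphic :: "('o, 'm, 'x) lin_cat_scheme \<Rightarrow> 'o \<Rightarrow> 'o \<Rightarrow> bool" where
  "isomorphic C X Y \<longleftrightarrow> isos C X Y \<noteq> {}"

text \<open>
  \<open>direct_sum C Xs Z\<close>: the object \<open>Z\<close> is a direct sum of the finite list of objects \<open>Xs\<close>, that is,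
  isomorphic to it.  A direct sum of the empty list is a zero object.
\<close>

definition direct_sum :: "('o, 'm, 'x) lin_cat_scheme \<Rightarrow> 'o list \<Rightarrow> 'o \<Rightarrow> bool" where
  "direct_sum C Xs Z \<longleftrightarrow> (\<exists>\<iota> \<pi>.
     (\<forall>j < length Xs. \<iota> j \<in> mors C (Xs ! j) Z \<and> \<pi> j \<in> mors C Z (Xs ! j)) \<and>
     (\<forall>j < length Xs. \<forall>k < length Xs.
        Cmp C (Xs ! j) Z (Xs ! k) (\<pi> k) (\<iota> j) =
          (if j = k then Idn C (Xs ! j) else zero_mor C (Xs ! j) (Xs ! k))) \<and>
     (\<Oplus>\<^bsub>Mor C Z Z\<^esub> j \<in> {..<length Xs}. Cmp C Z (Xs ! j) Z (\<iota> j) (\<pi> j)) = Idn C Z)"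

definition zero_object :: "('o, 'm, 'x) lin_cat_scheme \<Rightarrow> 'o \<Rightarrow> bool" where
  "zero_object C Z \<longleftrightarrow> Z \<in> Ob C \<and>
     (\<forall>X \<in> Ob C. (\<exists>!f. f \<in> mors C X Z) \<and> (\<exists>!f. f \<in> mors C Z X))"

definition indecomposable :: "('o, 'm, 'x) lin_cat_scheme \<Rightarrow> 'o \<Rightarrow> bool" where
  "indecomposable C X \<longleftrightarrow> X \<in> Ob C \<and> \<not> zero_object C X \<and>
     (\<forall>Y \<in> Ob C. \<forall>Z \<in> Ob C. direct_sum C [Y, Z] X \<longrightarrow> zero_object C Y \<or> zero_object C Z)"

definition additive :: "('o, 'm, 'x) lin_cat_scheme \<Rightarrow> bool" where
  "additive C \<longleftrightarrow> (\<forall>Xs. set Xs \<subseteq> Ob C \<longrightarrow> (\<exists>Z \<in> Ob C. direct_sum C Xs Z))"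

definition idempotent_split :: "('o, 'm, 'x) lin_cat_scheme \<Rightarrow> bool" where
  "idempotent_split C \<longleftrightarrow> (\<forall>X \<in> Ob C. \<forall>e \<in> mors C X X. Cmp C X X X e e = e \<longrightarrow>
     (\<exists>Y \<in> Ob C. \<exists>r \<in> mors C X Y. \<exists>s \<in> mors C Y X.
        Cmp C X Y X s r = e \<and> Cmp C Y X Y r s = Idn C Y))"

text \<open>A ring is local if it is nonzero and its non-units are closed under addition.\<close>

definition local_endomorphism_ring :: "('o, 'm, 'x) lin_cat_scheme \<Rightarrow> 'o \<Rightarrow> bool" where
  "local_endomorphism_ring C X \<longleftrightarrow> Idn C X \<noteq> zero_mor C X X \<and>
     (\<forall>f \<in> mors C X X - isos C X X. \<forall>g \<in> mors C X X - isos C X X.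
        f \<oplus>\<^bsub>Mor C X X\<^esub> g \<notin> isos C X X)"

definition krull_schmidt :: "('o, 'm, 'x) lin_cat_scheme \<Rightarrow> bool" where
  "krull_schmidt C \<longleftrightarrow> (\<forall>Z \<in> Ob C. \<exists>Xs. set Xs \<subseteq> Ob C \<and>
     (\<forall>X \<in> set Xs. local_endomorphism_ring C X) \<and> direct_sum C Xs Z)"

definition countably_many_indecomposables :: "('o, 'm, 'x) lin_cat_scheme \<Rightarrow> bool" where
  "countably_many_indecomposables C \<longleftrightarrow> (\<exists>S. countable S \<and> S \<subseteq> Ob C \<and>
     (\<forall>X. indecomposable C X \<longrightarrow> (\<exists>Y \<in> S. isomorphic C X Y)))"

definition locally_finitary :: "('o, 'm, 'x) lin_cat_scheme \<Rightarrow> bool" where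
  "locally_finitary C \<longleftrightarrow> linear_category C \<and> additive C \<and> idempotent_split C \<and>
     krull_schmidt C \<and> countably_many_indecomposables C \<and>
     (\<forall>X \<in> Ob C. \<forall>Y \<in> Ob C. vectorspace.fin_dim class_ring (Mor C X Y))"

definition weak_kernel ::
    "('o, 'm, 'x) lin_cat_scheme \<Rightarrow> 'o \<Rightarrow> 'o \<Rightarrow> 'm \<Rightarrow> 'o \<Rightarrow> 'm \<Rightarrow> bool" where
  "weak_kernel C X Y f K k \<longleftrightarrow> K \<in> Ob C \<and> k \<in> mors C K X \<and>
     Cmp C K X Y f k = zero_mor C K Y \<and>
     (\<forall>W \<in> Ob C. \<forall>g \<in> mors C W X. Cmp C W X Y f g = zero_mor C W Y \<longrightarrow>
        (\<exists>h \<in> mors C W K. Cmp C W K X k h = g))"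

definition admissible :: "('o, 'm, 'x) lin_cat_scheme \<Rightarrow> bool" where
  "admissible C \<longleftrightarrow>
     (\<forall>X \<in> Ob C. \<forall>Y \<in> Ob C. \<forall>f \<in> mors C X Y. \<exists>K k. weak_kernel C X Y f K k)"

definition category_ideal :: "('o, 'm, 'x) lin_cat_scheme \<Rightarrow> ('o \<Rightarrow> 'o \<Rightarrow> 'm set) \<Rightarrow> bool" where
  "category_ideal C I \<longleftrightarrow>
     (\<forall>X \<in> Ob C. \<forall>Y \<in> Ob C. VectorSpace.subspace class_ring (I X Y) (Mor C X Y)) \<and>
     (\<forall>X \<in> Ob C. \<forall>Y \<in> Ob C. \<forall>Z \<in> Ob C.
        (\<forall>f \<in> I X Y. \<forall>g \<in> mors C Y Z. Cmp C X Y Z g f \<in> I X Z) \<and>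
        (\<forall>f \<in> mors C X Y. \<forall>g \<in> I Y Z. Cmp C X Y Z g f \<in> I X Z))"

text \<open>
  The Jacobson radical of a linear category; invertibility of \<open>id\<^sub>X - g f\<close> for all \<open>g\<close> is equivalent
  to invertibility of \<open>id\<^sub>Y - f g\<close> for all \<open>g\<close>.
\<close>

definition radical :: "('o, 'm, 'x) lin_cat_scheme \<Rightarrow> 'o \<Rightarrow> 'o \<Rightarrow> 'm set" where
  "radical C X Y = {f \<in> mors C X Y. \<forall>g \<in> mors C Y X.
     Idn C X \<ominus>\<^bsub>Mor C X X\<^esub> Cmp C X Y X g f \<in> isos C X X}"

definition semi_simple :: "('o, 'm, 'x) lin_cat_scheme \<Rightarrow> bool" where
  "semi_simple C \<longleftrightarrow> (\<forall>X \<in> Ob C. \<forall>Y \<in> Ob C. radical C X Y = {zero_mor C X Y})"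


section \<open>Monoidal categories and module categories\<close>

text \<open>
  For \<open>f\<close> from \<open>X\<close> to \<open>X'\<close> and \<open>g\<close> from \<open>Y\<close> to \<open>Y'\<close>, the morphism \<open>tens_mor C X X' Y Y' f g\<close> is
  their tensor product, from \<open>tens_ob C X Y\<close> to \<open>tens_ob C X' Y'\<close>; likewise for \<open>act_mor\<close> below.
\<close>

record ('o, 'm) mon_cat = "('o, 'm) lin_cat" +
  tens_ob :: "'o \<Rightarrow> 'o \<Rightarrow> 'o"
  tens_mor :: "'o \<Rightarrow> 'o \<Rightarrow> 'o \<Rightarrow> 'o \<Rightarrow> 'm \<Rightarrow> 'm \<Rightarrow> 'm"
  unit_ob :: 'o
  associator :: "'o \<Rightarrow> 'o \<Rightarrow> 'o \<Rightarrow> 'm"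
  left_unitor :: "'o \<Rightarrow> 'm"
  right_unitor :: "'o \<Rightarrow> 'm"

locale linear_monoidal_category = linear_category C
  for C :: "('o, 'm, 'x) mon_cat_scheme" +
  assumes tens_ob_closed: "\<lbrakk>X \<in> Ob C; Y \<in> Ob C\<rbrakk> \<Longrightarrow> tens_ob C X Y \<in> Ob C"
    and unit_ob_closed: "unit_ob C \<in> Ob C"
    and tens_linear_right:
      "\<lbrakk>X \<in> Ob C; X' \<in> Ob C; Y \<in> Ob C; Y' \<in> Ob C; f \<in> mors C X X'\<rbrakk>
        \<Longrightarrow> linear_map class_ring (Mor C Y Y') (Mor C (tens_ob C X Y) (tens_ob C X' Y'))
              (\<lambda>g. tens_mor C X X' Y Y' f g)"
    and tens_linear_left:
      "\<lbrakk>X \<in> Ob C; X' \<in> Ob C; Y \<in> Ob C; Y' \<in> Ob C; g \<in> mors C Y Y'\<rbrakk>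
        \<Longrightarrow> linear_map class_ring (Mor C X X') (Mor C (tens_ob C X Y) (tens_ob C X' Y'))
              (\<lambda>f. tens_mor C X X' Y Y' f g)"
    and tens_id:
      "\<lbrakk>X \<in> Ob C; Y \<in> Ob C\<rbrakk> \<Longrightarrow> tens_mor C X X Y Y (Idn C X) (Idn C Y) = Idn C (tens_ob C X Y)"
    and tens_comp:
      "\<lbrakk>X \<in> Ob C; X' \<in> Ob C; X'' \<in> Ob C; Y \<in> Ob C; Y' \<in> Ob C; Y'' \<in> Ob C;
        f \<in> mors C X X'; f' \<in> mors C X' X''; g \<in> mors C Y Y'; g' \<in> mors C Y' Y''\<rbrakk>
        \<Longrightarrow> tens_mor C X X'' Y Y'' (Cmp C X X' X'' f' f) (Cmp C Y Y' Y'' g' g) =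
            Cmp C (tens_ob C X Y) (tens_ob C X' Y') (tens_ob C X'' Y'')
              (tens_mor C X' X'' Y' Y'' f' g') (tens_mor C X X' Y Y' f g)"
    and associator_iso:
      "\<lbrakk>X \<in> Ob C; Y \<in> Ob C; Z \<in> Ob C\<rbrakk> \<Longrightarrow> associator C X Y Z \<in>
         isos C (tens_ob C (tens_ob C X Y) Z) (tens_ob C X (tens_ob C Y Z))"
    and associator_natural:
      "\<lbrakk>X \<in> Ob C; X' \<in> Ob C; Y \<in> Ob C; Y' \<in> Ob C; Z \<in> Ob C; Z' \<in> Ob C;
        f \<in> mors C X X'; g \<in> mors C Y Y'; h \<in> mors C Z Z'\<rbrakk>
        \<Longrightarrow> Cmp C (tens_ob C (tens_ob C X Y) Z)
              (tens_ob C X (tens_ob C Y Z)) (tens_ob C X' (tens_ob C Y' Z'))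
              (tens_mor C X X' (tens_ob C Y Z) (tens_ob C Y' Z') f (tens_mor C Y Y' Z Z' g h))
              (associator C X Y Z) =
            Cmp C (tens_ob C (tens_ob C X Y) Z)
              (tens_ob C (tens_ob C X' Y') Z') (tens_ob C X' (tens_ob C Y' Z'))
              (associator C X' Y' Z')
              (tens_mor C (tens_ob C X Y) (tens_ob C X' Y') Z Z' (tens_mor C X X' Y Y' f g) h)"
    and left_unitor_iso:
      "X \<in> Ob C \<Longrightarrow> left_unitor C X \<in> isos C (tens_ob C (unit_ob C) X) X"
    and left_unitor_natural:
      "\<lbrakk>X \<in> Ob C; Y \<in> Ob C; f \<in> mors C X Y\<rbrakk> \<Longrightarrow>
         Cmp C (tens_ob C (unit_ob C) X) X Y f (left_unitor C X) =
         Cmp C (tens_ob C (unit_ob C) X) (tens_ob C (unit_ob C) Y) Y (left_unitor C Y)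
           (tens_mor C (unit_ob C) (unit_ob C) X Y (Idn C (unit_ob C)) f)"
    and right_unitor_iso:
      "X \<in> Ob C \<Longrightarrow> right_unitor C X \<in> isos C (tens_ob C X (unit_ob C)) X"
    and right_unitor_natural:
      "\<lbrakk>X \<in> Ob C; Y \<in> Ob C; f \<in> mors C X Y\<rbrakk> \<Longrightarrow>
         Cmp C (tens_ob C X (unit_ob C)) X Y f (right_unitor C X) =
         Cmp C (tens_ob C X (unit_ob C)) (tens_ob C Y (unit_ob C)) Y (right_unitor C Y)
           (tens_mor C X Y (unit_ob C) (unit_ob C) f (Idn C (unit_ob C)))"
    and pentagon:
      "\<lbrakk>W \<in> Ob C; X \<in> Ob C; Y \<in> Ob C; Z \<in> Ob C\<rbrakk> \<Longrightarrow>
         Cmp C (tens_ob C (tens_ob C (tens_ob C W X) Y) Z)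
           (tens_ob C (tens_ob C W X) (tens_ob C Y Z))
           (tens_ob C W (tens_ob C X (tens_ob C Y Z)))
           (associator C W X (tens_ob C Y Z))
           (associator C (tens_ob C W X) Y Z) =
         Cmp C (tens_ob C (tens_ob C (tens_ob C W X) Y) Z)
           (tens_ob C W (tens_ob C (tens_ob C X Y) Z))
           (tens_ob C W (tens_ob C X (tens_ob C Y Z)))
           (tens_mor C W W (tens_ob C (tens_ob C X Y) Z) (tens_ob C X (tens_ob C Y Z))
             (Idn C W) (associator C X Y Z))
           (Cmp C (tens_ob C (tens_ob C (tens_ob C W X) Y) Z)
             (tens_ob C (tens_ob C W (tens_ob C X Y)) Z)
             (tens_ob C W (tens_ob C (tens_ob C X Y) Z))
             (associator C W (tens_ob C X Y) Z)
             (tens_mor C (tens_ob C (tens_ob C W X) Y) (tens_ob C W (tens_ob C X Y)) Z Z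
               (associator C W X Y) (Idn C Z)))"
    and triangle:
      "\<lbrakk>X \<in> Ob C; Y \<in> Ob C\<rbrakk> \<Longrightarrow>
         Cmp C (tens_ob C (tens_ob C X (unit_ob C)) Y)
           (tens_ob C X (tens_ob C (unit_ob C) Y)) (tens_ob C X Y)
           (tens_mor C X X (tens_ob C (unit_ob C) Y) Y (Idn C X) (left_unitor C Y))
           (associator C X (unit_ob C) Y) =
         tens_mor C (tens_ob C X (unit_ob C)) X Y Y (right_unitor C X) (Idn C Y)"

record ('c, 'n, 'o, 'm) mod_cat = "('o, 'm) lin_cat" +
  act_ob :: "'c \<Rightarrow> 'o \<Rightarrow> 'o"
  act_mor :: "'c \<Rightarrow> 'c \<Rightarrow> 'o \<Rightarrow> 'o \<Rightarrow> 'n \<Rightarrow> 'm \<Rightarrow> 'm"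
  act_assoc :: "'c \<Rightarrow> 'c \<Rightarrow> 'o \<Rightarrow> 'm"
  act_unit :: "'o \<Rightarrow> 'm"

locale module_category =
  C: linear_monoidal_category C + M: linear_category M
  for C :: "('c, 'n, 'x) mon_cat_scheme" and M :: "('c, 'n, 'o, 'm, 'y) mod_cat_scheme" +
  assumes act_ob_closed: "\<lbrakk>A \<in> Ob C; X \<in> Ob M\<rbrakk> \<Longrightarrow> act_ob M A X \<in> Ob M"
    and act_linear_right:
      "\<lbrakk>A \<in> Ob C; A' \<in> Ob C; X \<in> Ob M; X' \<in> Ob M; a \<in> mors C A A'\<rbrakk>
        \<Longrightarrow> linear_map class_ring (Mor M X X') (Mor M (act_ob M A X) (act_ob M A' X'))
              (\<lambda>f. act_mor M A A' X X' a f)"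
    and act_linear_left:
      "\<lbrakk>A \<in> Ob C; A' \<in> Ob C; X \<in> Ob M; X' \<in> Ob M; f \<in> mors M X X'\<rbrakk>
        \<Longrightarrow> linear_map class_ring (Mor C A A') (Mor M (act_ob M A X) (act_ob M A' X'))
              (\<lambda>a. act_mor M A A' X X' a f)"
    and act_id:
      "\<lbrakk>A \<in> Ob C; X \<in> Ob M\<rbrakk> \<Longrightarrow> act_mor M A A X X (Idn C A) (Idn M X) = Idn M (act_ob M A X)"
    and act_comp:
      "\<lbrakk>A \<in> Ob C; A' \<in> Ob C; A'' \<in> Ob C; X \<in> Ob M; X' \<in> Ob M; X'' \<in> Ob M;
        a \<in> mors C A A'; a' \<in> mors C A' A''; f \<in> mors M X X'; f' \<in> mors M X' X''\<rbrakk>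
        \<Longrightarrow> act_mor M A A'' X X'' (Cmp C A A' A'' a' a) (Cmp M X X' X'' f' f) =
            Cmp M (act_ob M A X) (act_ob M A' X') (act_ob M A'' X'')
              (act_mor M A' A'' X' X'' a' f') (act_mor M A A' X X' a f)"
    and act_assoc_iso:
      "\<lbrakk>A \<in> Ob C; B \<in> Ob C; X \<in> Ob M\<rbrakk> \<Longrightarrow> act_assoc M A B X \<in>
         isos M (act_ob M (tens_ob C A B) X) (act_ob M A (act_ob M B X))"
    and act_assoc_natural:
      "\<lbrakk>A \<in> Ob C; A' \<in> Ob C; B \<in> Ob C; B' \<in> Ob C; X \<in> Ob M; X' \<in> Ob M;
        a \<in> mors C A A'; b \<in> mors C B B'; f \<in> mors M X X'\<rbrakk>
        \<Longrightarrow> Cmp M (act_ob M (tens_ob C A B) X)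
              (act_ob M A (act_ob M B X)) (act_ob M A' (act_ob M B' X'))
              (act_mor M A A' (act_ob M B X) (act_ob M B' X') a (act_mor M B B' X X' b f))
              (act_assoc M A B X) =
            Cmp M (act_ob M (tens_ob C A B) X)
              (act_ob M (tens_ob C A' B') X') (act_ob M A' (act_ob M B' X'))
              (act_assoc M A' B' X')
              (act_mor M (tens_ob C A B) (tens_ob C A' B') X X' (tens_mor C A A' B B' a b) f)"
    and act_unit_iso:
      "X \<in> Ob M \<Longrightarrow> act_unit M X \<in> isos M (act_ob M (unit_ob C) X) X"
    and act_unit_natural:
      "\<lbrakk>X \<in> Ob M; Y \<in> Ob M; f \<in> mors M X Y\<rbrakk> \<Longrightarrow>
         Cmp M (act_ob M (unit_ob C) X) X Y f (act_unit M X) =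
         Cmp M (act_ob M (unit_ob C) X) (act_ob M (unit_ob C) Y) Y (act_unit M Y)
           (act_mor M (unit_ob C) (unit_ob C) X Y (Idn C (unit_ob C)) f)"
    and act_pentagon:
      "\<lbrakk>A \<in> Ob C; B \<in> Ob C; D \<in> Ob C; X \<in> Ob M\<rbrakk> \<Longrightarrow>
         Cmp M (act_ob M (tens_ob C (tens_ob C A B) D) X)
           (act_ob M (tens_ob C A B) (act_ob M D X))
           (act_ob M A (act_ob M B (act_ob M D X)))
           (act_assoc M A B (act_ob M D X))
           (act_assoc M (tens_ob C A B) D X) =
         Cmp M (act_ob M (tens_ob C (tens_ob C A B) D) X)
           (act_ob M A (act_ob M (tens_ob C B D) X))
           (act_ob M A (act_ob M B (act_ob M D X)))
           (act_mor M A A (act_ob M (tens_ob C B D) X) (act_ob M B (act_ob M D X))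
             (Idn C A) (act_assoc M B D X))
           (Cmp M (act_ob M (tens_ob C (tens_ob C A B) D) X)
             (act_ob M (tens_ob C A (tens_ob C B D)) X)
             (act_ob M A (act_ob M (tens_ob C B D) X))
             (act_assoc M A (tens_ob C B D) X)
             (act_mor M (tens_ob C (tens_ob C A B) D) (tens_ob C A (tens_ob C B D)) X X
               (associator C A B D) (Idn M X)))"
    and act_triangle:
      "\<lbrakk>A \<in> Ob C; X \<in> Ob M\<rbrakk> \<Longrightarrow>
         Cmp M (act_ob M (tens_ob C A (unit_ob C)) X)
           (act_ob M A (act_ob M (unit_ob C) X)) (act_ob M A X)
           (act_mor M A A (act_ob M (unit_ob C) X) X (Idn C A) (act_unit M X))
           (act_assoc M A (unit_ob C) X) =
         act_mor M (tens_ob C A (unit_ob C)) A X X (right_unitor C A) (Idn M X)"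

definition invariant_ideal ::
    "('c, 'n, 'x) mon_cat_scheme \<Rightarrow> ('c, 'n, 'o, 'm, 'y) mod_cat_scheme \<Rightarrow>
     ('o \<Rightarrow> 'o \<Rightarrow> 'm set) \<Rightarrow> bool" where
  "invariant_ideal C M I \<longleftrightarrow> category_ideal M I \<and>
     (\<forall>A \<in> Ob C. \<forall>X \<in> Ob M. \<forall>Y \<in> Ob M. \<forall>f \<in> I X Y.
        act_mor M A A X Y (Idn C A) f \<in> I (act_ob M A X) (act_ob M A Y))"

definition simple_transitive ::
    "('c, 'n, 'x) mon_cat_scheme \<Rightarrow> ('c, 'n, 'o, 'm, 'y) mod_cat_scheme \<Rightarrow> bool" where
  "simple_transitive C M \<longleftrightarrow> (\<forall>I. invariant_ideal C M I \<longrightarrow>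
     (\<forall>X \<in> Ob M. \<forall>Y \<in> Ob M. I X Y = {zero_mor M X Y}) \<or>
     (\<forall>X \<in> Ob M. \<forall>Y \<in> Ob M. I X Y = mors M X Y))"


section \<open>Finite dimensional modules over the Lie algebra \<open>sl\<^sub>2\<close>\<close>

definition sl2 :: "complex mat set" where
  "sl2 = {A \<in> carrier_mat 2 2. (\<Sum>i<2. A $$ (i, i)) = 0}"

definition lie_bracket :: "complex mat \<Rightarrow> complex mat \<Rightarrow> complex mat" where
  "lie_bracket A B = A * B - B * A"

text \<open>
  Underlying vector spaces are the coordinate spaces of column vectors of length \<open>n\<close>: a module is a
  dimension \<open>n\<close> together with a representation of \<open>sl2\<close> by \<open>n \<times> n\<close> matrices, and homomorphisms are
  the intertwining matrices.
\<close>

type_synonym sl2_rep = "nat \<times> (complex mat \<Rightarrow> complex mat)"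

definition sl2_reps :: "sl2_rep set" where
  "sl2_reps = {(n, \<rho>). \<rho> \<in> sl2 \<rightarrow>\<^sub>E carrier_mat n n \<and>
     (\<forall>A \<in> sl2. \<forall>B \<in> sl2. \<rho> (A + B) = \<rho> A + \<rho> B) \<and>
     (\<forall>c. \<forall>A \<in> sl2. \<rho> (c \<cdot>\<^sub>m A) = c \<cdot>\<^sub>m \<rho> A) \<and>
     (\<forall>A \<in> sl2. \<forall>B \<in> sl2. \<rho> (lie_bracket A B) = lie_bracket (\<rho> A) (\<rho> B))}"

definition sl2_homs :: "sl2_rep \<Rightarrow> sl2_rep \<Rightarrow> complex mat set" where
  "sl2_homs V W = {f \<in> carrier_mat (fst W) (fst V). \<forall>A \<in> sl2. f * snd V A = snd W A * f}"

text \<open>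
  The Kronecker product: the matrix of a tensor product of linear maps with respect to the
  lexicographically ordered bases \<open>e\<^sub>i \<otimes> e\<^sub>j\<close>.
\<close>

definition kronecker :: "complex mat \<Rightarrow> complex mat \<Rightarrow> complex mat" where
  "kronecker A B = mat (dim_row A * dim_row B) (dim_col A * dim_col B)
     (\<lambda>(i, j). A $$ (i div dim_row B, j div dim_col B) * B $$ (i mod dim_row B, j mod dim_col B))"

definition sl2_tensor :: "sl2_rep \<Rightarrow> sl2_rep \<Rightarrow> sl2_rep" where
  "sl2_tensor V W = (fst V * fst W,
     \<lambda>A \<in> sl2. kronecker (snd V A) (1\<^sub>m (fst W)) + kronecker (1\<^sub>m (fst V)) (snd W A))"

text \<open>
  In the lexicographic bases the canonical isomorphisms between \<open>(U \<otimes> V) \<otimes> W\<close> and \<open>U \<otimes> (V \<otimes> W)\<close>,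
  between \<open>\<complex> \<otimes> V\<close> and \<open>V\<close>, and between \<open>V \<otimes> \<complex>\<close> and \<open>V\<close> are given by identity matrices.
\<close>

definition sl2_mod :: "(sl2_rep, complex mat) mon_cat" where
  "sl2_mod = \<lparr>
     Ob = sl2_reps,
     Mor = \<lambda>V W. (module_mat TYPE(complex) (fst W) (fst V))\<lparr>carrier := sl2_homs V W\<rparr>,
     Cmp = \<lambda>U V W g f. g * f,
     Idn = \<lambda>V. 1\<^sub>m (fst V),
     tens_ob = sl2_tensor,
     tens_mor = \<lambda>V V' W W' f g. kronecker f g,
     unit_ob = (1, \<lambda>A \<in> sl2. 0\<^sub>m 1 1),
     associator = \<lambda>U V W. 1\<^sub>m (fst U * fst V * fst W),
     left_unitor = \<lambda>V. 1\<^sub>m (fst V),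
     right_unitor = \<lambda>V. 1\<^sub>m (fst V)\<rparr>"

text \<open>The simple module \<open>L(1)\<close> of dimension 2 is the defining representation.\<close>

definition sl2_L1 :: sl2_rep where
  "sl2_L1 = (2, \<lambda>A \<in> sl2. A)"

definition type_T_infinity :: "(sl2_rep, complex mat, 'o, 'm, 'y) mod_cat_scheme \<Rightarrow> bool" where
  "type_T_infinity M \<longleftrightarrow> (\<exists>X :: nat \<Rightarrow> 'o.
     (\<forall>i. indecomposable M (X i)) \<and>
     (\<forall>i j. isomorphic M (X i) (X j) \<longrightarrow> i = j) \<and>
     (\<forall>Y. indecomposable M Y \<longrightarrow> (\<exists>i. isomorphic M Y (X i))) \<and>
     direct_sum M [X 0, X 1] (act_ob M sl2_L1 (X 0)) \<and>
     (\<forall>i \<ge> 1. direct_sum M [X (i - 1), X (i + 1)] (act_ob M sl2_L1 (X i))))"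


section \<open>The modules over \<open>sl\<^sub>2\<close> form a linear monoidal category\<close>

lemma sum_div_mod:
  fixes F :: "nat \<Rightarrow> nat \<Rightarrow> complex"
  shows "(\<Sum>k<b*e. F (k div e) (k mod e)) = (\<Sum>p<b. \<Sum>q<e. F p q)"
proof (cases "e = 0")
  case False
  have "(\<Sum>k<b*e. F (k div e) (k mod e)) = (\<Sum>p<b. sum (\<lambda>k. F (k div e) (k mod e)) {p*e..<p*e+e})"
    by (rule sum.nat_group[symmetric])
  also have "\<dots> = (\<Sum>p<b. \<Sum>q<e. F p q)"
  proof (rule sum.cong[OF refl])
    fix p
    show "sum (\<lambda>k. F (k div e) (k mod e)) {p*e..<p*e+e} = (\<Sum>q<e. F p q)"
      using sum.shift_bounds_nat_ivl[of "\<lambda>k. F (k div e) (k mod e)" 0 "p*e" e] False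
      by (simp add: atLeast0LessThan add.commute)
  qed
  finally show ?thesis .
qed simp

lemma kronecker_dim [simp]:
  "dim_row (kronecker A B) = dim_row A * dim_row B"
  "dim_col (kronecker A B) = dim_col A * dim_col B"
  by (simp_all add: kronecker_def)

lemma kronecker_carrier [simp, intro]:
  "A \<in> carrier_mat a b \<Longrightarrow> B \<in> carrier_mat d e \<Longrightarrow> kronecker A B \<in> carrier_mat (a*d) (b*e)"
  by (simp add: kronecker_def)

lemma kronecker_index [simp]:
  "i < dim_row A * dim_row B \<Longrightarrow> j < dim_col A * dim_col B \<Longrightarrow> kronecker A B $$ (i, j) =
    A $$ (i div dim_row B, j div dim_col B) * B $$ (i mod dim_row B, j mod dim_col B)"
  by (simp add: kronecker_def)

lemma mod_bound: "(i::nat) < a * d \<Longrightarrow> i mod d < d"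
  by (metis mod_less_divisor mult_0_right not_gr_zero not_less_zero)

lemma kronecker_mult:
  assumes A: "A \<in> carrier_mat a b" and C: "C \<in> carrier_mat b c"
    and B: "B \<in> carrier_mat d e" and D: "D \<in> carrier_mat e f"
  shows "kronecker A B * kronecker C D = kronecker (A * C) (B * D)"
proof (rule eq_matI)
  fix i j assume "i < dim_row (kronecker (A * C) (B * D))" "j < dim_col (kronecker (A * C) (B * D))"
  then have i: "i < a * d" and j: "j < c * f" using assms by auto
  note bd = less_mult_imp_div_less[OF i] less_mult_imp_div_less[OF j] mod_bound[OF i] mod_bound[OF j]
  have "(kronecker A B * kronecker C D) $$ (i, j) =
      (\<Sum>k<b*e. A $$ (i div d, k div e) * B $$ (i mod d, k mod e) * (C $$ (k div e, j div f) * D $$ (k mod e, j mod f)))"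
    using assms i j by (simp add: scalar_prod_def atLeast0LessThan)
  also have "\<dots> = (\<Sum>p<b. \<Sum>q<e. A $$ (i div d, p) * B $$ (i mod d, q) * (C $$ (p, j div f) * D $$ (q, j mod f)))"
    by (rule sum_div_mod)
  also have "\<dots> = (\<Sum>p<b. A $$ (i div d, p) * C $$ (p, j div f)) * (\<Sum>q<e. B $$ (i mod d, q) * D $$ (q, j mod f))"
    by (simp add: sum_product mult_ac)
  also have "\<dots> = kronecker (A * C) (B * D) $$ (i, j)"
    using assms i j bd by (simp add: scalar_prod_def atLeast0LessThan)
  finally show "(kronecker A B * kronecker C D) $$ (i, j) = kronecker (A * C) (B * D) $$ (i, j)" .
qed (use assms in auto)

lemma kronecker_assoc: "kronecker (kronecker A B) C = kronecker A (kronecker B C)"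
proof (rule eq_matI)
  fix i j assume "i < dim_row (kronecker A (kronecker B C))" "j < dim_col (kronecker A (kronecker B C))"
  then have i: "i < dim_row A * dim_row B * dim_row C" and j: "j < dim_col A * dim_col B * dim_col C"
    by (auto simp: mult.assoc)
  have i': "i mod (dim_row B * dim_row C) < dim_row B * dim_row C"
    using mod_bound[of i "dim_row A" "dim_row B * dim_row C"] i by (simp add: mult.assoc)
  have j': "j mod (dim_col B * dim_col C) < dim_col B * dim_col C"
    using mod_bound[of j "dim_col A" "dim_col B * dim_col C"] j by (simp add: mult.assoc)
  have pi: "i div dim_row C < dim_row A * dim_row B" and pj: "j div dim_col C < dim_col A * dim_col B"
    using i j by (auto intro: less_mult_imp_div_less)
  have q: "i div (dim_row B * dim_row C) = i div dim_row C div dim_row B"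
    "j div (dim_col B * dim_col C) = j div dim_col C div dim_col B"
    by (metis div_mult2_eq mult.commute)+
  have m0: "x mod (b * c) div c = x div c mod b" for x b c :: nat
    by (cases "c = 0") (simp_all add: mod_mult2_eq mult.commute[of b c])
  note m = m0[of i "dim_row B" "dim_row C"] m0[of j "dim_col B" "dim_col C"]
  have n: "i mod (dim_row B * dim_row C) mod dim_row C = i mod dim_row C"
    "j mod (dim_col B * dim_col C) mod dim_col C = j mod dim_col C"
    by (simp_all add: mod_mod_cancel)
  show "kronecker (kronecker A B) C $$ (i, j) = kronecker A (kronecker B C) $$ (i, j)"
    using i j i' j' pi pj by (simp add: q m n mult.assoc)
qed (simp_all add: mult.assoc)

lemma kronecker_one: "kronecker (1\<^sub>m a) (1\<^sub>m b) = 1\<^sub>m (a * b)"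
proof (rule eq_matI)
  fix i j assume "i < dim_row (1\<^sub>m (a * b) :: complex mat)" "j < dim_col (1\<^sub>m (a * b) :: complex mat)"
  then have i: "i < a * b" and j: "j < a * b" by auto
  have "(i div b = j div b \<and> i mod b = j mod b) \<longleftrightarrow> i = j"
    by (metis div_mult_mod_eq)
  then show "kronecker (1\<^sub>m a) (1\<^sub>m b) $$ (i, j) = 1\<^sub>m (a * b) $$ (i, j)"
    using i j less_mult_imp_div_less[OF i] less_mult_imp_div_less[OF j] mod_bound[OF i] mod_bound[OF j]
    by auto
qed auto

lemma kronecker_unit:
  assumes "A \<in> carrier_mat a b"
  shows "kronecker (1\<^sub>m 1) A = A" "kronecker A (1\<^sub>m 1) = A"
  using assms by (auto intro: eq_matI)

lemma kronecker_add_left: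
  assumes "A \<in> carrier_mat a b" "A' \<in> carrier_mat a b" "B \<in> carrier_mat d e"
  shows "kronecker (A + A') B = kronecker A B + kronecker A' B"
proof (rule eq_matI)
  fix i j assume "i < dim_row (kronecker A B + kronecker A' B)" "j < dim_col (kronecker A B + kronecker A' B)"
  then have i: "i < a * d" and j: "j < b * e" using assms by auto
  show "(kronecker (A + A') B) $$ (i, j) = (kronecker A B + kronecker A' B) $$ (i, j)"
    using assms i j less_mult_imp_div_less[OF i] less_mult_imp_div_less[OF j] mod_bound[OF i] mod_bound[OF j]
    by (simp add: algebra_simps)
qed (use assms in auto)

lemma kronecker_add_right:
  assumes "A \<in> carrier_mat a b" "B \<in> carrier_mat d e" "B' \<in> carrier_mat d e"
  shows "kronecker A (B + B') = kronecker A B + kronecker A B'"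
proof (rule eq_matI)
  fix i j assume "i < dim_row (kronecker A B + kronecker A B')" "j < dim_col (kronecker A B + kronecker A B')"
  then have i: "i < a * d" and j: "j < b * e" using assms by auto
  show "(kronecker A (B + B')) $$ (i, j) = (kronecker A B + kronecker A B') $$ (i, j)"
    using assms i j less_mult_imp_div_less[OF i] less_mult_imp_div_less[OF j] mod_bound[OF i] mod_bound[OF j]
    by (simp add: algebra_simps)
qed (use assms in auto)

lemma kronecker_minus_left:
  assumes "A \<in> carrier_mat a b" "A' \<in> carrier_mat a b" "B \<in> carrier_mat d e"
  shows "kronecker (A - A') B = kronecker A B - kronecker A' B"
proof (rule eq_matI)
  fix i j assume "i < dim_row (kronecker A B - kronecker A' B)" "j < dim_col (kronecker A B - kronecker A' B)"
  then have i: "i < a * d" and j: "j < b * e" using assms by auto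
  show "(kronecker (A - A') B) $$ (i, j) = (kronecker A B - kronecker A' B) $$ (i, j)"
    using assms i j less_mult_imp_div_less[OF i] less_mult_imp_div_less[OF j] mod_bound[OF i] mod_bound[OF j]
    by (simp add: algebra_simps)
qed (use assms in auto)

lemma kronecker_minus_right:
  assumes "A \<in> carrier_mat a b" "B \<in> carrier_mat d e" "B' \<in> carrier_mat d e"
  shows "kronecker A (B - B') = kronecker A B - kronecker A B'"
proof (rule eq_matI)
  fix i j assume "i < dim_row (kronecker A B - kronecker A B')" "j < dim_col (kronecker A B - kronecker A B')"
  then have i: "i < a * d" and j: "j < b * e" using assms by auto
  show "(kronecker A (B - B')) $$ (i, j) = (kronecker A B - kronecker A B') $$ (i, j)"
    using assms i j less_mult_imp_div_less[OF i] less_mult_imp_div_less[OF j] mod_bound[OF i] mod_bound[OF j]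
    by (simp add: algebra_simps)
qed (use assms in auto)

lemma kronecker_smult_left:
  assumes "A \<in> carrier_mat a b" "B \<in> carrier_mat d e"
  shows "kronecker (c \<cdot>\<^sub>m A) B = c \<cdot>\<^sub>m kronecker A B"
proof (rule eq_matI)
  fix i j assume "i < dim_row (c \<cdot>\<^sub>m kronecker A B)" "j < dim_col (c \<cdot>\<^sub>m kronecker A B)"
  then have i: "i < a * d" and j: "j < b * e" using assms by auto
  show "(kronecker (c \<cdot>\<^sub>m A) B) $$ (i, j) = (c \<cdot>\<^sub>m kronecker A B) $$ (i, j)"
    using assms i j less_mult_imp_div_less[OF i] less_mult_imp_div_less[OF j] mod_bound[OF i] mod_bound[OF j]
    by (simp add: algebra_simps)
qed (use assms in auto)

lemma kronecker_smult_right: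
  assumes "A \<in> carrier_mat a b" "B \<in> carrier_mat d e"
  shows "kronecker A (c \<cdot>\<^sub>m B) = c \<cdot>\<^sub>m kronecker A B"
proof (rule eq_matI)
  fix i j assume "i < dim_row (c \<cdot>\<^sub>m kronecker A B)" "j < dim_col (c \<cdot>\<^sub>m kronecker A B)"
  then have i: "i < a * d" and j: "j < b * e" using assms by auto
  show "(kronecker A (c \<cdot>\<^sub>m B)) $$ (i, j) = (c \<cdot>\<^sub>m kronecker A B) $$ (i, j)"
    using assms i j less_mult_imp_div_less[OF i] less_mult_imp_div_less[OF j] mod_bound[OF i] mod_bound[OF j]
    by (simp add: algebra_simps)
qed (use assms in auto)

lemma kronecker_zero:
  assumes "B \<in> carrier_mat d e"
  shows "kronecker (0\<^sub>m a b) B = 0\<^sub>m (a*d) (b*e)" "kronecker B (0\<^sub>m a b) = 0\<^sub>m (d*a) (e*b)"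
  using assms kronecker_smult_left[OF zero_carrier_mat[of a b] assms, of 0]
    kronecker_smult_right[OF assms zero_carrier_mat[of a b], of 0]
  by (auto intro!: eq_matI simp: less_mult_imp_div_less mod_bound)

lemma sl2_mod_simps [simp]:
  "Ob sl2_mod = sl2_reps"
  "mors sl2_mod V W = sl2_homs V W"
  "add (Mor sl2_mod V W) = (+)"
  "zero (Mor sl2_mod V W) = 0\<^sub>m (fst W) (fst V)"
  "Module.smult (Mor sl2_mod V W) = (\<cdot>\<^sub>m)"
  "Cmp sl2_mod U V W g f = g * f"
  "Idn sl2_mod V = 1\<^sub>m (fst V)"
  "tens_ob sl2_mod = sl2_tensor"
  "tens_mor sl2_mod V V' W W' f g = kronecker f g"
  "unit_ob sl2_mod = (1, \<lambda>A \<in> sl2. 0\<^sub>m 1 1)"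
  "associator sl2_mod U V W = 1\<^sub>m (fst U * fst V * fst W)"
  "left_unitor sl2_mod V = 1\<^sub>m (fst V)"
  "right_unitor sl2_mod V = 1\<^sub>m (fst V)"
  by (simp_all add: sl2_mod_def module_mat_simps)

lemma sl2_add: "A \<in> sl2 \<Longrightarrow> B \<in> sl2 \<Longrightarrow> A + B \<in> sl2"
  by (auto simp: sl2_def numeral_2_eq_2 add_eq_0_iff)

lemma sl2_smult: "A \<in> sl2 \<Longrightarrow> c \<cdot>\<^sub>m A \<in> sl2"
  by (auto simp: sl2_def numeral_2_eq_2 distrib_left[symmetric])

lemma sl2_bracket: "A \<in> sl2 \<Longrightarrow> B \<in> sl2 \<Longrightarrow> lie_bracket A B \<in> sl2"
  by (auto simp: sl2_def lie_bracket_def numeral_2_eq_2 scalar_prod_def algebra_simps)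

lemma sl2_repsD:
  assumes "V \<in> sl2_reps" "A \<in> sl2" "B \<in> sl2"
  shows "snd V A \<in> carrier_mat (fst V) (fst V)"
    "snd V (A + B) = snd V A + snd V B"
    "snd V (c \<cdot>\<^sub>m A) = c \<cdot>\<^sub>m snd V A"
    "snd V (lie_bracket A B) = snd V A * snd V B - snd V B * snd V A"
  using assms by (auto simp: sl2_reps_def lie_bracket_def)

lemma sl2_reps_carrier:
  "V \<in> sl2_reps \<Longrightarrow> A \<in> sl2 \<Longrightarrow> snd V A \<in> carrier_mat (fst V) (fst V)"
  by (rule sl2_repsD(1))

lemma sl2_reps_extensional: "V \<in> sl2_reps \<Longrightarrow> snd V \<in> extensional sl2"
  by (auto simp: sl2_reps_def PiE_def)

lemma sl2_repsI:
  assumes "\<And>A. A \<in> sl2 \<Longrightarrow> \<rho> A \<in> carrier_mat n n"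
    "\<And>A. A \<notin> sl2 \<Longrightarrow> \<rho> A = undefined"
    "\<And>A B. A \<in> sl2 \<Longrightarrow> B \<in> sl2 \<Longrightarrow> \<rho> (A + B) = \<rho> A + \<rho> B"
    "\<And>A c. A \<in> sl2 \<Longrightarrow> \<rho> (c \<cdot>\<^sub>m A) = c \<cdot>\<^sub>m \<rho> A"
    "\<And>A B. A \<in> sl2 \<Longrightarrow> B \<in> sl2 \<Longrightarrow> \<rho> (lie_bracket A B) = \<rho> A * \<rho> B - \<rho> B * \<rho> A"
  shows "(n, \<rho>) \<in> sl2_reps"
  using assms unfolding sl2_reps_def lie_bracket_def[of "_ (_::complex mat)"]
  by (auto simp: PiE_def extensional_def lie_bracket_def)

lemma sl2_L1_rep: "sl2_L1 \<in> sl2_reps"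
  unfolding sl2_L1_def
  by (rule sl2_repsI) (auto simp: sl2_add sl2_smult sl2_bracket, auto simp: sl2_def lie_bracket_def)

lemma sl2_unit_rep: "(1, \<lambda>A \<in> sl2. 0\<^sub>m 1 1) \<in> sl2_reps"
  by (rule sl2_repsI) (auto simp: sl2_add sl2_smult sl2_bracket)

lemma sl2_homs_vectorspace:
  assumes "V \<in> sl2_reps" "W \<in> sl2_reps"
  shows "vectorspace class_ring (Mor sl2_mod V W)"
proof -
  let ?M = "module_mat TYPE(complex) (fst W) (fst V)"
  interpret vectorspace "class_ring :: complex ring" ?M by (rule matrix_vs)
  have "submodule class_ring (sl2_homs V W) ?M"
  proof (unfold_locales, goal_cases)
    case 1
    then show ?case by (auto simp: sl2_homs_def module_mat_simps)
  next
    case (2 f g)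
    then have fg: "f \<in> carrier_mat (fst W) (fst V)" "g \<in> carrier_mat (fst W) (fst V)"
      by (auto simp: sl2_homs_def)
    have "(f + g) * snd V A = snd W A * (f + g)" if "A \<in> sl2" for A
      using 2 that sl2_repsD(1)[OF assms(1) that that] sl2_repsD(1)[OF assms(2) that that] fg
      by (auto simp: sl2_homs_def add_mult_distrib_mat[OF fg] mult_add_distrib_mat[OF _ fg])
    then show ?case using fg by (auto simp: sl2_homs_def module_mat_simps)
  next
    case 3
    have "0\<^sub>m (fst W) (fst V) * snd V A = snd W A * 0\<^sub>m (fst W) (fst V)" if "A \<in> sl2" for A
      using sl2_reps_carrier[OF assms(1) that] sl2_reps_carrier[OF assms(2) that] by simp
    then show ?case by (auto simp: sl2_homs_def module_mat_simps)
  next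
    case (4 c f)
    then have f: "f \<in> carrier_mat (fst W) (fst V)" by (auto simp: sl2_homs_def)
    have "(c \<cdot>\<^sub>m f) * snd V A = snd W A * (c \<cdot>\<^sub>m f)" if "A \<in> sl2" for A
      using 4 that sl2_repsD(1)[OF assms(1) that that] sl2_repsD(1)[OF assms(2) that that] f
      by (simp add: sl2_homs_def mult_smult_distrib mult_smult_assoc_mat)
    then show ?case using f by (auto simp: sl2_homs_def module_mat_simps)
  qed
  then have "VectorSpace.subspace class_ring (sl2_homs V W) ?M"
    by (intro subspace.intro) (rule vectorspace_axioms)
  then show ?thesis
    using subspace_is_vs by (simp add: sl2_mod_def)
qed

lemma sl2_homsD: "f \<in> sl2_homs V W \<Longrightarrow> f \<in> carrier_mat (fst W) (fst V)"
  by (simp add: sl2_homs_def)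

lemma sl2_linear_mapI:
  assumes "V \<in> sl2_reps" "W \<in> sl2_reps" "V' \<in> sl2_reps" "W' \<in> sl2_reps"
    "\<And>f. f \<in> sl2_homs V W \<Longrightarrow> T f \<in> sl2_homs V' W'"
    "\<And>f g. f \<in> sl2_homs V W \<Longrightarrow> g \<in> sl2_homs V W \<Longrightarrow> T (f + g) = T f + T g"
    "\<And>c f. f \<in> sl2_homs V W \<Longrightarrow> T (c \<cdot>\<^sub>m f) = c \<cdot>\<^sub>m T f"
  shows "linear_map class_ring (Mor sl2_mod V W) (Mor sl2_mod V' W') T"
proof -
  have "T \<in> LinearCombinations.module_hom class_ring (Mor sl2_mod V W) (Mor sl2_mod V' W')"
    using assms(5-7) by (auto simp: LinearCombinations.module_hom_def)
  then show ?thesis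
    using sl2_homs_vectorspace[OF assms(1,2)] sl2_homs_vectorspace[OF assms(3,4)]
    by (intro linear_map.intro mod_hom.intro mod_hom_axioms.intro) (auto simp: vectorspace_def)
qed

lemma sl2_homs_comp:
  assumes "U \<in> sl2_reps" "V \<in> sl2_reps" "W \<in> sl2_reps" "f \<in> sl2_homs U V" "g \<in> sl2_homs V W"
  shows "g * f \<in> sl2_homs U W"
proof -
  note c = sl2_homsD[OF assms(4)] sl2_homsD[OF assms(5)]
  have "g * f * snd U A = snd W A * (g * f)" if A: "A \<in> sl2" for A
  proof -
    note r = sl2_repsD(1)[OF assms(1) A A] sl2_repsD(1)[OF assms(2) A A] sl2_repsD(1)[OF assms(3) A A]
    have "g * f * snd U A = g * (f * snd U A)" using c r by (simp add: assoc_mult_mat)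
    also have "\<dots> = g * snd V A * f" using assms(4) A c r by (simp add: sl2_homs_def assoc_mult_mat)
    also have "\<dots> = snd W A * (g * f)" using assms(5) A c r by (simp add: sl2_homs_def assoc_mult_mat)
    finally show ?thesis .
  qed
  then show ?thesis using c by (auto simp: sl2_homs_def)
qed

lemma sl2_homs_one:
  assumes "V \<in> sl2_reps" shows "1\<^sub>m (fst V) \<in> sl2_homs V V"
proof -
  have "1\<^sub>m (fst V) * snd V A = snd V A * 1\<^sub>m (fst V)" if "A \<in> sl2" for A
    using sl2_reps_carrier[OF assms that] by simp
  then show ?thesis by (auto simp: sl2_homs_def)
qed

lemma sl2_category: "linear_category sl2_mod"
proof (rule linear_category.intro, goal_cases)
  case (1 X Y) then show ?case by (simp add: sl2_homs_vectorspace)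
next
  case (2 X) then show ?case by (simp add: sl2_homs_one)
next
  case (3 X Y Z g)
  then have r: "X \<in> sl2_reps" "Y \<in> sl2_reps" "Z \<in> sl2_reps" and g: "g \<in> sl2_homs Y Z" by simp_all
  have "linear_map class_ring (Mor sl2_mod X Y) (Mor sl2_mod X Z) (\<lambda>f. g * f)"
  proof (rule sl2_linear_mapI)
    fix f f' c assume "f \<in> sl2_homs X Y" "f' \<in> sl2_homs X Y"
    then show "g * (f + f') = g * f + g * f'" "g * f \<in> sl2_homs X Z"
      using mult_add_distrib_mat[OF sl2_homsD[OF g] sl2_homsD sl2_homsD] sl2_homs_comp[OF r _ g] by auto
  next
    fix f c assume "f \<in> sl2_homs X Y"
    then show "g * (c \<cdot>\<^sub>m f) = c \<cdot>\<^sub>m (g * f)"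
      by (rule mult_smult_distrib[OF sl2_homsD[OF g] sl2_homsD])
  qed (use r in auto)
  then show ?case by simp
next
  case (4 X Y Z f)
  then have r: "X \<in> sl2_reps" "Y \<in> sl2_reps" "Z \<in> sl2_reps" and f: "f \<in> sl2_homs X Y" by simp_all
  have "linear_map class_ring (Mor sl2_mod Y Z) (Mor sl2_mod X Z) (\<lambda>g. g * f)"
  proof (rule sl2_linear_mapI)
    fix g g' assume "g \<in> sl2_homs Y Z" "g' \<in> sl2_homs Y Z"
    then show "(g + g') * f = g * f + g' * f" "g * f \<in> sl2_homs X Z"
      using add_mult_distrib_mat[OF sl2_homsD sl2_homsD sl2_homsD[OF f]] sl2_homs_comp[OF r f] by auto
  next
    fix g c assume "g \<in> sl2_homs Y Z"
    then show "(c \<cdot>\<^sub>m g) * f = c \<cdot>\<^sub>m (g * f)"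
      by (rule mult_smult_assoc_mat[OF sl2_homsD sl2_homsD[OF f]])
  qed (use r in auto)
  then show ?case by simp
next
  case (7 W X Y Z f g h)
  then show ?case by (auto dest!: sl2_homsD simp: assoc_mult_mat)
qed (auto dest!: sl2_homsD)

lemma sl2_tensor_rep:
  assumes V: "V \<in> sl2_reps" and W: "W \<in> sl2_reps"
  shows "sl2_tensor V W \<in> sl2_reps"
  unfolding sl2_tensor_def
proof (rule sl2_repsI, goal_cases)
  case (1 A)
  then show ?case using sl2_repsD(1)[OF V 1 1] sl2_repsD(1)[OF W 1 1] by auto
next
  case (2 A)
  then show ?case by simp
next
  case (3 A B)
  note r = sl2_repsD(1)[OF V 3(1) 3(1)] sl2_repsD(1)[OF V 3(2) 3(2)]
    sl2_repsD(1)[OF W 3(1) 3(1)] sl2_repsD(1)[OF W 3(2) 3(2)]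
  let ?n = "fst V * fst W"
  have k: "kronecker (snd V A) (1\<^sub>m (fst W)) \<in> carrier_mat ?n ?n"
    "kronecker (snd V B) (1\<^sub>m (fst W)) \<in> carrier_mat ?n ?n"
    "kronecker (1\<^sub>m (fst V)) (snd W A) \<in> carrier_mat ?n ?n"
    "kronecker (1\<^sub>m (fst V)) (snd W B) \<in> carrier_mat ?n ?n" using r by auto
  show ?case
    using 3 r k by (simp add: sl2_add sl2_repsD(2)[OF V] sl2_repsD(2)[OF W]
      kronecker_add_left[OF r(1,2) one_carrier_mat] kronecker_add_right[OF one_carrier_mat r(3,4)])
      (rule eq_matI, auto)
next
  case (4 A c)
  note r = sl2_repsD(1)[OF V 4(1) 4(1)] sl2_repsD(1)[OF W 4(1) 4(1)]
  let ?n = "fst V * fst W"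
  have k: "kronecker (snd V A) (1\<^sub>m (fst W)) \<in> carrier_mat ?n ?n"
    "kronecker (1\<^sub>m (fst V)) (snd W A) \<in> carrier_mat ?n ?n" using r by auto
  show ?case
    using 4 r k by (simp add: sl2_smult sl2_repsD(3)[OF V 4(1) 4(1)] sl2_repsD(3)[OF W 4(1) 4(1)]
      kronecker_smult_left[OF r(1) one_carrier_mat] kronecker_smult_right[OF one_carrier_mat r(2)])
      (rule eq_matI, auto simp: distrib_left)
next
  case (5 A B)
  define m n where "m = fst V" and "n = fst W"
  define R R' S S' where "R = snd V A" and "R' = snd V B" and "S = snd W A" and "S' = snd W B"
  have r: "R \<in> carrier_mat m m" "R' \<in> carrier_mat m m" "S \<in> carrier_mat n n" "S' \<in> carrier_mat n n"
    using sl2_repsD(1)[OF V] sl2_repsD(1)[OF W] 5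
    by (auto simp: m_def n_def R_def R'_def S_def S'_def)
  let ?L = "\<lambda>X. kronecker X (1\<^sub>m n)" and ?K = "\<lambda>Y. kronecker (1\<^sub>m m) Y"
  have prod: "(?L P + ?K Q) * (?L P' + ?K Q') =
      ?L (P * P') + kronecker P' Q + (kronecker P Q' + ?K (Q * Q'))"
    if "P \<in> carrier_mat m m" "Q \<in> carrier_mat n n" "P' \<in> carrier_mat m m" "Q' \<in> carrier_mat n n"
    for P P' Q Q'
  proof -
    have c: "?L P \<in> carrier_mat (m*n) (m*n)" "?K Q \<in> carrier_mat (m*n) (m*n)"
      "?L P' \<in> carrier_mat (m*n) (m*n)" "?K Q' \<in> carrier_mat (m*n) (m*n)" using that by auto
    have "(?L P + ?K Q) * (?L P' + ?K Q') =
        (?L P * ?L P' + ?K Q * ?L P') + (?L P * ?K Q' + ?K Q * ?K Q')"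
      using c by (simp add: add_mult_distrib_mat[of _ "m*n" "m*n"] mult_add_distrib_mat[of _ "m*n" "m*n"])
    then show ?thesis
      using that by (simp add: kronecker_mult[of _ m m _ m _ n n _ n])
  qed
  have cancel: "(X1 - X2) + (Y1 - Y2) = (X1 + Q + (P + Y1)) - (X2 + P + (Q + Y2))"
    if "X1 \<in> carrier_mat k k" "X2 \<in> carrier_mat k k" "Y1 \<in> carrier_mat k k" "Y2 \<in> carrier_mat k k"
      "P \<in> carrier_mat k k" "Q \<in> carrier_mat k k" for X1 X2 Y1 Y2 P Q :: "complex mat" and k
    using that by (intro eq_matI) auto
  have "?L (R * R' - R' * R) + ?K (S * S' - S' * S) =
      (?L (R * R') - ?L (R' * R)) + (?K (S * S') - ?K (S' * S))"
    using r by (simp add: kronecker_minus_left[of _ m m _ _ n n] kronecker_minus_right[of _ m m _ n n])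
  also have "\<dots> = (?L R + ?K S) * (?L R' + ?K S') - (?L R' + ?K S') * (?L R + ?K S)"
    unfolding prod[OF r(1,3,2,4)] prod[OF r(2,4,1,3)]
    by (rule cancel[where k = "m * n"]) (use r in auto)
  finally have "?L (R * R' - R' * R) + ?K (S * S' - S' * S) =
      (?L R + ?K S) * (?L R' + ?K S') - (?L R' + ?K S') * (?L R + ?K S)" .
  then show ?case
    using 5 sl2_repsD(4)[OF V 5(1,2)] sl2_repsD(4)[OF W 5(1,2)]
    by (simp add: sl2_bracket m_def n_def R_def R'_def S_def S'_def)
qed

lemma sl2_tensor_hom:
  assumes "V \<in> sl2_reps" "V' \<in> sl2_reps" "W \<in> sl2_reps" "W' \<in> sl2_reps"
    and f: "f \<in> sl2_homs V V'" and g: "g \<in> sl2_homs W W'"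
  shows "kronecker f g \<in> sl2_homs (sl2_tensor V W) (sl2_tensor V' W')"
proof -
  note c = sl2_homsD[OF f] sl2_homsD[OF g]
  have "kronecker f g * (kronecker (snd V A) (1\<^sub>m (fst W)) + kronecker (1\<^sub>m (fst V)) (snd W A)) =
    (kronecker (snd V' A) (1\<^sub>m (fst W')) + kronecker (1\<^sub>m (fst V')) (snd W' A)) * kronecker f g"
    (is "?F * (?a + ?b) = (?c + ?d) * ?F")
    if A: "A \<in> sl2" for A
  proof -
    note r = sl2_reps_carrier[OF assms(1) A] sl2_reps_carrier[OF assms(2) A]
      sl2_reps_carrier[OF assms(3) A] sl2_reps_carrier[OF assms(4) A]
    have k: "?F \<in> carrier_mat (fst V' * fst W') (fst V * fst W)"
      "?a \<in> carrier_mat (fst V * fst W) (fst V * fst W)" "?b \<in> carrier_mat (fst V * fst W) (fst V * fst W)"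
      "?c \<in> carrier_mat (fst V' * fst W') (fst V' * fst W')"
      "?d \<in> carrier_mat (fst V' * fst W') (fst V' * fst W')"
      using r c by auto
    have "?F * (?a + ?b) = ?F * ?a + ?F * ?b" using k by (simp add: mult_add_distrib_mat)
    also have "?F * ?a = kronecker (f * snd V A) g"
      using kronecker_mult[OF c(1) r(1) c(2) one_carrier_mat] c by simp
    also have "\<dots> = ?c * ?F"
      using kronecker_mult[OF r(2) c(1) one_carrier_mat c(2)] c f A by (simp add: sl2_homs_def)
    also have "?F * ?b = kronecker f (g * snd W A)"
      using kronecker_mult[OF c(1) one_carrier_mat c(2) r(3)] c by simp
    also have "\<dots> = ?d * ?F"
      using kronecker_mult[OF one_carrier_mat c(1) r(4) c(2)] c g A by (simp add: sl2_homs_def)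
    finally show ?thesis using k by (simp add: add_mult_distrib_mat)
  qed
  then show ?thesis using c by (auto simp: sl2_homs_def sl2_tensor_def)
qed

lemma sl2_tensor_assoc:
  assumes "U \<in> sl2_reps" "V \<in> sl2_reps" "W \<in> sl2_reps"
  shows "sl2_tensor (sl2_tensor U V) W = sl2_tensor U (sl2_tensor V W)"
proof -
  have "kronecker (kronecker (snd U A) (1\<^sub>m (fst V)) + kronecker (1\<^sub>m (fst U)) (snd V A)) (1\<^sub>m (fst W)) +
      kronecker (1\<^sub>m (fst U * fst V)) (snd W A) =
      kronecker (snd U A) (1\<^sub>m (fst V * fst W)) +
      kronecker (1\<^sub>m (fst U)) (kronecker (snd V A) (1\<^sub>m (fst W)) + kronecker (1\<^sub>m (fst V)) (snd W A))"
    if A: "A \<in> sl2" for A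
  proof -
    note r = sl2_reps_carrier[OF assms(1) A] sl2_reps_carrier[OF assms(2) A] sl2_reps_carrier[OF assms(3) A]
    let ?u = "fst U" and ?v = "fst V" and ?w = "fst W"
    have l: "kronecker (kronecker (snd U A) (1\<^sub>m ?v) + kronecker (1\<^sub>m ?u) (snd V A)) (1\<^sub>m ?w) =
        kronecker (kronecker (snd U A) (1\<^sub>m ?v)) (1\<^sub>m ?w) + kronecker (kronecker (1\<^sub>m ?u) (snd V A)) (1\<^sub>m ?w)"
      by (rule kronecker_add_left[of _ "?u * ?v" "?u * ?v" _ _ ?w ?w]) (use r in auto)
    have r': "kronecker (1\<^sub>m ?u) (kronecker (snd V A) (1\<^sub>m ?w) + kronecker (1\<^sub>m ?v) (snd W A)) =
        kronecker (1\<^sub>m ?u) (kronecker (snd V A) (1\<^sub>m ?w)) + kronecker (1\<^sub>m ?u) (kronecker (1\<^sub>m ?v) (snd W A))"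
      by (rule kronecker_add_right[of _ ?u ?u _ "?v * ?w" "?v * ?w"]) (use r in auto)
    have "X + Y + Z = X + (Y + Z)"
      if "X \<in> carrier_mat k k" "Y \<in> carrier_mat k k" "Z \<in> carrier_mat k k" for X Y Z :: "complex mat" and k
      using that by (rule assoc_add_mat)
    moreover have "kronecker (snd U A) (kronecker (1\<^sub>m ?v) (1\<^sub>m ?w)) \<in> carrier_mat (?u * (?v * ?w)) (?u * (?v * ?w))"
      "kronecker (1\<^sub>m ?u) (kronecker (snd V A) (1\<^sub>m ?w)) \<in> carrier_mat (?u * (?v * ?w)) (?u * (?v * ?w))"
      "kronecker (1\<^sub>m ?u) (kronecker (1\<^sub>m ?v) (snd W A)) \<in> carrier_mat (?u * (?v * ?w)) (?u * (?v * ?w))"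
      using r by (auto intro!: kronecker_carrier)
    ultimately show ?thesis
      unfolding l r' kronecker_one[symmetric] kronecker_assoc by blast
  qed
  then show ?thesis
    by (auto simp: sl2_tensor_def mult.assoc intro!: restrict_ext)
qed

lemma sl2_tensor_unit:
  assumes "V \<in> sl2_reps"
  shows "sl2_tensor (1, \<lambda>A \<in> sl2. 0\<^sub>m 1 1) V = V" "sl2_tensor V (1, \<lambda>A \<in> sl2. 0\<^sub>m 1 1) = V"
proof -
  obtain n \<rho> where V: "V = (n, \<rho>)" by (cases V)
  have e: "\<rho> \<in> extensional sl2" using sl2_reps_extensional[OF assms] V by simp
  have c: "\<rho> A \<in> carrier_mat n n" if "A \<in> sl2" for A using sl2_reps_carrier[OF assms that] V by simp
  have "kronecker (0\<^sub>m 1 1) (1\<^sub>m n) + kronecker (1\<^sub>m 1) (\<rho> A) = \<rho> A"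
    "kronecker (\<rho> A) (1\<^sub>m 1) + kronecker (1\<^sub>m n) (0\<^sub>m 1 1) = \<rho> A" if "A \<in> sl2" for A
    using c[OF that] kronecker_unit[OF c[OF that]] kronecker_zero[of "1\<^sub>m n :: complex mat" n n 1 1] by simp_all
  then show "sl2_tensor (1, \<lambda>A \<in> sl2. 0\<^sub>m 1 1) V = V" "sl2_tensor V (1, \<lambda>A \<in> sl2. 0\<^sub>m 1 1) = V"
    using e by (auto simp: sl2_tensor_def V restrict_def extensional_def fun_eq_iff)
qed

lemma sl2_one_iso: "V \<in> sl2_reps \<Longrightarrow> 1\<^sub>m (fst V) \<in> isos sl2_mod V V"
  unfolding isos_def using sl2_homs_one[of V] by (auto intro!: bexI[of _ "1\<^sub>m (fst V)"])

lemma sl2_mod_monoidal: "linear_monoidal_category sl2_mod"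
proof -
  have dim: "fst (sl2_tensor V W) = fst V * fst W" for V W by (simp add: sl2_tensor_def)
  show ?thesis
  proof (intro linear_monoidal_category.intro[OF sl2_category] linear_monoidal_category_axioms.intro,
      goal_cases)
    case (3 X X' Y Y' f)
    then have r: "X \<in> sl2_reps" "X' \<in> sl2_reps" "Y \<in> sl2_reps" "Y' \<in> sl2_reps" and f: "f \<in> sl2_homs X X'"
      by simp_all
    have "linear_map class_ring (Mor sl2_mod Y Y') (Mor sl2_mod (sl2_tensor X Y) (sl2_tensor X' Y')) (kronecker f)"
      using r sl2_tensor_rep sl2_tensor_hom[OF r f] kronecker_add_right[OF sl2_homsD[OF f] sl2_homsD sl2_homsD]
        kronecker_smult_right[OF sl2_homsD[OF f] sl2_homsD]
      by (intro sl2_linear_mapI) auto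
    then show ?case by simp
  next
    case (4 X X' Y Y' g)
    then have r: "X \<in> sl2_reps" "X' \<in> sl2_reps" "Y \<in> sl2_reps" "Y' \<in> sl2_reps" and g: "g \<in> sl2_homs Y Y'"
      by simp_all
    have "linear_map class_ring (Mor sl2_mod X X') (Mor sl2_mod (sl2_tensor X Y) (sl2_tensor X' Y'))
        (\<lambda>f. kronecker f g)"
      using r sl2_tensor_rep sl2_tensor_hom[OF r _ g] kronecker_add_left[OF sl2_homsD sl2_homsD sl2_homsD[OF g]]
        kronecker_smult_left[OF sl2_homsD sl2_homsD[OF g]]
      by (intro sl2_linear_mapI) auto
    then show ?case by simp
  next
    case (6 X X' X'' Y Y' Y'' f f' g g')
    then show ?case by (auto dest!: sl2_homsD simp: kronecker_mult)
  next
    case (7 X Y Z)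
    then show ?case
      using sl2_one_iso[of "sl2_tensor X (sl2_tensor Y Z)"]
      by (simp add: sl2_tensor_assoc sl2_tensor_rep dim mult.assoc)
  next
    case (8 X X' Y Y' Z Z' f g h)
    then have "kronecker f (kronecker g h) \<in> carrier_mat (fst X' * fst Y' * fst Z') (fst X * fst Y * fst Z)"
      using kronecker_carrier[OF sl2_homsD[of f X X'] kronecker_carrier[OF sl2_homsD[of g Y Y'] sl2_homsD[of h Z Z']]]
      by (simp add: mult.assoc)
    from left_mult_one_mat[OF this] right_mult_one_mat[OF this]
    show ?case by (simp add: kronecker_assoc)
  next
    case (9 X)
    then show ?case by (simp add: sl2_tensor_unit[simplified] sl2_one_iso)
  next
    case (10 X Y f)
    then show ?case using kronecker_unit[OF sl2_homsD[of f X Y]] by (auto dest!: sl2_homsD)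
  next
    case (11 X)
    then show ?case by (simp add: sl2_tensor_unit[simplified] sl2_one_iso)
  next
    case (12 X Y f)
    then show ?case using kronecker_unit[OF sl2_homsD[of f X Y]] by (auto dest!: sl2_homsD)
  qed (simp_all add: sl2_tensor_rep sl2_unit_rep[simplified] kronecker_one dim mult.assoc)
qed

end

theory Submission
  imports Defs "HOL-Library.Function_Algebras"
begin

text \<open>
  Write \<open>F\<close> for the action of \<open>L(1)\<close> and \<open>L\<^sub>c\<close> for the simple functor \<open>Hom(-, P c) / rad\<close>, where
  \<open>P 0, P 1, \<dots>\<close> are the indecomposables.  By type \<open>T\<^sub>\<infinity>\<close>, the functor \<open>L\<^sub>c F\<close> has two non-isomorphic
  composition factors, namely \<open>L\<^sub>a\<close> for the two neighbours \<open>a\<close> of \<open>c\<close>.  As \<open>F\<close> is self-adjoint, \<open>L\<^sub>a\<close> is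
  in the socle of \<open>L\<^sub>c F\<close> if and only if \<open>L\<^sub>c\<close> is in the top of \<open>L\<^sub>a F\<close>.  For \<open>c = 0\<close> this excludes that
  \<open>L\<^sub>0 F\<close>, with factors \<open>L\<^sub>0\<close> and \<open>L\<^sub>1\<close>, is uniserial; inductively, since \<open>L\<^sub>c F\<close> is semisimple, \<open>L\<^sub>c\<close> is in
  the top and in the socle of the functor \<open>L\<^sub>d F\<close> for \<open>d = c + 1\<close>, which is therefore semisimple as well.
  So \<open>F\<close> preserves the radical.  By complete reducibility every finite dimensional module is a
  summand of a sum of tensor powers of \<open>L(1)\<close>; hence the radical is an invariant ideal, and it is
  zero by simple transitivity.
\<close>

section \<open>The radical of a linear category\<close>

text \<open>No functor category is formed. An element of \<open>L\<^sub>c F\<close> at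
  \<open>Z\<close> is a morphism \<open>F Z -> P c\<close> modulo radical ones, so
  \<open>L\<^sub>c F\<close> is semisimple if and only if \<open>v (F j)\<close> is radical for
  every such \<open>v\<close> and every radical \<open>j\<close>. Self-adjointness alone does not
  give this: it only trades a simple subfunctor of one \<open>L\<^sub>c F\<close> for a simple
  quotient of another. The induction can start because the vertex 0 carries a loop: were
  \<open>L\<^sub>0\<close> the socle of a uniserial \<open>L\<^sub>0 F\<close>, it would be its top
  as well, although it occurs only once. The other order of the factors is the same statement in the
  opposite category. Complete reducibility takes the form that the identity of a module is a sum of
  maps through tensor powers of \<open>L(1)\<close>. The weights come from
  \<open>E^k F^k w = k! H (H - 1) ... (H - k + 1) w\<close> for \<open>E w = 0\<close>: as
  \<open>F\<close> is nilpotent, this polynomial in \<open>H\<close> vanishes on the kernel of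
  \<open>E\<close> for large \<open>k\<close>.\<close>

context abelian_group
begin

lemma minus_add_cancel: "x \<in> carrier G \<Longrightarrow> y \<in> carrier G \<Longrightarrow> (x \<ominus> y) \<oplus> y = x"
  by (simp add: minus_eq a_assoc l_neg)

lemma minus_trans: "x \<in> carrier G \<Longrightarrow> y \<in> carrier G \<Longrightarrow> z \<in> carrier G \<Longrightarrow> x \<ominus> z = (x \<ominus> y) \<oplus> (y \<ominus> z)"
  by (simp add: minus_eq a_assoc) (simp add: a_assoc[symmetric] l_neg)

lemma minus_add_minus: "x \<in> carrier G \<Longrightarrow> y \<in> carrier G \<Longrightarrow> z \<in> carrier G \<Longrightarrow> x \<ominus> (y \<oplus> z) = (x \<ominus> y) \<ominus> z"
  by (simp add: minus_eq a_assoc minus_add)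

lemma minus_minus_cancel: "x \<in> carrier G \<Longrightarrow> y \<in> carrier G \<Longrightarrow> x \<ominus> (x \<ominus> y) = y"
  by (simp add: minus_eq minus_add) (simp add: a_assoc[symmetric] r_neg)

lemma minus_zero_right: "x \<in> carrier G \<Longrightarrow> x \<ominus> \<zero> = x"
  by (simp add: minus_eq)

lemma minus_self: "x \<in> carrier G \<Longrightarrow> x \<ominus> x = \<zero>"
  by (simp add: minus_eq r_neg)

lemma minus_eq_zero: "x \<in> carrier G \<Longrightarrow> y \<in> carrier G \<Longrightarrow> x \<ominus> y = \<zero> \<longleftrightarrow> x = y"
  by (metis minus_add_cancel l_zero minus_eq r_neg)

end

context linear_category
begin

lemma hom_abelian_group: "X \<in> Ob C \<Longrightarrow> Y \<in> Ob C \<Longrightarrow> abelian_group (Mor C X Y)"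
  using hom_vectorspace[of X Y] by (simp add: vectorspace_def Module.module_def)

lemma comp_closed [simp, intro]:
  assumes "X \<in> Ob C" "Y \<in> Ob C" "Z \<in> Ob C" "f \<in> mors C X Y" "g \<in> mors C Y Z"
  shows "Cmp C X Y Z g f \<in> mors C X Z"
proof -
  interpret linear_map class_ring "Mor C X Y" "Mor C X Z" "\<lambda>f. Cmp C X Y Z g f"
    using assms by (intro comp_linear_right)
  show ?thesis using assms by auto
qed

lemma comp_add_right:
  assumes "X \<in> Ob C" "Y \<in> Ob C" "Z \<in> Ob C" "f \<in> mors C X Y" "f' \<in> mors C X Y" "g \<in> mors C Y Z"
  shows "Cmp C X Y Z g (f \<oplus>\<^bsub>Mor C X Y\<^esub> f') = Cmp C X Y Z g f \<oplus>\<^bsub>Mor C X Z\<^esub> Cmp C X Y Z g f'"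
  using assms by (intro linear_map.T_add[OF comp_linear_right])

lemma comp_add_left:
  assumes "X \<in> Ob C" "Y \<in> Ob C" "Z \<in> Ob C" "f \<in> mors C X Y" "g \<in> mors C Y Z" "g' \<in> mors C Y Z"
  shows "Cmp C X Y Z (g \<oplus>\<^bsub>Mor C Y Z\<^esub> g') f = Cmp C X Y Z g f \<oplus>\<^bsub>Mor C X Z\<^esub> Cmp C X Y Z g' f"
  using assms by (intro linear_map.T_add[OF comp_linear_left])

lemma comp_minus_right:
  assumes "X \<in> Ob C" "Y \<in> Ob C" "Z \<in> Ob C" "f \<in> mors C X Y" "f' \<in> mors C X Y" "g \<in> mors C Y Z"
  shows "Cmp C X Y Z g (f \<ominus>\<^bsub>Mor C X Y\<^esub> f') = Cmp C X Y Z g f \<ominus>\<^bsub>Mor C X Z\<^esub> Cmp C X Y Z g f'"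
  using assms by (intro linear_map.T_minus[OF comp_linear_right])

lemma comp_minus_left:
  assumes "X \<in> Ob C" "Y \<in> Ob C" "Z \<in> Ob C" "f \<in> mors C X Y" "g \<in> mors C Y Z" "g' \<in> mors C Y Z"
  shows "Cmp C X Y Z (g \<ominus>\<^bsub>Mor C Y Z\<^esub> g') f = Cmp C X Y Z g f \<ominus>\<^bsub>Mor C X Z\<^esub> Cmp C X Y Z g' f"
  using assms by (intro linear_map.T_minus[OF comp_linear_left])

lemma comp_smult_right:
  assumes "X \<in> Ob C" "Y \<in> Ob C" "Z \<in> Ob C" "f \<in> mors C X Y" "g \<in> mors C Y Z"
  shows "Cmp C X Y Z g (a \<odot>\<^bsub>Mor C X Y\<^esub> f) = a \<odot>\<^bsub>Mor C X Z\<^esub> Cmp C X Y Z g f"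
  using assms by (intro linear_map.T_smult[OF comp_linear_right]) auto

lemma comp_smult_left:
  assumes "X \<in> Ob C" "Y \<in> Ob C" "Z \<in> Ob C" "f \<in> mors C X Y" "g \<in> mors C Y Z"
  shows "Cmp C X Y Z (a \<odot>\<^bsub>Mor C Y Z\<^esub> g) f = a \<odot>\<^bsub>Mor C X Z\<^esub> Cmp C X Y Z g f"
  using assms by (intro linear_map.T_smult[OF comp_linear_left]) auto

lemma comp_zero_right:
  assumes "X \<in> Ob C" "Y \<in> Ob C" "Z \<in> Ob C" "g \<in> mors C Y Z"
  shows "Cmp C X Y Z g (zero_mor C X Y) = zero_mor C X Z"
  using assms by (intro linear_map.T0_is_0[OF comp_linear_right])

lemma comp_zero_left:
  assumes "X \<in> Ob C" "Y \<in> Ob C" "Z \<in> Ob C" "f \<in> mors C X Y"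
  shows "Cmp C X Y Z (zero_mor C Y Z) f = zero_mor C X Z"
  using assms by (intro linear_map.T0_is_0[OF comp_linear_left])

lemma zero_closed: "X \<in> Ob C \<Longrightarrow> Y \<in> Ob C \<Longrightarrow> zero_mor C X Y \<in> mors C X Y"
  using abelian_group.axioms(1)[OF hom_abelian_group] by (rule abelian_monoid.zero_closed)

lemma add_closed: "X \<in> Ob C \<Longrightarrow> Y \<in> Ob C \<Longrightarrow> f \<in> mors C X Y \<Longrightarrow> g \<in> mors C X Y \<Longrightarrow>
    f \<oplus>\<^bsub>Mor C X Y\<^esub> g \<in> mors C X Y"
  using abelian_group.axioms(1)[OF hom_abelian_group] by (rule abelian_monoid.a_closed)

lemma minus_closed: "X \<in> Ob C \<Longrightarrow> Y \<in> Ob C \<Longrightarrow> f \<in> mors C X Y \<Longrightarrow> g \<in> mors C X Y \<Longrightarrow>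
    f \<ominus>\<^bsub>Mor C X Y\<^esub> g \<in> mors C X Y"
  using hom_abelian_group by (rule abelian_group.minus_closed)

lemma smult_closed: "X \<in> Ob C \<Longrightarrow> Y \<in> Ob C \<Longrightarrow> f \<in> mors C X Y \<Longrightarrow> a \<odot>\<^bsub>Mor C X Y\<^esub> f \<in> mors C X Y"
  using hom_vectorspace[of X Y] by (auto simp: vectorspace_def intro: module.smult_closed)

lemmas closed [simp, intro] = comp_closed zero_closed add_closed minus_closed smult_closed id_closed

lemma comp_finsum_right:
  assumes "X \<in> Ob C" "Y \<in> Ob C" "Z \<in> Ob C" "finite I" "\<And>i. i \<in> I \<Longrightarrow> f i \<in> mors C X Y" "g \<in> mors C Y Z"
  shows "Cmp C X Y Z g (\<Oplus>\<^bsub>Mor C X Y\<^esub>i\<in>I. f i) = (\<Oplus>\<^bsub>Mor C X Z\<^esub>i\<in>I. Cmp C X Y Z g (f i))"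
proof -
  interpret S: abelian_group "Mor C X Y" using assms by (intro hom_abelian_group)
  interpret T: abelian_group "Mor C X Z" using assms by (intro hom_abelian_group)
  show ?thesis using assms(4,5)
  proof (induction I)
    case empty
    then show ?case using assms by (simp add: comp_zero_right)
  next
    case (insert i I)
    then have "f \<in> I \<rightarrow> mors C X Y" "f i \<in> mors C X Y" by auto
    with insert assms show ?case by (subst S.finsum_insert T.finsum_insert; (simp add: comp_add_right closed Pi_def)?)+
  qed
qed

lemma comp_finsum_left:
  assumes "X \<in> Ob C" "Y \<in> Ob C" "Z \<in> Ob C" "finite I" "\<And>i. i \<in> I \<Longrightarrow> g i \<in> mors C Y Z" "f \<in> mors C X Y"
  shows "Cmp C X Y Z (\<Oplus>\<^bsub>Mor C Y Z\<^esub>i\<in>I. g i) f = (\<Oplus>\<^bsub>Mor C X Z\<^esub>i\<in>I. Cmp C X Y Z (g i) f)"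
proof -
  interpret S: abelian_group "Mor C Y Z" using assms by (intro hom_abelian_group)
  interpret T: abelian_group "Mor C X Z" using assms by (intro hom_abelian_group)
  show ?thesis using assms(4,5)
  proof (induction I)
    case empty
    then show ?case using assms by (simp add: comp_zero_left)
  next
    case (insert i I)
    then have "g \<in> I \<rightarrow> mors C Y Z" "g i \<in> mors C Y Z" by auto
    with insert assms show ?case by (subst S.finsum_insert T.finsum_insert; (simp add: comp_add_left closed Pi_def)?)+
  qed
qed

lemma isosI:
  "\<lbrakk>f \<in> mors C X Y; g \<in> mors C Y X; Cmp C X Y X g f = Idn C X; Cmp C Y X Y f g = Idn C Y\<rbrakk> \<Longrightarrow> f \<in> isos C X Y"
  by (auto simp: isos_def)

lemma isosE:
  assumes "f \<in> isos C X Y"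
  obtains g where "f \<in> mors C X Y" "g \<in> mors C Y X" "g \<in> isos C Y X"
    "Cmp C X Y X g f = Idn C X" "Cmp C Y X Y f g = Idn C Y"
  using assms by (auto simp: isos_def)

lemma isos_hom: "f \<in> isos C X Y \<Longrightarrow> f \<in> mors C X Y"
  by (auto simp: isos_def)


lemma comp_assoc_right:
  "\<lbrakk>W \<in> Ob C; X \<in> Ob C; Y \<in> Ob C; Z \<in> Ob C;
    f \<in> mors C W X; g \<in> mors C X Y; h \<in> mors C Y Z\<rbrakk>
    \<Longrightarrow> Cmp C W X Z (Cmp C X Y Z h g) f = Cmp C W Y Z h (Cmp C W X Y g f)"
  by (simp add: comp_assoc)

lemma comp_cancel:
  "\<lbrakk>Cmp C X Y X g f = Idn C X; X \<in> Ob C; Y \<in> Ob C; f \<in> mors C X Y; g \<in> mors C Y X;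
    W \<in> Ob C; h \<in> mors C W X\<rbrakk> \<Longrightarrow> Cmp C W Y X g (Cmp C W X Y f h) = h"
  by (simp add: comp_assoc comp_id_left)

lemma id_iso: "X \<in> Ob C \<Longrightarrow> Idn C X \<in> isos C X X"
  by (rule isosI[where g = "Idn C X"]) (auto simp: comp_id_left)

lemma comp_iso:
  assumes X: "X \<in> Ob C" "Y \<in> Ob C" "Z \<in> Ob C" "f \<in> isos C X Y" "g \<in> isos C Y Z"
  shows "Cmp C X Y Z g f \<in> isos C X Z"
proof -
  obtain f' where f: "f \<in> mors C X Y" "f' \<in> mors C Y X" "Cmp C X Y X f' f = Idn C X" "Cmp C Y X Y f f' = Idn C Y"
    using assms(4) by (rule isosE)
  obtain g' where g: "g \<in> mors C Y Z" "g' \<in> mors C Z Y" "Cmp C Y Z Y g' g = Idn C Y" "Cmp C Z Y Z g g' = Idn C Z"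
    using assms(5) by (rule isosE)
  show ?thesis
    by (rule isosI[where g = "Cmp C Z Y X f' g'"])
      (use X f g in \<open>simp_all add: comp_assoc_right comp_cancel[of Y Z] comp_cancel[of Y X]\<close>)
qed

text \<open>The inverse of \<open>1 - a b\<close> is \<open>1 + a u b\<close>, where \<open>u\<close> is the inverse of \<open>1 - b a\<close>.\<close>

lemma id_minus_comp_iso:
  assumes X: "X \<in> Ob C" "Y \<in> Ob C" and a: "a \<in> mors C X Y" and b: "b \<in> mors C Y X"
    and iso: "Idn C X \<ominus>\<^bsub>Mor C X X\<^esub> Cmp C X Y X b a \<in> isos C X X"
  shows "Idn C Y \<ominus>\<^bsub>Mor C Y Y\<^esub> Cmp C Y X Y a b \<in> isos C Y Y"
proof -
  interpret A: abelian_group "Mor C Y Y" using X by (intro hom_abelian_group)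
  interpret B: abelian_group "Mor C X Y" using X by (intro hom_abelian_group)
  interpret D: abelian_group "Mor C Y X" using X by (intro hom_abelian_group)
  let ?v = "Idn C X \<ominus>\<^bsub>Mor C X X\<^esub> Cmp C X Y X b a" and ?w = "Idn C Y \<ominus>\<^bsub>Mor C Y Y\<^esub> Cmp C Y X Y a b"
  obtain u where u: "u \<in> mors C X X" "Cmp C X X X u ?v = Idn C X" "Cmp C X X X ?v u = Idn C X"
    using iso by (rule isosE)
  have v: "?v \<in> mors C X X" and w: "?w \<in> mors C Y Y" using X a b by auto
  \<comment> \<open>\<open>(1 - a b) a = a (1 - b a)\<close>, and likewise for \<open>b\<close>:
    these identities bring \<open>?v\<close> next to its inverse \<open>u\<close>, and both products
    of \<open>?w\<close> with \<open>?t\<close> collapse to \<open>a b\<close>.\<close>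
  have wa: "Cmp C X Y Y ?w a = Cmp C X X Y a ?v"
    using X a b by (simp add: comp_minus_left comp_minus_right comp_id_left comp_id_right comp_assoc)
  have bw: "Cmp C Y Y X b ?w = Cmp C Y X X ?v b"
    using X a b by (simp add: comp_minus_left comp_minus_right comp_id_left comp_id_right comp_assoc)
  let ?t = "Cmp C Y X Y a (Cmp C Y X X u b)"
  have t: "?t \<in> mors C Y Y" using X a b u by auto
  have "Cmp C Y Y Y ?w ?t = Cmp C Y X Y (Cmp C X Y Y ?w a) (Cmp C Y X X u b)"
    using X a b u w by (simp add: comp_assoc)
  also have "\<dots> = Cmp C Y X Y a (Cmp C Y X X ?v (Cmp C Y X X u b))"
    unfolding wa using X a b u v by (simp add: comp_assoc_right)
  also have "\<dots> = Cmp C Y X Y a b" using X a b u v by (simp add: comp_cancel)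
  finally have 1: "Cmp C Y Y Y ?w (Idn C Y \<oplus>\<^bsub>Mor C Y Y\<^esub> ?t) = Idn C Y"
    using X a b u w t by (simp add: comp_add_right comp_id_right A.minus_add_cancel)
  have "Cmp C Y Y Y ?t ?w = Cmp C Y X Y a (Cmp C Y X X u (Cmp C Y Y X b ?w))"
    using X a b u w by (simp add: comp_assoc_right)
  also have "\<dots> = Cmp C Y X Y a b" unfolding bw using X a b u v by (simp add: comp_cancel)
  finally have 2: "Cmp C Y Y Y (Idn C Y \<oplus>\<^bsub>Mor C Y Y\<^esub> ?t) ?w = Idn C Y"
    using X a b u w t by (simp add: comp_add_left comp_id_left A.minus_add_cancel)
  show ?thesis by (rule isosI[OF w _ 2 1]) (use X t in auto)
qed

section \<open>The radical as a two-sided ideal\<close>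

abbreviation (input) "J \<equiv> radical C"

lemma rad_hom: "f \<in> J X Y \<Longrightarrow> f \<in> mors C X Y"
  by (simp add: radical_def)

text \<open>Left-right symmetry, from \<open>id_minus_comp_iso\<close>. Closure under composition on
  the left is visible in the definition, closure on the right in this form.\<close>

lemma radical_alt:
  assumes "X \<in> Ob C" "Y \<in> Ob C"
  shows "J X Y = {f \<in> mors C X Y. \<forall>g \<in> mors C Y X. Idn C Y \<ominus>\<^bsub>Mor C Y Y\<^esub> Cmp C Y X Y f g \<in> isos C Y Y}"
  using assms id_minus_comp_iso[of X Y] id_minus_comp_iso[of Y X] by (auto simp: radical_def)

lemma rad_comp_left:
  assumes X: "X \<in> Ob C" "Y \<in> Ob C" "Z \<in> Ob C" and f: "f \<in> J X Y" and g: "g \<in> mors C Y Z"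
  shows "Cmp C X Y Z g f \<in> J X Z"
proof -
  have "Idn C X \<ominus>\<^bsub>Mor C X X\<^esub> Cmp C X Z X h (Cmp C X Y Z g f) \<in> isos C X X" if h: "h \<in> mors C Z X" for h
  proof -
    have "Idn C X \<ominus>\<^bsub>Mor C X X\<^esub> Cmp C X Y X (Cmp C Y Z X h g) f \<in> isos C X X"
      using X f g h unfolding radical_def by blast
    then show ?thesis using X g h rad_hom[OF f] by (simp add: comp_assoc)
  qed
  then show ?thesis using X g rad_hom[OF f] unfolding radical_def by auto
qed

lemma rad_comp_right:
  assumes X: "X \<in> Ob C" "Y \<in> Ob C" "Z \<in> Ob C" and f: "f \<in> mors C X Y" and g: "g \<in> J Y Z"
  shows "Cmp C X Y Z g f \<in> J X Z"
proof -
  have "Idn C Z \<ominus>\<^bsub>Mor C Z Z\<^esub> Cmp C Z X Z (Cmp C X Y Z g f) h \<in> isos C Z Z" if h: "h \<in> mors C Z X" for h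
  proof -
    have "Idn C Z \<ominus>\<^bsub>Mor C Z Z\<^esub> Cmp C Z Y Z g (Cmp C Z X Y f h) \<in> isos C Z Z"
      using X f g h unfolding radical_alt[OF X(2,3)] by blast
    then show ?thesis using X f h rad_hom[OF g] by (simp add: comp_assoc)
  qed
  then show ?thesis using X f rad_hom[OF g] unfolding radical_alt[OF X(1,3)] by auto
qed

lemma rad_zero:
  assumes X: "X \<in> Ob C" "Y \<in> Ob C"
  shows "zero_mor C X Y \<in> J X Y"
proof -
  interpret A: abelian_group "Mor C X X" using X by (intro hom_abelian_group)
  show ?thesis using X by (simp add: radical_def comp_zero_right A.minus_zero_right id_iso)
qed

text \<open>With \<open>u = 1 - g f\<close> invertible,
  \<open>1 - g (f + f') = u (1 - u' g f')\<close>, where \<open>u'\<close> is the inverse of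
  \<open>u\<close>; this is a product of two isomorphisms.\<close>

lemma rad_add:
  assumes X: "X \<in> Ob C" "Y \<in> Ob C" and f: "f \<in> J X Y" and f': "f' \<in> J X Y"
  shows "f \<oplus>\<^bsub>Mor C X Y\<^esub> f' \<in> J X Y"
proof -
  interpret A: abelian_group "Mor C X X" using X by (intro hom_abelian_group)
  note m = rad_hom[OF f] rad_hom[OF f']
  have "Idn C X \<ominus>\<^bsub>Mor C X X\<^esub> Cmp C X Y X g (f \<oplus>\<^bsub>Mor C X Y\<^esub> f') \<in> isos C X X" if g: "g \<in> mors C Y X" for g
  proof -
    let ?u = "Idn C X \<ominus>\<^bsub>Mor C X X\<^esub> Cmp C X Y X g f"
    have u: "?u \<in> isos C X X" using f g by (simp add: radical_def)
    then obtain u' where u': "?u \<in> mors C X X" "u' \<in> mors C X X" "Cmp C X X X ?u u' = Idn C X" by (rule isosE)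
    have "Idn C X \<ominus>\<^bsub>Mor C X X\<^esub> Cmp C X Y X (Cmp C Y X X u' g) f' \<in> isos C X X"
      using X f' g u' unfolding radical_def by blast
    from comp_iso[OF X(1) X(1) X(1) this u]
    have "Cmp C X X X ?u (Idn C X \<ominus>\<^bsub>Mor C X X\<^esub> Cmp C X X X u' (Cmp C X Y X g f')) \<in> isos C X X"
      using X m g u' by (simp add: comp_assoc)
    also have "Cmp C X X X ?u (Idn C X \<ominus>\<^bsub>Mor C X X\<^esub> Cmp C X X X u' (Cmp C X Y X g f')) =
        ?u \<ominus>\<^bsub>Mor C X X\<^esub> Cmp C X Y X g f'"
      using X m g u' by (subst comp_minus_right) (simp_all add: comp_id_right comp_cancel)
    finally show ?thesis using X m g by (simp add: comp_add_right A.minus_add_minus)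
  qed
  then show ?thesis using X m unfolding radical_def by auto
qed

lemma rad_smult:
  assumes X: "X \<in> Ob C" "Y \<in> Ob C" and f: "f \<in> J X Y"
  shows "a \<odot>\<^bsub>Mor C X Y\<^esub> f \<in> J X Y"
proof -
  have "Cmp C X Y Y (a \<odot>\<^bsub>Mor C Y Y\<^esub> Idn C Y) f = a \<odot>\<^bsub>Mor C X Y\<^esub> f"
    using X rad_hom[OF f] by (simp add: comp_smult_left comp_id_left)
  then show ?thesis using rad_comp_left[OF X(1) X(2) X(2) f, of "a \<odot>\<^bsub>Mor C Y Y\<^esub> Idn C Y"] X by auto
qed

lemma rad_submodule:
  assumes X: "X \<in> Ob C" "Y \<in> Ob C"
  shows "submodule class_ring (J X Y) (Mor C X Y)"
  using hom_vectorspace[OF X] X rad_hom[of _ X Y]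
  by (auto intro!: submodule.intro rad_add rad_zero rad_smult simp: vectorspace_def)

lemma rad_ideal: "category_ideal C J"
  unfolding category_ideal_def
  using hom_vectorspace rad_submodule rad_comp_left rad_comp_right
  by (auto intro!: subspace.intro)

lemma rad_finsum:
  assumes X: "X \<in> Ob C" "Y \<in> Ob C" and "finite I" and "\<And>i. i \<in> I \<Longrightarrow> f i \<in> J X Y"
  shows "(\<Oplus>\<^bsub>Mor C X Y\<^esub>i\<in>I. f i) \<in> J X Y"
proof -
  interpret A: abelian_group "Mor C X Y" using X by (intro hom_abelian_group)
  show ?thesis using assms(3,4)
  proof (induction I)
    case (insert i I)
    then have "f \<in> I \<rightarrow> mors C X Y" "f i \<in> mors C X Y" using rad_hom by auto
    with insert X show ?case by (simp add: rad_add)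
  qed (simp add: X rad_zero)
qed

end

section \<open>Local endomorphism rings and congruence modulo the radical\<close>

context linear_category
begin

text \<open>\<open>f\<close> and \<open>1 - f\<close> add up to the unit 1, so they are not both
  non-units.\<close>

lemma local_split:
  assumes X: "X \<in> Ob C" "local_endomorphism_ring C X" and f: "f \<in> mors C X X"
  shows "f \<in> isos C X X \<or> Idn C X \<ominus>\<^bsub>Mor C X X\<^esub> f \<in> isos C X X"
proof -
  interpret A: abelian_group "Mor C X X" using X by (intro hom_abelian_group)
  have "(Idn C X \<ominus>\<^bsub>Mor C X X\<^esub> f) \<oplus>\<^bsub>Mor C X X\<^esub> f = Idn C X"
    using X f by (simp add: A.minus_add_cancel)
  then show ?thesis
    using X f id_iso[OF X(1)] minus_closed[OF X(1,1) id_closed[OF X(1)] f]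
    unfolding local_endomorphism_ring_def by (metis DiffI)
qed

lemma iso_idem:
  assumes X: "X \<in> Ob C" and e: "e \<in> isos C X X" "Cmp C X X X e e = e"
  shows "e = Idn C X"
proof -
  obtain g where "e \<in> mors C X X" "g \<in> mors C X X" "Cmp C X X X g e = Idn C X"
    using e(1) by (rule isosE)
  then show ?thesis using comp_cancel[of X X g e X e] X e by simp
qed

text \<open>Either \<open>e\<close> or \<open>1 - e\<close> is invertible, and an invertible
  idempotent is the identity.\<close>

lemma local_idem:
  assumes X: "X \<in> Ob C" "local_endomorphism_ring C X" and e: "e \<in> mors C X X" "Cmp C X X X e e = e"
  shows "e = Idn C X \<or> e = zero_mor C X X"
  using local_split[OF X e(1)]
proof
  assume "e \<in> isos C X X"
  then show ?thesis using iso_idem X e by blast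
next
  interpret A: abelian_group "Mor C X X" using X by (intro hom_abelian_group)
  assume "Idn C X \<ominus>\<^bsub>Mor C X X\<^esub> e \<in> isos C X X"
  moreover have "Cmp C X X X (Idn C X \<ominus>\<^bsub>Mor C X X\<^esub> e) (Idn C X \<ominus>\<^bsub>Mor C X X\<^esub> e) = Idn C X \<ominus>\<^bsub>Mor C X X\<^esub> e"
    using X e by (simp add: comp_minus_left comp_minus_right comp_id_left comp_id_right A.minus_zero_right
      A.minus_self)
  ultimately have "Idn C X \<ominus>\<^bsub>Mor C X X\<^esub> e = Idn C X" using iso_idem X by blast
  then have "e = zero_mor C X X"
    using A.minus_minus_cancel[of "Idn C X" e] X e by (simp add: A.minus_self)
  then show ?thesis ..
qed

lemma local_id_nonzero: "local_endomorphism_ring C X \<Longrightarrow> Idn C X \<noteq> zero_mor C X X"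
  by (simp add: local_endomorphism_ring_def)

lemma iso_not_rad:
  assumes X: "X \<in> Ob C" "Y \<in> Ob C" "Idn C X \<noteq> zero_mor C X X" and f: "f \<in> isos C X Y"
  shows "f \<notin> J X Y"
proof
  interpret A: abelian_group "Mor C X X" using X by (intro hom_abelian_group)
  assume "f \<in> J X Y"
  moreover obtain g where g: "g \<in> mors C Y X" "Cmp C X Y X g f = Idn C X" using f by (rule isosE)
  ultimately have "Idn C X \<ominus>\<^bsub>Mor C X X\<^esub> Idn C X \<in> isos C X X" by (metis (no_types, lifting) mem_Collect_eq radical_def)
  then have "zero_mor C X X \<in> isos C X X" using X by (simp add: A.minus_self)
  then obtain h where "h \<in> mors C X X" "Cmp C X X X h (zero_mor C X X) = Idn C X" by (rule isosE)
  then show False using X by (simp add: comp_zero_right)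
qed

lemma id_not_rad: "X \<in> Ob C \<Longrightarrow> local_endomorphism_ring C X \<Longrightarrow> Idn C X \<notin> J X X"
  using iso_not_rad id_iso local_id_nonzero by blast

text \<open>Some \<open>1 - f g\<close> is not invertible, so \<open>f g\<close> is, by locality.
  Arguments by contradiction use this to turn a non-radical morphism into an equation with an
  identity.\<close>

lemma not_rad_section:
  assumes X: "X \<in> Ob C" "Y \<in> Ob C" and loc: "local_endomorphism_ring C Y" and f: "f \<in> mors C X Y" "f \<notin> J X Y"
  obtains s where "s \<in> mors C Y X" "Cmp C Y X Y f s = Idn C Y"
proof -
  obtain g where g: "g \<in> mors C Y X" "Idn C Y \<ominus>\<^bsub>Mor C Y Y\<^esub> Cmp C Y X Y f g \<notin> isos C Y Y"
    using f X unfolding radical_alt[OF X] by auto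
  then have "Cmp C Y X Y f g \<in> isos C Y Y"
    using local_split[OF X(2) loc, of "Cmp C Y X Y f g"] X f by auto
  then obtain u where u: "u \<in> mors C Y Y" "Cmp C Y Y Y (Cmp C Y X Y f g) u = Idn C Y" by (rule isosE)
  show thesis by (rule that[of "Cmp C Y Y X g u"]) (use X f g u in \<open>simp_all add: comp_assoc\<close>)
qed

lemma not_rad_retraction:
  assumes X: "X \<in> Ob C" "Y \<in> Ob C" and loc: "local_endomorphism_ring C X" and f: "f \<in> mors C X Y" "f \<notin> J X Y"
  obtains r where "r \<in> mors C Y X" "Cmp C X Y X r f = Idn C X"
proof -
  obtain g where g: "g \<in> mors C Y X" "Idn C X \<ominus>\<^bsub>Mor C X X\<^esub> Cmp C X Y X g f \<notin> isos C X X"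
    using f X unfolding radical_def by auto
  then have "Cmp C X Y X g f \<in> isos C X X"
    using local_split[OF X(1) loc, of "Cmp C X Y X g f"] X f by auto
  then obtain u where u: "u \<in> mors C X X" "Cmp C X X X u (Cmp C X Y X g f) = Idn C X" by (rule isosE)
  show thesis by (rule that[of "Cmp C Y X X u g"]) (use X f g u in \<open>simp_all add: comp_assoc_right\<close>)
qed

text \<open>For a section \<open>s\<close> of \<open>f\<close>, the idempotent \<open>s f\<close> is
  non-zero because \<open>f s = 1\<close>; in a local ring it is therefore the identity.\<close>

lemma not_rad_iso:
  assumes X: "X \<in> Ob C" "Y \<in> Ob C" and loc: "local_endomorphism_ring C X" "local_endomorphism_ring C Y"
    and f: "f \<in> mors C X Y" "f \<notin> J X Y"
  shows "f \<in> isos C X Y"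
proof -
  obtain s where s: "s \<in> mors C Y X" "Cmp C Y X Y f s = Idn C Y"
    using not_rad_section[OF X loc(2) f] .
  let ?e = "Cmp C X Y X s f"
  have e: "?e \<in> mors C X X" "Cmp C X X X ?e ?e = ?e"
    using X f s by (simp_all add: comp_assoc_right comp_cancel)
  have "Cmp C Y X Y f (Cmp C Y X X ?e s) = Idn C Y"
    using X f s by (simp add: comp_assoc_right comp_cancel comp_id_left)
  then have "?e \<noteq> zero_mor C X X"
    using X f s local_id_nonzero[OF loc(2)] by (auto simp: comp_zero_left comp_zero_right)
  then have "?e = Idn C X" using local_idem[OF X(1) loc(1) e] by blast
  then show ?thesis using isosI f s by blast
qed

definition modrad where
  "modrad X Y f g \<longleftrightarrow> f \<in> mors C X Y \<and> g \<in> mors C X Y \<and> f \<ominus>\<^bsub>Mor C X Y\<^esub> g \<in> J X Y"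

lemma modrad_refl: "X \<in> Ob C \<Longrightarrow> Y \<in> Ob C \<Longrightarrow> f \<in> mors C X Y \<Longrightarrow> modrad X Y f f"
  using abelian_group.minus_eq_zero[OF hom_abelian_group, of X Y f f]
  by (simp add: modrad_def rad_zero)

lemma modrad_trans: 
  assumes X: "X \<in> Ob C" "Y \<in> Ob C" and "modrad X Y f g" "modrad X Y g h"
  shows "modrad X Y f h"
  using assms abelian_group.minus_trans[OF hom_abelian_group, of X Y f g h] rad_add
  unfolding modrad_def by (metis (no_types, lifting))

lemma modrad_comp_left:
  "\<lbrakk>X \<in> Ob C; Y \<in> Ob C; Z \<in> Ob C; modrad X Y f f'; g \<in> mors C Y Z\<rbrakk>
    \<Longrightarrow> modrad X Z (Cmp C X Y Z g f) (Cmp C X Y Z g f')"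
  using rad_comp_left[of X Y Z "f \<ominus>\<^bsub>Mor C X Y\<^esub> f'" g] by (simp add: modrad_def comp_minus_right)

lemma modrad_comp_right:
  "\<lbrakk>X \<in> Ob C; Y \<in> Ob C; Z \<in> Ob C; f \<in> mors C X Y; modrad Y Z g g'\<rbrakk>
    \<Longrightarrow> modrad X Z (Cmp C X Y Z g f) (Cmp C X Y Z g' f)"
  using rad_comp_right[of X Y Z f "g \<ominus>\<^bsub>Mor C Y Z\<^esub> g'"] by (simp add: modrad_def comp_minus_left)

lemma modrad_rad:
  assumes X: "X \<in> Ob C" "Y \<in> Ob C" and "modrad X Y f g" "g \<in> J X Y"
  shows "f \<in> J X Y"
  using assms abelian_group.minus_add_cancel[OF hom_abelian_group, of X Y f g]
    rad_add[OF X, of "f \<ominus>\<^bsub>Mor C X Y\<^esub> g" g] unfolding modrad_def by metis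

lemma direct_sumE:
  assumes "direct_sum C Xs Z"
  obtains \<iota> \<pi> where "\<And>j. j < length Xs \<Longrightarrow> \<iota> j \<in> mors C (Xs ! j) Z" "\<And>j. j < length Xs \<Longrightarrow> \<pi> j \<in> mors C Z (Xs ! j)"
    "\<And>j. j < length Xs \<Longrightarrow> Cmp C (Xs ! j) Z (Xs ! j) (\<pi> j) (\<iota> j) = Idn C (Xs ! j)"
    "\<And>j k. j < length Xs \<Longrightarrow> k < length Xs \<Longrightarrow> j \<noteq> k \<Longrightarrow>
        Cmp C (Xs ! j) Z (Xs ! k) (\<pi> k) (\<iota> j) = zero_mor C (Xs ! j) (Xs ! k)"
    "(\<Oplus>\<^bsub>Mor C Z Z\<^esub> j \<in> {..<length Xs}. Cmp C Z (Xs ! j) Z (\<iota> j) (\<pi> j)) = Idn C Z"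
  using assms unfolding direct_sum_def by (elim exE conjE) (rule that; simp)

lemma rad_if_components:
  assumes X: "Z \<in> Ob C" "W \<in> Ob C" "set Xs \<subseteq> Ob C" and f: "f \<in> mors C W Z"
    and ip: "\<And>j. j < length Xs \<Longrightarrow> \<iota> j \<in> mors C (Xs ! j) Z" "\<And>j. j < length Xs \<Longrightarrow> \<pi> j \<in> mors C Z (Xs ! j)"
      "(\<Oplus>\<^bsub>Mor C Z Z\<^esub> j \<in> {..<length Xs}. Cmp C Z (Xs ! j) Z (\<iota> j) (\<pi> j)) = Idn C Z"
    and rad: "\<And>j. j < length Xs \<Longrightarrow> Cmp C W Z (Xs ! j) (\<pi> j) f \<in> J W (Xs ! j)"
  shows "f \<in> J W Z"
proof -
  have Xj: "Xs ! j \<in> Ob C" if "j < length Xs" for j using X that by auto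
  have "f = Cmp C W Z Z (\<Oplus>\<^bsub>Mor C Z Z\<^esub> j \<in> {..<length Xs}. Cmp C Z (Xs ! j) Z (\<iota> j) (\<pi> j)) f"
    using X f ip by (simp add: comp_id_left)
  also have "\<dots> = (\<Oplus>\<^bsub>Mor C W Z\<^esub> j \<in> {..<length Xs}. Cmp C W Z Z (Cmp C Z (Xs ! j) Z (\<iota> j) (\<pi> j)) f)"
    using X Xj f ip by (intro comp_finsum_left) auto
  also have "\<dots> \<in> J W Z"
  proof (rule rad_finsum)
    fix j assume "j \<in> {..<length Xs}"
    then show "Cmp C W Z Z (Cmp C Z (Xs ! j) Z (\<iota> j) (\<pi> j)) f \<in> J W Z"
      using X Xj f ip rad by (simp add: comp_assoc_right rad_comp_left)
  qed (use X in auto)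
  finally show ?thesis .
qed

lemma rad_if_restrictions:
  assumes X: "Z \<in> Ob C" "W \<in> Ob C" "set Xs \<subseteq> Ob C" and f: "f \<in> mors C Z W"
    and ip: "\<And>j. j < length Xs \<Longrightarrow> \<iota> j \<in> mors C (Xs ! j) Z" "\<And>j. j < length Xs \<Longrightarrow> \<pi> j \<in> mors C Z (Xs ! j)"
      "(\<Oplus>\<^bsub>Mor C Z Z\<^esub> j \<in> {..<length Xs}. Cmp C Z (Xs ! j) Z (\<iota> j) (\<pi> j)) = Idn C Z"
    and rad: "\<And>j. j < length Xs \<Longrightarrow> Cmp C (Xs ! j) Z W f (\<iota> j) \<in> J (Xs ! j) W"
  shows "f \<in> J Z W"
proof -
  have Xj: "Xs ! j \<in> Ob C" if "j < length Xs" for j using X that by auto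
  have "f = Cmp C Z Z W f (\<Oplus>\<^bsub>Mor C Z Z\<^esub> j \<in> {..<length Xs}. Cmp C Z (Xs ! j) Z (\<iota> j) (\<pi> j))"
    using X f ip by (simp add: comp_id_right)
  also have "\<dots> = (\<Oplus>\<^bsub>Mor C Z W\<^esub> j \<in> {..<length Xs}. Cmp C Z Z W f (Cmp C Z (Xs ! j) Z (\<iota> j) (\<pi> j)))"
    using X Xj f ip by (intro comp_finsum_right) auto
  also have "\<dots> \<in> J Z W"
  proof (rule rad_finsum)
    fix j assume "j \<in> {..<length Xs}"
    then show "Cmp C Z Z W f (Cmp C Z (Xs ! j) Z (\<iota> j) (\<pi> j)) \<in> J Z W"
      using X Xj f ip rad by (simp add: comp_assoc rad_comp_right)
  qed (use X in auto)
  finally show ?thesis .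
qed

end

section \<open>Krull-Schmidt categories with numbered indecomposables\<close>

fun cpow :: "('o, 'm, 'x) lin_cat_scheme \<Rightarrow> 'o \<Rightarrow> 'm \<Rightarrow> nat \<Rightarrow> 'm" where
  "cpow C X f 0 = Idn C X"
| "cpow C X f (Suc n) = Cmp C X X X (cpow C X f n) f"

text \<open>\<open>P_nilpotent\<close> is the form in which finite dimensional hom-spaces enter. The
  summands in \<open>P_sum\<close> are only isomorphic to some \<open>P k\<close>, since
  Krull-Schmidt decompositions are given only up to isomorphism.\<close>

locale krull_schmidt_category = linear_category C
  for C :: "('o, 'm, 'x) lin_cat_scheme" +
  fixes P :: "nat \<Rightarrow> 'o"
  assumes P_ob [simp]: "P i \<in> Ob C"
    and P_local: "local_endomorphism_ring C (P i)"
    and P_eq: "isomorphic C (P i) (P j) \<Longrightarrow> i = j"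
    and P_sum: "Z \<in> Ob C \<Longrightarrow> \<exists>Xs. set Xs \<subseteq> Ob C \<and> (\<forall>X \<in> set Xs. \<exists>k. isomorphic C X (P k)) \<and> direct_sum C Xs Z"
    and P_nilpotent: "f \<in> radical C (P i) (P i) \<Longrightarrow> \<exists>n. cpow C (P i) f n = zero_mor C (P i) (P i)"
begin

text \<open>A non-radical morphism between local objects is an isomorphism, which
  \<open>P_eq\<close> excludes here.\<close>

lemma rad_P:
  assumes "f \<in> mors C (P i) (P j)" "i \<noteq> j"
  shows "f \<in> J (P i) (P j)"
  using not_rad_iso[OF P_ob P_ob P_local P_local assms(1)] P_eq[of i j] assms
  by (auto simp: isomorphic_def)

lemma decomposition:
  assumes "Z \<in> Ob C"
  obtains Xs \<iota> \<pi> where "set Xs \<subseteq> Ob C" "\<And>j. j < length Xs \<Longrightarrow> \<exists>k. isomorphic C (Xs ! j) (P k)"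
    "\<And>j. j < length Xs \<Longrightarrow> \<iota> j \<in> mors C (Xs ! j) Z" "\<And>j. j < length Xs \<Longrightarrow> \<pi> j \<in> mors C Z (Xs ! j)"
    "(\<Oplus>\<^bsub>Mor C Z Z\<^esub> j \<in> {..<length Xs}. Cmp C Z (Xs ! j) Z (\<iota> j) (\<pi> j)) = Idn C Z"
proof -
  obtain Xs where Xs: "set Xs \<subseteq> Ob C" "\<forall>X \<in> set Xs. \<exists>k. isomorphic C X (P k)" "direct_sum C Xs Z"
    using P_sum[OF assms] by blast
  show thesis
    using Xs(3) by (rule direct_sumE) (rule that[OF Xs(1)]; use Xs(2) in simp)
qed

text \<open>Every summand of \<open>Z\<close> is isomorphic to some \<open>P k\<close>; take for
  \<open>x\<close> the projection followed by that isomorphism.\<close>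

lemma rad_P_components:
  assumes X: "Z \<in> Ob C" "W \<in> Ob C" and f: "f \<in> mors C W Z"
    and rad: "\<And>k x. x \<in> mors C Z (P k) \<Longrightarrow> Cmp C W Z (P k) x f \<in> J W (P k)"
  shows "f \<in> J W Z"
proof -
  obtain Xs \<iota> \<pi> where ip: "set Xs \<subseteq> Ob C" "\<And>j. j < length Xs \<Longrightarrow> \<exists>k. isomorphic C (Xs ! j) (P k)"
    "\<And>j. j < length Xs \<Longrightarrow> \<iota> j \<in> mors C (Xs ! j) Z" "\<And>j. j < length Xs \<Longrightarrow> \<pi> j \<in> mors C Z (Xs ! j)"
    "(\<Oplus>\<^bsub>Mor C Z Z\<^esub> j \<in> {..<length Xs}. Cmp C Z (Xs ! j) Z (\<iota> j) (\<pi> j)) = Idn C Z"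
    using decomposition[OF X(1)] by blast
  show ?thesis
  proof (rule rad_if_components[OF X ip(1) f ip(3-5)])
    fix j assume j: "j < length Xs"
    then have Xj: "Xs ! j \<in> Ob C" using ip(1) by auto
    obtain k \<phi> \<psi> where i: "\<phi> \<in> mors C (Xs ! j) (P k)" "\<psi> \<in> mors C (P k) (Xs ! j)" "Cmp C (Xs ! j) (P k) (Xs ! j) \<psi> \<phi> = Idn C (Xs ! j)"
      using ip(2)[OF j] unfolding isomorphic_def isos_def by blast
    have "Cmp C W (P k) (Xs ! j) \<psi> (Cmp C W Z (P k) (Cmp C Z (Xs ! j) (P k) \<phi> (\<pi> j)) f) \<in> J W (Xs ! j)"
      by (rule rad_comp_left[OF X(2) P_ob Xj rad i(2)]) (use X Xj i ip(4)[OF j] in auto)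
    then show "Cmp C W Z (Xs ! j) (\<pi> j) f \<in> J W (Xs ! j)"
      using X Xj i ip(4)[OF j] f by (simp add: comp_assoc_right comp_cancel)
  qed
qed

text \<open>Some component of \<open>w\<close> is non-radical; by \<open>rad_P\<close> it belongs to
  a summand \<open>P c\<close>, on which \<open>w\<close> is invertible. As \<open>ks\<close> is
  distinct, this is the only such summand. In functor terms, \<open>L\<^sub>c\<close> at
  \<open>Z\<close> is generated by any non-zero element over the endomorphisms of
  \<open>P c\<close>.\<close>

lemma multiplicity_one:
  assumes Z: "Z \<in> Ob C" and ds: "direct_sum C (map P ks) Z" "distinct ks"
    and w: "w \<in> mors C Z (P c)" "w \<notin> J Z (P c)"
  shows "c \<in> set ks" 
    and "w' \<in> mors C Z (P c) \<Longrightarrow> \<exists>d \<in> mors C (P c) (P c). modrad Z (P c) w' (Cmp C Z (P c) (P c) d w)"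
proof -
  let ?Xs = "map P ks"
  obtain \<iota> \<pi> where ip: "\<And>j. j < length ?Xs \<Longrightarrow> \<iota> j \<in> mors C (?Xs ! j) Z" "\<And>j. j < length ?Xs \<Longrightarrow> \<pi> j \<in> mors C Z (?Xs ! j)"
      "(\<Oplus>\<^bsub>Mor C Z Z\<^esub> j \<in> {..<length ?Xs}. Cmp C Z (?Xs ! j) Z (\<iota> j) (\<pi> j)) = Idn C Z"
    using ds(1) by (rule direct_sumE) blast
  have Xs: "set ?Xs \<subseteq> Ob C" by auto
  have ip': "\<iota> j \<in> mors C (P (ks ! j)) Z" if "j < length ks" for j using ip(1)[of j] that by simp
  obtain i where i: "i < length ks" "Cmp C (P (ks ! i)) Z (P c) w (\<iota> i) \<notin> J (P (ks ! i)) (P c)"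
    using rad_if_restrictions[OF Z P_ob Xs w(1) ip] w(2) by auto
  then have ci: "ks ! i = c" using rad_P[of _ "ks ! i" c] ip' w Z comp_closed P_ob by metis
  then show "c \<in> set ks" using i(1) by (metis nth_mem)
  have ip'': "\<iota> i \<in> mors C (P c) Z" using ip'[OF i(1)] ci by simp
  have "Cmp C (P c) Z (P c) w (\<iota> i) \<in> isos C (P c) (P c)"
    by (rule not_rad_iso) (use P_local i ci ip'' w Z in auto)
  then obtain r where r: "r \<in> mors C (P c) (P c)" 
    "Cmp C (P c) (P c) (P c) r (Cmp C (P c) Z (P c) w (\<iota> i)) = Idn C (P c)" by (rule isosE)
  assume w': "w' \<in> mors C Z (P c)"
  \<comment> \<open>Chosen so that \<open>d w\<close> and \<open>w'\<close> agree on the summand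
    \<open>P c\<close>; the other summands contribute only radical morphisms.\<close>
  let ?d = "Cmp C (P c) (P c) (P c) (Cmp C (P c) Z (P c) w' (\<iota> i)) r"
  let ?dw = "Cmp C Z (P c) (P c) ?d w"
  have d: "?d \<in> mors C (P c) (P c)" using r w' Z ip'' by auto
  have "w' \<ominus>\<^bsub>Mor C Z (P c)\<^esub> ?dw \<in> J Z (P c)"
  proof (rule rad_if_restrictions[OF Z P_ob Xs _ ip])
    show "w' \<ominus>\<^bsub>Mor C Z (P c)\<^esub> ?dw \<in> mors C Z (P c)" using d w w' Z by auto
    fix k assume "k < length ?Xs"
    then have k: "k < length ks" by simp
    show "Cmp C (?Xs ! k) Z (P c) (w' \<ominus>\<^bsub>Mor C Z (P c)\<^esub> ?dw) (\<iota> k) \<in> J (?Xs ! k) (P c)"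
    proof (cases "k = i")
      case True
      interpret A: abelian_group "Mor C (P c) (P c)" by (intro hom_abelian_group) auto
      have "Cmp C (P c) Z (P c) ?dw (\<iota> i) = Cmp C (P c) Z (P c) w' (\<iota> i)"
        using r ip'' w w' Z by (simp add: comp_assoc_right comp_id_right)
      then have "Cmp C (P c) Z (P c) (w' \<ominus>\<^bsub>Mor C Z (P c)\<^esub> ?dw) (\<iota> i) = zero_mor C (P c) (P c)"
        using ip'' w w' Z d by (simp add: comp_minus_left A.minus_eq_zero)
      then show ?thesis using True k ci by (simp add: rad_zero)
    next
      case False
      then have "ks ! k \<noteq> c" using ds(2) k i(1) ci by (metis nth_eq_iff_index_eq)
      then show ?thesis using k ip' d w w' Z by (auto intro!: rad_P)
    qed
  qed
  then have "modrad Z (P c) w' ?dw" using d w w' Z by (auto simp: modrad_def)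
  then show "\<exists>d \<in> mors C (P c) (P c). modrad Z (P c) w' (Cmp C Z (P c) (P c) d w)" using d by blast
qed

end

section \<open>Self-adjoint functors of type \<open>T\<^sub>\<infinity>\<close>\<close>

text \<open>One half of a self-adjunction: \<open>\<eta>\<close> is a natural unit, while
  \<open>\<kappa>\<close> is a mere family, and a triangle composite is only invertible. This
  tolerates the sign \<open>-1\<close> that the chosen evaluation and coevaluation of
  \<open>L(1)\<close> produce.\<close>

locale T_infinity_functor = krull_schmidt_category C P
  for C :: "('o, 'm, 'x) lin_cat_scheme" and P +
  fixes Fo :: "'o \<Rightarrow> 'o" and Fm :: "'o \<Rightarrow> 'o \<Rightarrow> 'm \<Rightarrow> 'm" and \<eta> \<kappa> :: "'o \<Rightarrow> 'm"
  assumes F_ob [simp]: "X \<in> Ob C \<Longrightarrow> Fo X \<in> Ob C"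
    and F_hom [simp]: "\<lbrakk>X \<in> Ob C; Y \<in> Ob C; f \<in> mors C X Y\<rbrakk> \<Longrightarrow> Fm X Y f \<in> mors C (Fo X) (Fo Y)"
    and F_comp: "\<lbrakk>X \<in> Ob C; Y \<in> Ob C; Z \<in> Ob C; f \<in> mors C X Y; g \<in> mors C Y Z\<rbrakk> \<Longrightarrow>
      Fm X Z (Cmp C X Y Z g f) = Cmp C (Fo X) (Fo Y) (Fo Z) (Fm Y Z g) (Fm X Y f)"
    and F_id: "X \<in> Ob C \<Longrightarrow> Fm X X (Idn C X) = Idn C (Fo X)"
    and F_add: "\<lbrakk>X \<in> Ob C; Y \<in> Ob C; f \<in> mors C X Y; g \<in> mors C X Y\<rbrakk> \<Longrightarrow>
      Fm X Y (f \<oplus>\<^bsub>Mor C X Y\<^esub> g) = Fm X Y f \<oplus>\<^bsub>Mor C (Fo X) (Fo Y)\<^esub> Fm X Y g"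
    and F_zero: "\<lbrakk>X \<in> Ob C; Y \<in> Ob C\<rbrakk> \<Longrightarrow> Fm X Y (zero_mor C X Y) = zero_mor C (Fo X) (Fo Y)"
    and \<eta>_hom [simp]: "X \<in> Ob C \<Longrightarrow> \<eta> X \<in> mors C X (Fo (Fo X))"
    and \<eta>_natural: "\<lbrakk>X \<in> Ob C; Y \<in> Ob C; f \<in> mors C X Y\<rbrakk> \<Longrightarrow>
      Cmp C X (Fo (Fo X)) (Fo (Fo Y)) (Fm (Fo X) (Fo Y) (Fm X Y f)) (\<eta> X) = Cmp C X Y (Fo (Fo Y)) (\<eta> Y) f"
    and \<kappa>_hom [simp]: "X \<in> Ob C \<Longrightarrow> \<kappa> X \<in> mors C (Fo (Fo X)) X"
    and \<kappa>_\<eta>_iso: "X \<in> Ob C \<Longrightarrow>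
      Cmp C (Fo X) (Fo (Fo (Fo X))) (Fo X) (Fm (Fo (Fo X)) X (\<kappa> X)) (\<eta> (Fo X)) \<in> isos C (Fo X) (Fo X)"
    and F_P_0: "direct_sum C [P 0, P 1] (Fo (P 0))"
    and F_P_Suc: "direct_sum C [P i, P (Suc (Suc i))] (Fo (P (Suc i)))"
begin

definition nbrs :: "nat \<Rightarrow> nat list" where
  "nbrs a = (case a of 0 \<Rightarrow> [0, 1] | Suc i \<Rightarrow> [i, Suc (Suc i)])"

lemma F_P: "direct_sum C (map P (nbrs a)) (Fo (P a))" and distinct_nbrs: "distinct (nbrs a)"
  using F_P_0 F_P_Suc by (simp_all add: nbrs_def split: nat.split)

lemma nbrs_sym: "a \<in> set (nbrs c) \<longleftrightarrow> c \<in> set (nbrs a)"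
  by (auto simp: nbrs_def split: nat.splits)

lemma nbrs_two: "\<lbrakk>a \<in> set (nbrs c); b \<in> set (nbrs c); a \<noteq> b; k \<in> set (nbrs c)\<rbrakk> \<Longrightarrow> k = a \<or> k = b"
  by (auto simp: nbrs_def split: nat.splits)

text \<open>\<open>w\<close> can be non-radical only if \<open>P c\<close> is among the summands of
  \<open>F (P a)\<close>. Hence the composition factors of \<open>L\<^sub>c F\<close> belong to the
  neighbours of \<open>c\<close>.\<close>

lemma hom_F_nbrs:
  assumes "w \<in> mors C (Fo (P a)) (P c)" "w \<notin> J (Fo (P a)) (P c)"
  shows "a \<in> set (nbrs c)"
  using multiplicity_one(1)[OF F_ob[OF P_ob] F_P distinct_nbrs assms] nbrs_sym by simp

lemma hom_F_proportional:
  assumes "w \<in> mors C (Fo (P a)) (P c)" "w \<notin> J (Fo (P a)) (P c)" "w' \<in> mors C (Fo (P a)) (P c)"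
  obtains d where "d \<in> mors C (P c) (P c)" "modrad (Fo (P a)) (P c) w' (Cmp C (Fo (P a)) (P c) (P c) d w)"
  using multiplicity_one(2)[OF F_ob[OF P_ob] F_P distinct_nbrs assms] by blast

lemma F_finsum:
  assumes "X \<in> Ob C" "Y \<in> Ob C" "finite I" "\<And>i. i \<in> I \<Longrightarrow> f i \<in> mors C X Y"
  shows "Fm X Y (\<Oplus>\<^bsub>Mor C X Y\<^esub>i\<in>I. f i) = (\<Oplus>\<^bsub>Mor C (Fo X) (Fo Y)\<^esub>i\<in>I. Fm X Y (f i))"
proof -
  interpret S: abelian_group "Mor C X Y" using assms by (intro hom_abelian_group)
  interpret T: abelian_group "Mor C (Fo X) (Fo Y)" using assms by (intro hom_abelian_group) auto
  show ?thesis using assms(3,4)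
  proof (induction I)
    case (insert i I)
    then have "f \<in> I \<rightarrow> mors C X Y" "f i \<in> mors C X Y" by auto
    with insert assms show ?case
      by (subst S.finsum_insert T.finsum_insert; (simp add: F_add Pi_def)?)+
  qed (simp add: assms F_zero)
qed

text \<open>\<open>F\<close> is additive, so it carries the decomposition of the identity of
  \<open>Z\<close> into one for \<open>F Z\<close>, and morphisms out of \<open>F Z\<close> can be
  tested on the \<open>F (P k)\<close>.\<close>

lemma rad_F_restrictions:
  assumes X: "Z \<in> Ob C" "W \<in> Ob C" and f: "f \<in> mors C (Fo Z) W"
    and rad: "\<And>k x. x \<in> mors C (P k) Z \<Longrightarrow> Cmp C (Fo (P k)) (Fo Z) W f (Fm (P k) Z x) \<in> J (Fo (P k)) W"
  shows "f \<in> J (Fo Z) W"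
proof -
  obtain Xs \<iota> \<pi> where ip: "set Xs \<subseteq> Ob C" "\<And>j. j < length Xs \<Longrightarrow> \<exists>k. isomorphic C (Xs ! j) (P k)"
    "\<And>j. j < length Xs \<Longrightarrow> \<iota> j \<in> mors C (Xs ! j) Z" "\<And>j. j < length Xs \<Longrightarrow> \<pi> j \<in> mors C Z (Xs ! j)"
    "(\<Oplus>\<^bsub>Mor C Z Z\<^esub> j \<in> {..<length Xs}. Cmp C Z (Xs ! j) Z (\<iota> j) (\<pi> j)) = Idn C Z"
    using decomposition[OF X(1)] by blast
  have Xj: "Xs ! j \<in> Ob C" if "j < length Xs" for j using ip(1) that by auto
  show ?thesis
  proof (rule rad_if_restrictions[where Xs = "map Fo Xs" and \<iota> = "\<lambda>j. Fm (Xs ! j) Z (\<iota> j)" and \<pi> = "\<lambda>j. Fm Z (Xs ! j) (\<pi> j)"])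
    have "Idn C (Fo Z) = (\<Oplus>\<^bsub>Mor C (Fo Z) (Fo Z)\<^esub> j \<in> {..<length Xs}. Fm Z Z (Cmp C Z (Xs ! j) Z (\<iota> j) (\<pi> j)))"
      unfolding F_id[OF X(1), symmetric] ip(5)[symmetric] by (rule F_finsum) (use X Xj ip in auto)
    also have "\<dots> = (\<Oplus>\<^bsub>Mor C (Fo Z) (Fo Z)\<^esub> j \<in> {..<length (map Fo Xs)}. Cmp C (Fo Z) (map Fo Xs ! j) (Fo Z)
        (Fm (Xs ! j) Z (\<iota> j)) (Fm Z (Xs ! j) (\<pi> j)))"
      by (rule abelian_monoid.finsum_cong'[OF abelian_group.axioms(1)[OF hom_abelian_group]])
        (use X Xj ip in \<open>auto simp: F_comp\<close>)
    finally show "(\<Oplus>\<^bsub>Mor C (Fo Z) (Fo Z)\<^esub> j \<in> {..<length (map Fo Xs)}. Cmp C (Fo Z) (map Fo Xs ! j) (Fo Z)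
        (Fm (Xs ! j) Z (\<iota> j)) (Fm Z (Xs ! j) (\<pi> j))) = Idn C (Fo Z)" by simp
    fix j assume "j < length (map Fo Xs)"
    then have j: "j < length Xs" by simp
    obtain k \<phi> \<psi> where i: "\<phi> \<in> mors C (Xs ! j) (P k)" "\<psi> \<in> mors C (P k) (Xs ! j)" "Cmp C (Xs ! j) (P k) (Xs ! j) \<psi> \<phi> = Idn C (Xs ! j)"
      using ip(2)[OF j] unfolding isomorphic_def isos_def by blast
    \<comment> \<open>The injection \<open>\<iota> j\<close> factors through this morphism from
      \<open>P k\<close>, to which the assumption applies.\<close>
    let ?x = "Cmp C (P k) (Xs ! j) Z (\<iota> j) \<psi>"
    have x: "?x \<in> mors C (P k) Z" using X Xj[OF j] i ip(3)[OF j] by auto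
    have "Fm (Xs ! j) Z (\<iota> j) = Cmp C (Fo (Xs ! j)) (Fo (P k)) (Fo Z) (Fm (P k) Z ?x) (Fm (Xs ! j) (P k) \<phi>)"
      using X Xj[OF j] i ip(3)[OF j] by (simp add: F_comp[symmetric] comp_assoc_right comp_id_right)
    moreover have "Cmp C (Fo (Xs ! j)) (Fo (P k)) W (Cmp C (Fo (P k)) (Fo Z) W f (Fm (P k) Z ?x)) (Fm (Xs ! j) (P k) \<phi>) \<in> J (Fo (Xs ! j)) W"
      by (rule rad_comp_right[OF _ _ X(2) _ rad[OF x]]) (use Xj[OF j] i in auto)
    ultimately show "Cmp C (map Fo Xs ! j) (Fo Z) W f (Fm (Xs ! j) Z (\<iota> j)) \<in> J (map Fo Xs ! j) W"
      using X Xj[OF j] i x f j by (simp add: comp_assoc_right)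
  qed (use X f ip Xj in auto)
qed

text \<open>If \<open>w (F j)\<close> were not radical, then \<open>w\<close> would be a multiple of \<open>w (F j)\<close>, hence of \<open>w (F j\<^sup>n) = 0\<close>,
  modulo the radical.\<close>

lemma rad_F_endo:
  assumes w: "w \<in> mors C (Fo (P a)) (P c)" and j: "j \<in> J (P a) (P a)"
  shows "Cmp C (Fo (P a)) (Fo (P a)) (P c) w (Fm (P a) (P a) j) \<in> J (Fo (P a)) (P c)"
proof (rule ccontr)
  let ?A = "Fo (P a)"
  let ?F = "\<lambda>f. Fm (P a) (P a) f"
  note jh [simp] = rad_hom[OF j]
  assume "Cmp C ?A ?A (P c) w (?F j) \<notin> J ?A (P c)"
  then obtain d where d: "d \<in> mors C (P c) (P c)"
      "modrad ?A (P c) w (Cmp C ?A (P c) (P c) d (Cmp C ?A ?A (P c) w (?F j)))"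
    using hom_F_proportional[of "Cmp C ?A ?A (P c) w (?F j)" a c w] w by auto
  have pw [simp]: "cpow C (P a) j n \<in> mors C (P a) (P a)" for n by (induction n) auto
  have "\<exists>e \<in> mors C (P c) (P c). modrad ?A (P c) w (Cmp C ?A (P c) (P c) e (Cmp C ?A ?A (P c) w (?F (cpow C (P a) j n))))" for n
  proof (induction n)
    case 0
    show ?case using w by (intro bexI[of _ "Idn C (P c)"]) (auto simp: F_id comp_id_left comp_id_right modrad_refl)
  next
    case (Suc n)
    then obtain e where e: "e \<in> mors C (P c) (P c)"
      "modrad ?A (P c) w (Cmp C ?A (P c) (P c) e (Cmp C ?A ?A (P c) w (?F (cpow C (P a) j n))))" by blast
    have "modrad ?A (P c) (Cmp C ?A ?A (P c) w (?F j))
        (Cmp C ?A ?A (P c) (Cmp C ?A (P c) (P c) e (Cmp C ?A ?A (P c) w (?F (cpow C (P a) j n)))) (?F j))"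
      by (rule modrad_comp_right[OF _ _ _ _ e(2)]) auto
    then have "modrad ?A (P c) (Cmp C ?A (P c) (P c) d (Cmp C ?A ?A (P c) w (?F j)))
        (Cmp C ?A (P c) (P c) d (Cmp C ?A ?A (P c) (Cmp C ?A (P c) (P c) e (Cmp C ?A ?A (P c) w (?F (cpow C (P a) j n)))) (?F j)))"
      by (rule modrad_comp_left[rotated 3]) (use d in auto)
    from modrad_trans[OF _ _ d(2) this]
    have "modrad ?A (P c) w (Cmp C ?A (P c) (P c) (Cmp C (P c) (P c) (P c) d e) (Cmp C ?A ?A (P c) w (?F (cpow C (P a) j (Suc n)))))"
      using d(1) e(1) w by (simp add: comp_assoc_right F_comp)
    then show ?case using d(1) e(1) by (intro bexI[of _ "Cmp C (P c) (P c) (P c) d e"]) auto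
  qed
  moreover obtain n where "cpow C (P a) j n = zero_mor C (P a) (P a)" using P_nilpotent[OF j] by blast
  ultimately obtain e where "e \<in> mors C (P c) (P c)" "modrad ?A (P c) w (Cmp C ?A (P c) (P c) e (Cmp C ?A ?A (P c) w (?F (zero_mor C (P a) (P a)))))"
    by metis
  then have "w \<in> J ?A (P c)" using w modrad_rad[of ?A "P c" w "zero_mor C ?A (P c)"]
    by (simp add: F_zero comp_zero_right rad_zero)
  then have "Cmp C ?A ?A (P c) w (?F j) \<in> J ?A (P c)" by (intro rad_comp_right) auto
  with \<open>Cmp C ?A ?A (P c) w (?F j) \<notin> J ?A (P c)\<close> show False ..
qed

text \<open>In the language of the functors \<open>L\<^sub>c = Hom(-, P c) / rad\<close>: if the socle of \<open>L\<^sub>c F\<close> is not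
  everything, then it contains the image of the other composition factor.\<close>

lemma socle:
  assumes ab: "a \<noteq> b" and x: "x \<in> mors C (P a) (P b)" and w: "w \<in> mors C (Fo (P b)) (P c)"
    and nr: "Cmp C (Fo (P a)) (Fo (P b)) (P c) w (Fm (P a) (P b) x) \<notin> J (Fo (P a)) (P c)"
    and Y: "Y \<in> Ob C" and j: "j \<in> J Y (P a)"
  shows "Cmp C (Fo Y) (Fo (P a)) (P c) (Cmp C (Fo (P a)) (Fo (P b)) (P c) w (Fm (P a) (P b) x)) (Fm Y (P a) j) \<in> J (Fo Y) (P c)"
proof -
  let ?v = "Cmp C (Fo (P a)) (Fo (P b)) (P c) w (Fm (P a) (P b) x)"
  have v: "?v \<in> mors C (Fo (P a)) (P c)" using x w by auto
  have aN: "a \<in> set (nbrs c)" using hom_F_nbrs v nr by blast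
  have "w \<notin> J (Fo (P b)) (P c)" using nr x rad_comp_right[of "Fo (P a)" "Fo (P b)" "P c"] by auto
  then have bN: "b \<in> set (nbrs c)" using hom_F_nbrs w by blast
  note jh [simp] = rad_hom[OF j]
  show ?thesis
  proof (rule rad_F_restrictions[OF Y P_ob])
    show "Cmp C (Fo Y) (Fo (P a)) (P c) ?v (Fm Y (P a) j) \<in> mors C (Fo Y) (P c)" using v Y by auto
    fix k z assume z: "z \<in> mors C (P k) Y"
    let ?i = "Cmp C (P k) Y (P a) j z"
    have i: "?i \<in> J (P k) (P a)" using z Y j by (intro rad_comp_right) auto
    have eq: "Cmp C (Fo (P k)) (Fo Y) (P c) (Cmp C (Fo Y) (Fo (P a)) (P c) ?v (Fm Y (P a) j)) (Fm (P k) Y z) =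
        Cmp C (Fo (P k)) (Fo (P a)) (P c) ?v (Fm (P k) (P a) ?i)"
      using z Y v by (simp add: comp_assoc_right F_comp)
    have "Cmp C (Fo (P k)) (Fo (P a)) (P c) ?v (Fm (P k) (P a) ?i) \<in> J (Fo (P k)) (P c)"
    proof (rule ccontr)
      assume nr': "\<not> ?thesis"
      have "k \<in> set (nbrs c)" by (rule hom_F_nbrs[OF _ nr']) (use v rad_hom[OF i] in auto)
      \<comment> \<open>Here it matters that \<open>c\<close> has just two neighbours.\<close>
      then consider "k = a" | "k = b" using nbrs_two[OF aN bN ab] by blast
      then show False
      proof cases
        case 1
        then show ?thesis using rad_F_endo[OF v] i nr' by blast
      next
        case 2
        \<comment> \<open>\<open>v (F i) = w (F (x i))\<close>, and \<open>x i\<close> is a radical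
          endomorphism of \<open>P b\<close>, as \<open>rad_F_endo\<close> demands.\<close>
        let ?xi = "Cmp C (P b) (P a) (P b) x ?i"
        have i': "?i \<in> J (P b) (P a)" using i 2 by simp
        then have "?xi \<in> J (P b) (P b)" using x by (intro rad_comp_left) auto
        from rad_F_endo[OF w this] nr' 2 show ?thesis
          using x w rad_hom[OF i'] by (simp add: comp_assoc_right F_comp)
      qed
    qed
    then show "Cmp C (Fo (P k)) (Fo Y) (P c) (Cmp C (Fo Y) (Fo (P a)) (P c) ?v (Fm Y (P a) j)) (Fm (P k) Y z) \<in> J (Fo (P k)) (P c)"
      unfolding eq .
  qed
qed

text \<open>If \<open>L\<^sub>c\<close> embeds into \<open>L\<^sub>a F\<close> by means of \<open>v\<close>, then \<open>g \<mapsto> v (F g) \<eta>\<close> is a nonzero map from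
  \<open>L\<^sub>c F\<close> to \<open>L\<^sub>a\<close>.  It vanishes on \<open>w (F x)\<close> if \<open>x\<close> is radical.\<close>

lemma top:
  assumes v: "v \<in> mors C (Fo (P c)) (P a)" "v \<notin> J (Fo (P c)) (P a)"
    and soc: "\<And>Y j. Y \<in> Ob C \<Longrightarrow> j \<in> J Y (P c) \<Longrightarrow> Cmp C (Fo Y) (Fo (P c)) (P a) v (Fm Y (P c) j) \<in> J (Fo Y) (P a)"
    and ab: "a \<noteq> b" and x: "x \<in> mors C (P a) (P b)" and w: "w \<in> mors C (Fo (P b)) (P c)"
  shows "Cmp C (Fo (P a)) (Fo (P b)) (P c) w (Fm (P a) (P b) x) \<in> J (Fo (P a)) (P c)"
proof (rule ccontr)
  let ?u = "Cmp C (Fo (P a)) (Fo (P b)) (P c) w (Fm (P a) (P b) x)"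
  assume nr: "?u \<notin> J (Fo (P a)) (P c)"
  have u: "?u \<in> mors C (Fo (P a)) (P c)" using x w by auto
  define \<beta> where "\<beta> X g = Cmp C X (Fo (Fo X)) (P a) (Cmp C (Fo (Fo X)) (Fo (P c)) (P a) v (Fm (Fo X) (P c) g)) (\<eta> X)" for X g
  have \<beta>_hom: "\<beta> X g \<in> mors C X (P a)" if "X \<in> Ob C" "g \<in> mors C (Fo X) (P c)" for X g
    using that v by (auto simp: \<beta>_def)
  have \<beta>_natural: "\<beta> Y (Cmp C (Fo Y) (Fo X) (P c) g (Fm Y X z)) = Cmp C Y X (P a) (\<beta> X g) z"
    if "X \<in> Ob C" "Y \<in> Ob C" "g \<in> mors C (Fo X) (P c)" "z \<in> mors C Y X" for X Y g z
    using that v by (simp add: \<beta>_def comp_assoc_right F_comp \<eta>_natural)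
  have F_minus: "Fm (Fo (P a)) (P c) (f \<ominus>\<^bsub>Mor C (Fo (P a)) (P c)\<^esub> g) \<oplus>\<^bsub>Mor C (Fo (Fo (P a))) (Fo (P c))\<^esub> Fm (Fo (P a)) (P c) g =
      Fm (Fo (P a)) (P c) f" if "f \<in> mors C (Fo (P a)) (P c)" "g \<in> mors C (Fo (P a)) (P c)" for f g
    using that abelian_group.minus_add_cancel[OF hom_abelian_group, of "Fo (P a)" "P c" f g]
    by (simp add: F_add[symmetric])
  have "\<beta> (P a) ?u = Cmp C (P a) (P b) (P a) (\<beta> (P b) w) x" using \<beta>_natural w x by simp
  also have "\<dots> \<in> J (P a) (P a)"
    using rad_P[OF x ab] \<beta>_hom[of "P b" w] w by (intro rad_comp_left) auto
  finally have \<beta>_u: "\<beta> (P a) ?u \<in> J (P a) (P a)" .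
  \<comment> \<open>Modulo the radical, \<open>g\<close> is \<open>d u\<close> by multiplicity one.
    The radical remainder is killed by \<open>soc\<close>; \<open>d\<close> moves to the other side
    of \<open>v\<close> because \<open>v (F d)\<close> is congruent to some \<open>d' v\<close>,
    again by multiplicity one, and \<open>\<beta>\<close> of \<open>u\<close> is radical.\<close>
  have \<beta>_a: "\<beta> (P a) g \<in> J (P a) (P a)" if g: "g \<in> mors C (Fo (P a)) (P c)" for g
  proof -
    obtain d where d: "d \<in> mors C (P c) (P c)" "modrad (Fo (P a)) (P c) g (Cmp C (Fo (P a)) (P c) (P c) d ?u)"
      using hom_F_proportional[OF u nr g] .
    obtain d' where d': "d' \<in> mors C (P a) (P a)"
      "modrad (Fo (P c)) (P a) (Cmp C (Fo (P c)) (Fo (P c)) (P a) v (Fm (P c) (P c) d)) (Cmp C (Fo (P c)) (P a) (P a) d' v)"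
      using hom_F_proportional[OF v, of "Cmp C (Fo (P c)) (Fo (P c)) (P a) v (Fm (P c) (P c) d)"] v d by auto
    let ?du = "Cmp C (Fo (P a)) (P c) (P c) d ?u"
    let ?j = "g \<ominus>\<^bsub>Mor C (Fo (P a)) (P c)\<^esub> ?du"
    have du: "?du \<in> mors C (Fo (P a)) (P c)" using d u by auto
    have j: "?j \<in> J (Fo (P a)) (P c)" using d by (simp add: modrad_def)
    have "\<beta> (P a) ?du = Cmp C (P a) (Fo (P c)) (P a) (Cmp C (Fo (P c)) (Fo (P c)) (P a) v (Fm (P c) (P c) d))
        (Cmp C (P a) (Fo (Fo (P a))) (Fo (P c)) (Fm (Fo (P a)) (P c) ?u) (\<eta> (P a)))"
      using v d u by (simp add: \<beta>_def comp_assoc_right F_comp[of _ "P c" "P c"])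
    moreover have "modrad (P a) (P a) \<dots> (Cmp C (P a) (Fo (P c)) (P a) (Cmp C (Fo (P c)) (P a) (P a) d' v)
        (Cmp C (P a) (Fo (Fo (P a))) (Fo (P c)) (Fm (Fo (P a)) (P c) ?u) (\<eta> (P a))))"
      by (rule modrad_comp_right[OF _ _ _ _ d'(2)]) (use u in auto)
    moreover have "Cmp C (P a) (Fo (P c)) (P a) (Cmp C (Fo (P c)) (P a) (P a) d' v)
        (Cmp C (P a) (Fo (Fo (P a))) (Fo (P c)) (Fm (Fo (P a)) (P c) ?u) (\<eta> (P a))) = Cmp C (P a) (P a) (P a) d' (\<beta> (P a) ?u)"
      using v d' u by (simp add: \<beta>_def comp_assoc_right)
    moreover have "Cmp C (P a) (P a) (P a) d' (\<beta> (P a) ?u) \<in> J (P a) (P a)"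
      using \<beta>_u d' by (intro rad_comp_left) auto
    ultimately have du_rad: "\<beta> (P a) ?du \<in> J (P a) (P a)" using modrad_rad by auto
    have "\<beta> (P a) ?j \<in> J (P a) (P a)"
      unfolding \<beta>_def by (rule rad_comp_right[OF _ _ _ _ soc[OF _ j]]) auto
    moreover have "\<beta> (P a) g = \<beta> (P a) ?j \<oplus>\<^bsub>Mor C (P a) (P a)\<^esub> \<beta> (P a) ?du"
      using F_minus[OF g du] v g du rad_hom[OF j]
      by (simp add: \<beta>_def comp_add_right[symmetric] comp_add_left[symmetric])
    ultimately show ?thesis using du_rad by (simp add: rad_add)
  qed
  \<comment> \<open>If \<open>\<beta> X g\<close> were non-radical, a section \<open>z\<close> and
    naturality would make the identity of \<open>P a\<close> a value of
    \<open>\<beta> (P a)\<close>.\<close>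
  have \<beta>_rad: "\<beta> X g \<in> J X (P a)" if X: "X \<in> Ob C" and g: "g \<in> mors C (Fo X) (P c)" for X g
  proof (rule ccontr)
    assume "\<not> ?thesis"
    then obtain z where z: "z \<in> mors C (P a) X" "Cmp C (P a) X (P a) (\<beta> X g) z = Idn C (P a)"
      using not_rad_section[OF X P_ob P_local \<beta>_hom[OF X g]] by blast
    then have "\<beta> (P a) (Cmp C (Fo (P a)) (Fo X) (P c) g (Fm (P a) X z)) = Idn C (P a)"
      using \<beta>_natural X g by simp
    then show False using \<beta>_a[of "Cmp C (Fo (P a)) (Fo X) (P c) g (Fm (P a) X z)"] z X g id_not_rad[OF P_ob P_local] by auto
  qed
  \<comment> \<open>At \<open>X = F (P c)\<close> and \<open>g = \<kappa> (P c)\<close> the value of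
    \<open>\<beta>\<close> is \<open>v\<close> times an isomorphism, so \<open>v\<close> itself
    would be radical.\<close>
  let ?i = "Cmp C (Fo (P c)) (Fo (Fo (Fo (P c)))) (Fo (P c)) (Fm (Fo (Fo (P c))) (P c) (\<kappa> (P c))) (\<eta> (Fo (P c)))"
  have "\<beta> (Fo (P c)) (\<kappa> (P c)) \<in> J (Fo (P c)) (P a)" using \<beta>_rad by auto
  then have vi: "Cmp C (Fo (P c)) (Fo (P c)) (P a) v ?i \<in> J (Fo (P c)) (P a)"
    using v by (simp add: \<beta>_def comp_assoc_right)
  obtain r where r: "?i \<in> mors C (Fo (P c)) (Fo (P c))" "r \<in> mors C (Fo (P c)) (Fo (P c))" "Cmp C (Fo (P c)) (Fo (P c)) (Fo (P c)) ?i r = Idn C (Fo (P c))"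
    using \<kappa>_\<eta>_iso[OF P_ob] by (rule isosE) blast
  have "Cmp C (Fo (P c)) (Fo (P c)) (P a) (Cmp C (Fo (P c)) (Fo (P c)) (P a) v ?i) r \<in> J (Fo (P c)) (P a)"
    by (rule rad_comp_right) (use vi r in auto)
  moreover have "Cmp C (Fo (P c)) (Fo (P c)) (P a) (Cmp C (Fo (P c)) (Fo (P c)) (P a) v ?i) r = v"
    using v r by (simp only: comp_assoc_right comp_id_right F_ob P_ob)
  ultimately show False using v by simp
qed

text \<open>Semisimplicity of \<open>L\<^sub>c F\<close>: radical morphisms act on it by
  zero.\<close>

definition F_preserves_rad :: "nat \<Rightarrow> bool" where
  "F_preserves_rad c \<longleftrightarrow> (\<forall>Y \<in> Ob C. \<forall>Z \<in> Ob C. \<forall>j \<in> J Y Z. \<forall>v \<in> mors C (Fo Z) (P c).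
     Cmp C (Fo Y) (Fo Z) (P c) v (Fm Y Z j) \<in> J (Fo Y) (P c))"

text \<open>Because of the loop at 0, \<open>top\<close> applies with \<open>a = c = 0\<close>. If
  \<open>w (F x)\<close> is non-radical, it satisfies the socle condition by \<open>socle\<close>
  and can serve as \<open>v\<close>; but then \<open>top\<close> makes this same morphism
  radical.\<close>

lemma F_preserves_rad_0_1:
  assumes "x \<in> mors C (P 0) (P 1)" "w \<in> mors C (Fo (P 1)) (P 0)"
  shows "Cmp C (Fo (P 0)) (Fo (P 1)) (P 0) w (Fm (P 0) (P 1) x) \<in> J (Fo (P 0)) (P 0)"
proof (rule ccontr)
  assume nr: "\<not> ?thesis"
  show False
    using top[OF _ nr socle[OF _ assms nr] _ assms] assms nr by auto
qed

text \<open>The projection \<open>p\<close> from \<open>F (P (c + 1))\<close> onto its summand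
  \<open>P c\<close> is non-radical, and semisimplicity of \<open>L\<^sub>c F\<close> is exactly the
  socle condition that \<open>top\<close> needs for \<open>v = p\<close>.\<close>

lemma F_preserves_rad_up:
  assumes A: "F_preserves_rad c" and x: "x \<in> mors C (P c) (P (Suc (Suc c)))" and w: "w \<in> mors C (Fo (P (Suc (Suc c)))) (P (Suc c))"
  shows "Cmp C (Fo (P c)) (Fo (P (Suc (Suc c)))) (P (Suc c)) w (Fm (P c) (P (Suc (Suc c))) x) \<in> J (Fo (P c)) (P (Suc c))"
proof -
  let ?Xs = "[P c, P (Suc (Suc c))]" and ?Z = "Fo (P (Suc c))"
  obtain \<iota> \<pi> where "\<And>j. j < length ?Xs \<Longrightarrow> \<iota> j \<in> mors C (?Xs ! j) ?Z" "\<And>j. j < length ?Xs \<Longrightarrow> \<pi> j \<in> mors C ?Z (?Xs ! j)"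
      "\<And>j. j < length ?Xs \<Longrightarrow> Cmp C (?Xs ! j) ?Z (?Xs ! j) (\<pi> j) (\<iota> j) = Idn C (?Xs ! j)"
    using F_P_Suc[of c] by (rule direct_sumE) blast
  from this[of 0] obtain i p where ip: "i \<in> mors C (P c) ?Z" "p \<in> mors C ?Z (P c)" "Cmp C (P c) ?Z (P c) p i = Idn C (P c)"
    by simp
  then have "p \<notin> J ?Z (P c)"
    using rad_comp_right[of "P c" ?Z "P c" i p] id_not_rad[OF P_ob P_local, of c] by auto
  then show ?thesis
    using A ip x w unfolding F_preserves_rad_def by (intro top[of p "Suc c" c]) auto
qed

end

section \<open>Dual statements from the opposite category\<close>

definition op_cat :: "('o, 'm, 'x) lin_cat_scheme \<Rightarrow> ('o, 'm) lin_cat" where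
  "op_cat C = \<lparr>Ob = Ob C, Mor = \<lambda>X Y. Mor C Y X, Cmp = \<lambda>X Y Z g f. Cmp C Z Y X f g, Idn = Idn C\<rparr>"

lemma op_cat_simps [simp]:
  "Ob (op_cat C) = Ob C" "Mor (op_cat C) X Y = Mor C Y X"
  "Cmp (op_cat C) X Y Z g f = Cmp C Z Y X f g" "Idn (op_cat C) X = Idn C X"
  by (simp_all add: op_cat_def)

lemma isos_op_cat [simp]: "isos (op_cat C) X Y = isos C Y X"
  by (auto simp: isos_def)

lemma local_endomorphism_ring_op_cat [simp]: "local_endomorphism_ring (op_cat C) X = local_endomorphism_ring C X"
  by (simp add: local_endomorphism_ring_def)

lemma direct_sum_op_cat:
  assumes "direct_sum C Xs Z"
  shows "direct_sum (op_cat C) Xs Z"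
proof -
  obtain \<iota> \<pi> where "(\<forall>j < length Xs. \<iota> j \<in> mors C (Xs ! j) Z \<and> \<pi> j \<in> mors C Z (Xs ! j)) \<and>
     (\<forall>j < length Xs. \<forall>k < length Xs. Cmp C (Xs ! j) Z (Xs ! k) (\<pi> k) (\<iota> j) =
          (if j = k then Idn C (Xs ! j) else zero_mor C (Xs ! j) (Xs ! k))) \<and>
     (\<Oplus>\<^bsub>Mor C Z Z\<^esub> j \<in> {..<length Xs}. Cmp C Z (Xs ! j) Z (\<iota> j) (\<pi> j)) = Idn C Z"
    using assms unfolding direct_sum_def by blast
  then show ?thesis
    unfolding direct_sum_def by (intro exI[of _ \<pi>] exI[of _ \<iota>]) auto
qed

context linear_category
begin

lemma linear_category_op_cat: "linear_category (op_cat C)"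
  by (rule linear_category.intro)
    (auto simp: hom_vectorspace comp_linear_left comp_linear_right comp_id_left comp_id_right comp_assoc)

lemma radical_op_cat: "X \<in> Ob C \<Longrightarrow> Y \<in> Ob C \<Longrightarrow> radical (op_cat C) X Y = J Y X"
  by (subst radical_alt) (auto simp: radical_def)

lemma cpow_op_cat:
  assumes "X \<in> Ob C" "f \<in> mors C X X"
  shows "cpow (op_cat C) X f n = cpow C X f n"
proof (induction n)
  case (Suc n)
  have pw: "cpow C X f k \<in> mors C X X" for k using assms by (induction k) auto
  have "Cmp C X X X f (cpow C X f k) = Cmp C X X X (cpow C X f k) f" for k
    using assms pw by (induction k) (simp_all add: comp_id_left comp_id_right comp_assoc)
  then show ?case using Suc by simp
qed simp

end

lemma (in krull_schmidt_category) krull_schmidt_category_op_cat: "krull_schmidt_category (op_cat C) P"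
proof (intro krull_schmidt_category.intro linear_category_op_cat krull_schmidt_category_axioms.intro)
  show "isomorphic (op_cat C) (P i) (P j) \<Longrightarrow> i = j" for i j
    using P_eq[of j i] by (simp add: isomorphic_def)
  show "\<exists>n. cpow (op_cat C) (P i) f n = zero_mor (op_cat C) (P i) (P i)" if "f \<in> radical (op_cat C) (P i) (P i)" for f i
  proof -
    have "f \<in> J (P i) (P i)" using that by (simp add: radical_op_cat)
    then show ?thesis using P_nilpotent[of f i] cpow_op_cat[of "P i" f] rad_hom by simp
  qed
  have "isomorphic (op_cat C) X Y" if "isomorphic C X Y" for X Y
    using that by (auto simp: isomorphic_def elim: isosE)
  then show "\<exists>Xs. set Xs \<subseteq> Ob (op_cat C) \<and> (\<forall>X \<in> set Xs. \<exists>k. isomorphic (op_cat C) X (P k)) \<and> direct_sum (op_cat C) Xs Z"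
    if "Z \<in> Ob (op_cat C)" for Z
    using P_sum[of Z] that direct_sum_op_cat unfolding op_cat_simps by metis
qed (use P_local in auto)

text \<open>The added data are a natural counit and the second triangle: read in the opposite
  category, they are the assumptions on \<open>\<eta>\<close> and \<open>\<kappa>\<close>.\<close>

locale T_infinity_self_dual_functor = T_infinity_functor C P Fo Fm \<eta> \<kappa>
  for C :: "('o, 'm, 'x) lin_cat_scheme" and P Fo Fm \<eta> \<kappa> +
  fixes \<epsilon> \<kappa>' :: "'o \<Rightarrow> 'm"
  assumes \<epsilon>_hom: "X \<in> Ob C \<Longrightarrow> \<epsilon> X \<in> mors C (Fo (Fo X)) X"
    and \<epsilon>_natural: "\<lbrakk>X \<in> Ob C; Y \<in> Ob C; f \<in> mors C X Y\<rbrakk> \<Longrightarrow>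
      Cmp C (Fo (Fo X)) (Fo (Fo Y)) Y (\<epsilon> Y) (Fm (Fo X) (Fo Y) (Fm X Y f)) = Cmp C (Fo (Fo X)) X Y f (\<epsilon> X)"
    and \<kappa>'_hom: "X \<in> Ob C \<Longrightarrow> \<kappa>' X \<in> mors C X (Fo (Fo X))"
    and \<epsilon>_\<kappa>'_iso: "X \<in> Ob C \<Longrightarrow>
      Cmp C (Fo X) (Fo (Fo (Fo X))) (Fo X) (\<epsilon> (Fo X)) (Fm X (Fo (Fo X)) (\<kappa>' X)) \<in> isos C (Fo X) (Fo X)"
begin

lemma T_infinity_functor_op_cat: "T_infinity_functor (op_cat C) P Fo (\<lambda>X Y. Fm Y X) \<epsilon> \<kappa>'"
  by (intro T_infinity_functor.intro krull_schmidt_category_op_cat T_infinity_functor_axioms.intro)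
    (simp_all add: \<epsilon>_hom \<epsilon>_natural \<kappa>'_hom \<epsilon>_\<kappa>'_iso F_comp F_id F_add F_zero F_P_0 [simplified] F_P_Suc direct_sum_op_cat)

sublocale op: T_infinity_functor "op_cat C" P Fo "\<lambda>X Y. Fm Y X" \<epsilon> \<kappa>'
  by (rule T_infinity_functor_op_cat)

text \<open>If \<open>(F j) u\<close> starting at \<open>P c\<close> were non-radical, it would have
  a retraction \<open>r\<close>. But \<open>r (F j)\<close> ends at \<open>P c\<close> and is
  radical by assumption, so the identity of \<open>P c\<close> would be radical.\<close>

lemma F_preserves_rad_op_cat:
  assumes "F_preserves_rad c"
  shows "op.F_preserves_rad c"
  unfolding op.F_preserves_rad_def
proof (intro ballI)
  fix Y Z j u assume "Y \<in> Ob (op_cat C)" "Z \<in> Ob (op_cat C)" "j \<in> radical (op_cat C) Y Z" "u \<in> mors (op_cat C) (Fo Z) (P c)"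
  then have Y: "Y \<in> Ob C" and Z: "Z \<in> Ob C" and j: "j \<in> J Z Y" and u: "u \<in> mors C (P c) (Fo Z)"
    by (simp_all add: radical_op_cat)
  note jh [simp] = rad_hom[OF j]
  have "Cmp C (P c) (Fo Z) (Fo Y) (Fm Z Y j) u \<in> J (P c) (Fo Y)"
  proof (rule ccontr)
    assume nr: "\<not> ?thesis"
    obtain r where r: "r \<in> mors C (Fo Y) (P c)" "Cmp C (P c) (Fo Y) (P c) r (Cmp C (P c) (Fo Z) (Fo Y) (Fm Z Y j) u) = Idn C (P c)"
      using not_rad_retraction[OF _ _ P_local _ nr] Y Z u by auto
    have "Cmp C (Fo Z) (Fo Y) (P c) r (Fm Z Y j) \<in> J (Fo Z) (P c)"
      using assms Y Z j r(1) unfolding F_preserves_rad_def by blast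
    then have "Cmp C (P c) (Fo Z) (P c) (Cmp C (Fo Z) (Fo Y) (P c) r (Fm Z Y j)) u \<in> J (P c) (P c)"
      using Z u by (intro rad_comp_right[of "P c" "Fo Z"]) auto
    then show False using r Y Z u id_not_rad[OF P_ob P_local] by (simp add: comp_assoc_right)
  qed
  then show "Cmp (op_cat C) (Fo Y) (Fo Z) (P c) u (Fm Z Y j) \<in> radical (op_cat C) (Fo Y) (P c)"
    using Y by (simp add: radical_op_cat)
qed

text \<open>Results from the opposite category concern morphisms out of \<open>P c\<close>; a
  section \<open>s\<close> of a non-radical \<open>w (F x)\<close> turns it into such a morphism
  \<open>(F x) s\<close>.\<close>

lemma off_diagonal_dual:
  assumes x: "x \<in> mors C (P a) (P b)" and w: "w \<in> mors C (Fo (P b)) (P c)"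
    and dual: "\<And>u. u \<in> mors C (P c) (Fo (P a)) \<Longrightarrow> Cmp C (P c) (Fo (P a)) (Fo (P b)) (Fm (P a) (P b) x) u \<in> J (P c) (Fo (P b))"
  shows "Cmp C (Fo (P a)) (Fo (P b)) (P c) w (Fm (P a) (P b) x) \<in> J (Fo (P a)) (P c)"
proof (rule ccontr)
  assume nr: "\<not> ?thesis"
  obtain s where s: "s \<in> mors C (P c) (Fo (P a))" 
    "Cmp C (P c) (Fo (P a)) (P c) (Cmp C (Fo (P a)) (Fo (P b)) (P c) w (Fm (P a) (P b) x)) s = Idn C (P c)"
    using not_rad_section[OF _ _ P_local _ nr] x w by auto
  have "Cmp C (P c) (Fo (P b)) (P c) w (Cmp C (P c) (Fo (P a)) (Fo (P b)) (Fm (P a) (P b) x) s) \<in> J (P c) (P c)"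
    by (rule rad_comp_left[OF _ _ _ dual[OF s(1)] w]) auto
  then show False using s x w id_not_rad[OF P_ob P_local] by (simp add: comp_assoc_right)
qed

text \<open>Endomorphisms of one \<open>P a\<close> are covered by \<open>rad_F_endo\<close>, and
  non-neighbours by \<open>hom_F_nbrs\<close>. The reduction of arbitrary \<open>Y\<close> and
  \<open>Z\<close> to indecomposables decomposes \<open>Y\<close> in the category itself and
  \<open>Z\<close> in the opposite one.\<close>

lemma F_preserves_radI:
  assumes off: "\<And>a b x w. \<lbrakk>a \<in> set (nbrs c); b \<in> set (nbrs c); a \<noteq> b; x \<in> mors C (P a) (P b); w \<in> mors C (Fo (P b)) (P c)\<rbrakk> \<Longrightarrow>
      Cmp C (Fo (P a)) (Fo (P b)) (P c) w (Fm (P a) (P b) x) \<in> J (Fo (P a)) (P c)"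
  shows "F_preserves_rad c"
  unfolding F_preserves_rad_def
proof (intro ballI)
  have P_P: "Cmp C (Fo (P a)) (Fo (P b)) (P c) w (Fm (P a) (P b) x) \<in> J (Fo (P a)) (P c)"
    if x: "x \<in> J (P a) (P b)" and w: "w \<in> mors C (Fo (P b)) (P c)" for a b x w
  proof (rule ccontr)
    assume nr: "\<not> ?thesis"
    note xh = rad_hom[OF x]
    have "a \<in> set (nbrs c)" by (rule hom_F_nbrs[OF _ nr]) (use xh w in auto)
    moreover have "w \<notin> J (Fo (P b)) (P c)" using nr xh rad_comp_right[of "Fo (P a)" "Fo (P b)" "P c"] by auto
    then have "b \<in> set (nbrs c)" using hom_F_nbrs w by blast
    ultimately show False using off xh w nr rad_F_endo x by metis
  qed
  fix Y Z j v assume Y: "Y \<in> Ob C" and Z: "Z \<in> Ob C" and j: "j \<in> J Y Z" and v: "v \<in> mors C (Fo Z) (P c)"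
  note jh [simp] = rad_hom[OF j]
  show "Cmp C (Fo Y) (Fo Z) (P c) v (Fm Y Z j) \<in> J (Fo Y) (P c)"
  proof (rule rad_F_restrictions)
    fix k x assume x: "x \<in> mors C (P k) Y"
    let ?t = "Cmp C (P k) Y Z j x"
    have t: "?t \<in> J (P k) Z" by (rule rad_comp_right[OF P_ob Y Z x j])
    note th = rad_hom[OF t]
    have "Cmp C (Fo (P k)) (Fo Z) (P c) v (Fm (P k) Z ?t) \<in> J (Fo (P k)) (P c)"
    proof (rule ccontr)
      assume nr: "\<not> ?thesis"
      obtain s where s: "s \<in> mors C (P c) (Fo (P k))" "Cmp C (P c) (Fo (P k)) (P c) (Cmp C (Fo (P k)) (Fo Z) (P c) v (Fm (P k) Z ?t)) s = Idn C (P c)"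
        using not_rad_section[OF _ _ P_local _ nr] Z v th by auto
      \<comment> \<open>A morphism out of \<open>P c\<close> into \<open>F Z\<close>: in this form
        the target \<open>Z\<close> can be decomposed, by
        \<open>op.rad_F_restrictions\<close>.\<close>
      let ?u = "Cmp C (P c) (Fo (P k)) (Fo Z) (Fm (P k) Z ?t) s"
      have u: "?u \<in> mors C (P c) (Fo Z)" using Z th s by auto
      have "?u \<in> radical (op_cat C) (Fo Z) (P c)"
      proof (rule op.rad_F_restrictions)
        fix l y assume "y \<in> mors (op_cat C) (P l) Z"
        then have y: "y \<in> mors C Z (P l)" by simp
        let ?yt = "Cmp C (P k) Z (P l) y ?t"
        have yt: "?yt \<in> J (P k) (P l)" by (rule rad_comp_left[OF P_ob Z P_ob t y])
        have "Cmp C (P c) (Fo (P k)) (Fo (P l)) (Fm (P k) (P l) ?yt) s \<in> J (P c) (Fo (P l))"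
        proof (rule ccontr)
          assume nr': "\<not> ?thesis"
          obtain r where r: "r \<in> mors C (Fo (P l)) (P c)" "Cmp C (P c) (Fo (P l)) (P c) r (Cmp C (P c) (Fo (P k)) (Fo (P l)) (Fm (P k) (P l) ?yt) s) = Idn C (P c)"
            using not_rad_retraction[OF _ _ P_local _ nr'] rad_hom[OF yt] s by auto
          have "Cmp C (P c) (Fo (P k)) (P c) (Cmp C (Fo (P k)) (Fo (P l)) (P c) r (Fm (P k) (P l) ?yt)) s \<in> J (P c) (P c)"
            by (rule rad_comp_right[OF _ _ _ s(1) P_P[OF yt r(1)]]) auto
          then show False using r s rad_hom[OF yt] id_not_rad[OF P_ob P_local] by (simp only: comp_assoc_right F_ob P_ob F_hom)
        qed
        then show "Cmp (op_cat C) (Fo (P l)) (Fo Z) (P c) ?u (Fm Z (P l) y) \<in> radical (op_cat C) (Fo (P l)) (P c)"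
          using Z s y th by (simp add: radical_op_cat F_comp[of _ Z "P l"] comp_assoc_right)
      qed (use Z u in auto)
      then have "Cmp C (P c) (Fo Z) (P c) v ?u \<in> J (P c) (P c)"
        using Z v by (intro rad_comp_left[of _ "Fo Z"]) (simp_all add: radical_op_cat)
      then show False using s v Z th id_not_rad[OF P_ob P_local] by (simp add: comp_assoc_right)
    qed
    then show "Cmp C (Fo (P k)) (Fo Y) (P c) (Cmp C (Fo Y) (Fo Z) (P c) v (Fm Y Z j)) (Fm (P k) Y x) \<in> J (Fo (P k)) (P c)"
      using Y Z x v by (simp add: F_comp comp_assoc_right)
  qed (use Y Z v in auto)
qed

lemma F_preserves_rad: "F_preserves_rad c"
proof (induction c)
  case 0
  show ?case
  proof (rule F_preserves_radI)
    fix a b x w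
    assume ab: "a \<in> set (nbrs 0)" "b \<in> set (nbrs 0)" "a \<noteq> b" and x: "x \<in> mors C (P a) (P b)" and w: "w \<in> mors C (Fo (P b)) (P 0)"
    from ab consider "a = 0" "b = 1" | "a = 1" "b = 0" by (auto simp: nbrs_def)
    then show "Cmp C (Fo (P a)) (Fo (P b)) (P 0) w (Fm (P a) (P b) x) \<in> J (Fo (P a)) (P 0)"
    proof cases
      case 1
      then show ?thesis using F_preserves_rad_0_1 x w by simp
    next
      \<comment> \<open>In the opposite category \<open>x\<close> is a morphism from
        \<open>P 0\<close> to \<open>P 1\<close>, so the first case applies to it there.\<close>
      case 2
      then show ?thesis
        using op.F_preserves_rad_0_1[of x] x by (intro off_diagonal_dual[OF x w]) (simp add: radical_op_cat)
    qed
  qed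
next
  case (Suc c)
  show ?case
  proof (rule F_preserves_radI)
    fix a b x w
    assume ab: "a \<in> set (nbrs (Suc c))" "b \<in> set (nbrs (Suc c))" "a \<noteq> b" and x: "x \<in> mors C (P a) (P b)" and w: "w \<in> mors C (Fo (P b)) (P (Suc c))"
    from ab consider "a = c" "b = Suc (Suc c)" | "a = Suc (Suc c)" "b = c" by (auto simp: nbrs_def)
    then show "Cmp C (Fo (P a)) (Fo (P b)) (P (Suc c)) w (Fm (P a) (P b) x) \<in> J (Fo (P a)) (P (Suc c))"
    proof cases
      case 1
      then show ?thesis using F_preserves_rad_up Suc x w by simp
    next
      case 2
      then show ?thesis
        using op.F_preserves_rad_up[OF F_preserves_rad_op_cat[OF Suc], of x] x
        by (intro off_diagonal_dual[OF x w]) (simp add: radical_op_cat)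
    qed
  qed
qed

lemma F_rad:
  assumes X: "X \<in> Ob C" "Y \<in> Ob C" and f: "f \<in> J X Y"
  shows "Fm X Y f \<in> J (Fo X) (Fo Y)"
proof (rule rad_P_components)
  fix k v assume "v \<in> mors C (Fo Y) (P k)"
  then show "Cmp C (Fo X) (Fo Y) (P k) v (Fm X Y f) \<in> J (Fo X) (P k)"
    using F_preserves_rad[of k] X f unfolding F_preserves_rad_def by blast
qed (use X rad_hom[OF f] in auto)

end

section \<open>Adjunctions from self-dual objects\<close>

definition minv :: "('o, 'm, 'x) lin_cat_scheme \<Rightarrow> 'o \<Rightarrow> 'o \<Rightarrow> 'm \<Rightarrow> 'm" where
  "minv C X Y f = (SOME g. g \<in> mors C Y X \<and> Cmp C X Y X g f = Idn C X \<and> Cmp C Y X Y f g = Idn C Y)"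

context linear_category
begin

lemma minv:
  assumes "f \<in> isos C X Y"
  shows "f \<in> mors C X Y" "minv C X Y f \<in> mors C Y X" 
    "Cmp C X Y X (minv C X Y f) f = Idn C X" "Cmp C Y X Y f (minv C X Y f) = Idn C Y"
    "minv C X Y f \<in> isos C Y X"
proof -
  have "\<exists>g. g \<in> mors C Y X \<and> Cmp C X Y X g f = Idn C X \<and> Cmp C Y X Y f g = Idn C Y"
    using assms by (auto simp: isos_def)
  from someI_ex[OF this] show 1: "f \<in> mors C X Y" "minv C X Y f \<in> mors C Y X" 
    "Cmp C X Y X (minv C X Y f) f = Idn C X" "Cmp C Y X Y f (minv C X Y f) = Idn C Y"
    using assms by (auto simp: minv_def isos_def)
  then show "minv C X Y f \<in> isos C Y X" by (intro isosI)
qed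

end

context module_category
begin

lemma act_hom [simp]:
  assumes "A \<in> Ob C" "A' \<in> Ob C" "X \<in> Ob M" "X' \<in> Ob M" "a \<in> mors C A A'" "f \<in> mors M X X'"
  shows "act_mor M A A' X X' a f \<in> mors M (act_ob M A X) (act_ob M A' X')"
proof -
  interpret linear_map class_ring "Mor M X X'" "Mor M (act_ob M A X) (act_ob M A' X')" "\<lambda>f. act_mor M A A' X X' a f"
    using assms by (intro act_linear_right)
  show ?thesis using assms by auto
qed

lemma act_iso:
  assumes X: "A \<in> Ob C" "A' \<in> Ob C" "X \<in> Ob M" "X' \<in> Ob M" and a: "a \<in> isos C A A'" and f: "f \<in> isos M X X'"
  shows "act_mor M A A' X X' a f \<in> isos M (act_ob M A X) (act_ob M A' X')"
proof -
  obtain a' where a': "a \<in> mors C A A'" "a' \<in> mors C A' A" "Cmp C A A' A a' a = Idn C A" "Cmp C A' A A' a a' = Idn C A'"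
    using a by (rule C.isosE)
  obtain f' where f': "f \<in> mors M X X'" "f' \<in> mors M X' X" "Cmp M X X' X f' f = Idn M X" "Cmp M X' X X' f f' = Idn M X'"
    using f by (rule M.isosE)
  show ?thesis
    by (rule M.isosI[where g = "act_mor M A' A X' X a' f'"])
      (use X a' f' in \<open>simp_all add: act_comp[symmetric] act_id\<close>)
qed

lemmas act_closed [simp] = act_ob_closed C.tens_ob_closed C.unit_ob_closed

lemma tens_hom:
  assumes "X \<in> Ob C" "X' \<in> Ob C" "Y \<in> Ob C" "Y' \<in> Ob C" "f \<in> mors C X X'" "g \<in> mors C Y Y'"
  shows "tens_mor C X X' Y Y' f g \<in> mors C (tens_ob C X Y) (tens_ob C X' Y')"
proof -
  interpret linear_map class_ring "Mor C Y Y'" "Mor C (tens_ob C X Y) (tens_ob C X' Y')" "\<lambda>g. tens_mor C X X' Y Y' f g"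
    using assms by (intro C.tens_linear_right)
  show ?thesis using assms by auto
qed

end

text \<open>The zigzags retain the unit object, hence run between its products with \<open>A\<close>
  on the two sides, and are merely invertible. The right inverse \<open>a'\<close> of the associator
  is a parameter so that it can be named concretely.\<close>

locale self_dual_action = module_category C M
  for C :: "('c, 'n, 'x) mon_cat_scheme" and M :: "('c, 'n, 'o, 'm, 'y) mod_cat_scheme" +
  fixes A :: 'c and coev ev a' :: 'n
  assumes A [simp]: "A \<in> Ob C"
    and coev [simp]: "coev \<in> mors C (unit_ob C) (tens_ob C A A)"
    and ev [simp]: "ev \<in> mors C (tens_ob C A A) (unit_ob C)"
    and a' [simp]: "a' \<in> mors C (tens_ob C A (tens_ob C A A)) (tens_ob C (tens_ob C A A) A)"
    and assoc_a': "Cmp C (tens_ob C A (tens_ob C A A)) (tens_ob C (tens_ob C A A) A) (tens_ob C A (tens_ob C A A))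
        (associator C A A A) a' = Idn C (tens_ob C A (tens_ob C A A))"
    and zig: "Cmp C (tens_ob C (unit_ob C) A) (tens_ob C (tens_ob C A A) A) (tens_ob C A (unit_ob C))
        (Cmp C (tens_ob C (tens_ob C A A) A) (tens_ob C A (tens_ob C A A)) (tens_ob C A (unit_ob C))
          (tens_mor C A A (tens_ob C A A) (unit_ob C) (Idn C A) ev) (associator C A A A))
        (tens_mor C (unit_ob C) (tens_ob C A A) A A coev (Idn C A)) \<in> isos C (tens_ob C (unit_ob C) A) (tens_ob C A (unit_ob C))"
    and zag: "Cmp C (tens_ob C A (unit_ob C)) (tens_ob C A (tens_ob C A A)) (tens_ob C (unit_ob C) A)
        (Cmp C (tens_ob C A (tens_ob C A A)) (tens_ob C (tens_ob C A A) A) (tens_ob C (unit_ob C) A)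
          (tens_mor C (tens_ob C A A) (unit_ob C) A A ev (Idn C A)) a')
        (tens_mor C A A (unit_ob C) (tens_ob C A A) (Idn C A) coev) \<in> isos C (tens_ob C A (unit_ob C)) (tens_ob C (unit_ob C) A)"
begin

abbreviation "U \<equiv> unit_ob C"
abbreviation "AA \<equiv> tens_ob C A A"

definition Fo :: "'o \<Rightarrow> 'o" where "Fo X = act_ob M A X"
definition Fm :: "'o \<Rightarrow> 'o \<Rightarrow> 'm \<Rightarrow> 'm" where "Fm X Y f = act_mor M A A X Y (Idn C A) f"
definition \<eta> :: "'o \<Rightarrow> 'm" where
  "\<eta> X = Cmp M X (act_ob M AA X) (Fo (Fo X)) (act_assoc M A A X)
    (Cmp M X (act_ob M U X) (act_ob M AA X) (act_mor M U AA X X coev (Idn M X)) (minv M (act_ob M U X) X (act_unit M X)))"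
definition \<epsilon> :: "'o \<Rightarrow> 'm" where
  "\<epsilon> X = Cmp M (Fo (Fo X)) (act_ob M U X) X (act_unit M X)
    (Cmp M (Fo (Fo X)) (act_ob M AA X) (act_ob M U X) (act_mor M AA U X X ev (Idn M X)) (minv M (act_ob M AA X) (Fo (Fo X)) (act_assoc M A A X)))"

lemma Fo [simp]: "X \<in> Ob M \<Longrightarrow> Fo X \<in> Ob M"
  by (simp add: Fo_def)

lemma Fm [simp]: "X \<in> Ob M \<Longrightarrow> Y \<in> Ob M \<Longrightarrow> f \<in> mors M X Y \<Longrightarrow> Fm X Y f \<in> mors M (Fo X) (Fo Y)"
  by (simp add: Fm_def Fo_def)

lemma Fm_comp: "\<lbrakk>X \<in> Ob M; Y \<in> Ob M; Z \<in> Ob M; f \<in> mors M X Y; g \<in> mors M Y Z\<rbrakk> \<Longrightarrow>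
      Fm X Z (Cmp M X Y Z g f) = Cmp M (Fo X) (Fo Y) (Fo Z) (Fm Y Z g) (Fm X Y f)"
  using act_comp[of A A A X Y Z "Idn C A" "Idn C A" f g] by (simp add: Fm_def Fo_def C.comp_id_left)

lemma Fm_id: "X \<in> Ob M \<Longrightarrow> Fm X X (Idn M X) = Idn M (Fo X)"
  by (simp add: Fm_def Fo_def act_id)

lemma Fm_linear: "X \<in> Ob M \<Longrightarrow> Y \<in> Ob M \<Longrightarrow> linear_map class_ring (Mor M X Y) (Mor M (Fo X) (Fo Y)) (Fm X Y)"
  unfolding Fm_def Fo_def by (rule act_linear_right) auto

lemma assoc_AA:
  assumes "X \<in> Ob M"
  shows "act_assoc M A A X \<in> isos M (act_ob M AA X) (Fo (Fo X))"
  using act_assoc_iso[of A A X] assms by (simp add: Fo_def)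

lemma \<eta>_hom [simp]: "X \<in> Ob M \<Longrightarrow> \<eta> X \<in> mors M X (Fo (Fo X))"
  using M.minv(1,2)[OF act_unit_iso] M.minv(1,2)[OF assoc_AA] unfolding \<eta>_def by auto

lemma \<epsilon>_hom [simp]: "X \<in> Ob M \<Longrightarrow> \<epsilon> X \<in> mors M (Fo (Fo X)) X"
  using M.minv(1,2)[OF act_unit_iso] M.minv(1,2)[OF assoc_AA] unfolding \<epsilon>_def by auto

lemma inverse_natural:
  assumes X: "X \<in> Ob M" "Y \<in> Ob M" "X' \<in> Ob M" "Y' \<in> Ob M"
    and f: "f \<in> mors M X Y" and g: "g \<in> mors M X' Y'" and p: "p \<in> isos M X X'" and q: "q \<in> isos M Y Y'"
    and sq: "Cmp M X X' Y' g p = Cmp M X Y Y' q f"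
  shows "Cmp M X' X Y f (minv M X X' p) = Cmp M X' Y' Y (minv M Y Y' q) g"
proof -
  note mp = M.minv[OF p] and mq = M.minv[OF q]
  have "Cmp M X' X Y f (minv M X X' p) = Cmp M X' Y' Y (minv M Y Y' q) (Cmp M X' X Y' (Cmp M X Y Y' q f) (minv M X X' p))"
    using X f mp mq by (simp add: M.comp_assoc_right M.comp_cancel)
  also have "\<dots> = Cmp M X' Y' Y (minv M Y Y' q) g"
    unfolding sq[symmetric] using X g mp mq by (simp add: M.comp_assoc_right M.comp_id_right)
  finally show ?thesis .
qed

lemma interchange:
  assumes "B \<in> Ob C" "D \<in> Ob C" "X \<in> Ob M" "Y \<in> Ob M" "a \<in> mors C B D" "f \<in> mors M X Y"
  shows "Cmp M (act_ob M B X) (act_ob M D X) (act_ob M D Y) (act_mor M D D X Y (Idn C D) f) (act_mor M B D X X a (Idn M X)) =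
    Cmp M (act_ob M B X) (act_ob M B Y) (act_ob M D Y) (act_mor M B D Y Y a (Idn M Y)) (act_mor M B B X Y (Idn C B) f)"
  using assms by (simp add: act_comp[symmetric] C.comp_id_left C.comp_id_right M.comp_id_left M.comp_id_right)

lemma assoc_AA_natural:
  assumes "X \<in> Ob M" "Y \<in> Ob M" "f \<in> mors M X Y"
  shows "Cmp M (act_ob M AA X) (Fo (Fo X)) (Fo (Fo Y)) (Fm (Fo X) (Fo Y) (Fm X Y f)) (act_assoc M A A X) =
    Cmp M (act_ob M AA X) (act_ob M AA Y) (Fo (Fo Y)) (act_assoc M A A Y) (act_mor M AA AA X Y (Idn C AA) f)"
  using act_assoc_natural[of A A A A X Y "Idn C A" "Idn C A" f] assms
  by (simp add: Fo_def Fm_def C.tens_id)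

lemma square_comp:
  assumes X: "X \<in> Ob M" "Y \<in> Ob M" "Z \<in> Ob M" "X' \<in> Ob M" "Y' \<in> Ob M" "Z' \<in> Ob M"
    and h: "f \<in> mors M X X'" "g \<in> mors M Y Y'" "h \<in> mors M Z Z'" "p \<in> mors M X Y" "q \<in> mors M Y Z" "p' \<in> mors M X' Y'" "q' \<in> mors M Y' Z'"
    and sq: "Cmp M X Y Y' g p = Cmp M X X' Y' p' f" "Cmp M Y Z Z' h q = Cmp M Y Y' Z' q' g"
  shows "Cmp M X Z Z' h (Cmp M X Y Z q p) = Cmp M X X' Z' (Cmp M X' Y' Z' q' p') f"
proof -
  have "Cmp M X Z Z' h (Cmp M X Y Z q p) = Cmp M X Y Z' (Cmp M Y Z Z' h q) p" using X h by (simp add: M.comp_assoc)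
  also have "\<dots> = Cmp M X Y' Z' q' (Cmp M X Y Y' g p)" unfolding sq(2) using X h by (simp add: M.comp_assoc_right)
  also have "\<dots> = Cmp M X X' Z' (Cmp M X' Y' Z' q' p') f" unfolding sq(1) using X h by (simp add: M.comp_assoc)
  finally show ?thesis .
qed

lemma \<eta>_natural:
  assumes X: "X \<in> Ob M" "Y \<in> Ob M" and f: "f \<in> mors M X Y"
  shows "Cmp M X (Fo (Fo X)) (Fo (Fo Y)) (Fm (Fo X) (Fo Y) (Fm X Y f)) (\<eta> X) = Cmp M X Y (Fo (Fo Y)) (\<eta> Y) f"
proof -
  have Uf: "act_mor M U U X Y (Idn C U) f \<in> mors M (act_ob M U X) (act_ob M U Y)" using X f by simp
  have AAf: "act_mor M AA AA X Y (Idn C AA) f \<in> mors M (act_ob M AA X) (act_ob M AA Y)" using X f by simp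
  note u = M.minv(2)[OF act_unit_iso] and a = M.isos_hom[OF assoc_AA]
  have 1: "Cmp M X (act_ob M U X) (act_ob M U Y) (act_mor M U U X Y (Idn C U) f) (minv M (act_ob M U X) X (act_unit M X)) =
      Cmp M X Y (act_ob M U Y) (minv M (act_ob M U Y) Y (act_unit M Y)) f"
    by (rule inverse_natural) (use X f Uf act_unit_iso act_unit_natural in auto)
  have 2: "Cmp M X (act_ob M AA X) (act_ob M AA Y) (act_mor M AA AA X Y (Idn C AA) f)
        (Cmp M X (act_ob M U X) (act_ob M AA X) (act_mor M U AA X X coev (Idn M X)) (minv M (act_ob M U X) X (act_unit M X))) =
      Cmp M X Y (act_ob M AA Y) (Cmp M Y (act_ob M U Y) (act_ob M AA Y) (act_mor M U AA Y Y coev (Idn M Y)) (minv M (act_ob M U Y) Y (act_unit M Y))) f"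
    by (rule square_comp[OF _ _ _ _ _ _ f Uf AAf _ _ _ _ 1 interchange]) (use X f u in auto)
  show ?thesis
    unfolding \<eta>_def by (rule square_comp[OF _ _ _ _ _ _ f AAf _ _ _ _ _ 2 assoc_AA_natural[OF X f]]) (use X f u a in auto)
qed

lemma \<epsilon>_natural:
  assumes X: "X \<in> Ob M" "Y \<in> Ob M" and f: "f \<in> mors M X Y"
  shows "Cmp M (Fo (Fo X)) (Fo (Fo Y)) Y (\<epsilon> Y) (Fm (Fo X) (Fo Y) (Fm X Y f)) = Cmp M (Fo (Fo X)) X Y f (\<epsilon> X)"
proof -
  have Uf: "act_mor M U U X Y (Idn C U) f \<in> mors M (act_ob M U X) (act_ob M U Y)" using X f by simp
  have AAf: "act_mor M AA AA X Y (Idn C AA) f \<in> mors M (act_ob M AA X) (act_ob M AA Y)" using X f by simp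
  have FFf: "Fm (Fo X) (Fo Y) (Fm X Y f) \<in> mors M (Fo (Fo X)) (Fo (Fo Y))" using X f by simp
  note u = M.isos_hom[OF act_unit_iso] and a = M.minv(2)[OF assoc_AA]
  have 1: "Cmp M (Fo (Fo X)) (act_ob M AA X) (act_ob M AA Y) (act_mor M AA AA X Y (Idn C AA) f) (minv M (act_ob M AA X) (Fo (Fo X)) (act_assoc M A A X)) =
      Cmp M (Fo (Fo X)) (Fo (Fo Y)) (act_ob M AA Y) (minv M (act_ob M AA Y) (Fo (Fo Y)) (act_assoc M A A Y)) (Fm (Fo X) (Fo Y) (Fm X Y f))"
    by (rule inverse_natural[OF _ _ _ _ AAf FFf assoc_AA assoc_AA assoc_AA_natural[OF X f]]) (use X in auto)
  have 2: "Cmp M (Fo (Fo X)) (act_ob M U X) (act_ob M U Y) (act_mor M U U X Y (Idn C U) f)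
        (Cmp M (Fo (Fo X)) (act_ob M AA X) (act_ob M U X) (act_mor M AA U X X ev (Idn M X)) (minv M (act_ob M AA X) (Fo (Fo X)) (act_assoc M A A X))) =
      Cmp M (Fo (Fo X)) (Fo (Fo Y)) (act_ob M U Y) (Cmp M (Fo (Fo Y)) (act_ob M AA Y) (act_ob M U Y) (act_mor M AA U Y Y ev (Idn M Y))
        (minv M (act_ob M AA Y) (Fo (Fo Y)) (act_assoc M A A Y))) (Fm (Fo X) (Fo Y) (Fm X Y f))"
    by (rule square_comp[OF _ _ _ _ _ _ FFf AAf Uf _ _ _ _ 1 interchange]) (use X f a in auto)
  show ?thesis
    unfolding \<epsilon>_def by (rule square_comp[OF _ _ _ _ _ _ FFf Uf f _ _ _ _ 2 act_unit_natural[OF X f], symmetric]) (use X f u a in auto)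
qed

end

context self_dual_action
begin

text \<open>Up to unitors and associators of the action, the composite is the action of the
  isomorphism \<open>zig\<close> on \<open>X\<close>; the comparison uses naturality of the
  associator at \<open>coev\<close> and \<open>ev\<close>, and the pentagon.\<close>

lemma \<epsilon>_\<eta>_iso:
  assumes X: "X \<in> Ob M"
  shows "Cmp M (Fo X) (Fo (Fo (Fo X))) (Fo X) (Fm (Fo (Fo X)) X (\<epsilon> X)) (\<eta> (Fo X)) \<in> isos M (Fo X) (Fo X)"
proof -
  let ?AX = "Fo X" and ?UX = "act_ob M U X" and ?AAX = "act_ob M AA X"
  let ?UAX = "act_ob M U ?AX" and ?AAAX = "act_ob M AA ?AX" and ?AUX = "Fo ?UX" and ?FFX = "Fo (Fo X)"
  let ?AAX' = "Fo ?AAX" and ?F3 = "Fo (Fo (Fo X))"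
  let ?L = "act_ob M (tens_ob C AA A) X" and ?R = "act_ob M (tens_ob C A AA) X" 
  let ?UA = "act_ob M (tens_ob C U A) X" and ?AU = "act_ob M (tens_ob C A U) X"
  have o: "?AX \<in> Ob M" "?UX \<in> Ob M" "?AAX \<in> Ob M" "?UAX \<in> Ob M" "?AAAX \<in> Ob M" "?AUX \<in> Ob M" "?FFX \<in> Ob M"
    "?AAX' \<in> Ob M" "?F3 \<in> Ob M" "?L \<in> Ob M" "?R \<in> Ob M" "?UA \<in> Ob M" "?AU \<in> Ob M" using X by auto
  define u where "u = act_unit M X"
  define e where "e = act_mor M AA U X X ev (Idn M X)"
  define a where "a = act_assoc M A A X"
  define ai where "ai = minv M ?AAX ?FFX a"
  define v where "v = minv M ?UAX ?AX (act_unit M ?AX)"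
  define k where "k = act_mor M U AA ?AX ?AX coev (Idn M ?AX)"
  define b where "b = act_assoc M A A ?AX"
  define p where "p = act_assoc M AA A X"
  define q where "q = act_assoc M A AA X"
  define r where "r = act_assoc M A U X"
  define s where "s = act_assoc M U A X"
  define \<alpha> where "\<alpha> = act_mor M (tens_ob C AA A) (tens_ob C A AA) X X (associator C A A A) (Idn M X)"
  define Ae where "Ae = act_mor M (tens_ob C A AA) (tens_ob C A U) X X (tens_mor C A A AA U (Idn C A) ev) (Idn M X)"
  define kA where "kA = act_mor M (tens_ob C U A) (tens_ob C AA A) X X (tens_mor C U AA A A coev (Idn C A)) (Idn M X)"
  note A3 = C.isos_hom[OF C.associator_iso[OF A A A]]
  note ev3 = tens_hom[OF A A _ _ C.id_closed[OF A] ev, simplified] tens_hom[OF _ _ A A coev C.id_closed[OF A], simplified]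
  have iso: "u \<in> isos M ?UX X" "a \<in> isos M ?AAX ?FFX" "b \<in> isos M ?AAAX ?F3" "p \<in> isos M ?L ?AAAX"
    "q \<in> isos M ?R ?AAX'" "r \<in> isos M ?AU ?AUX" "s \<in> isos M ?UA ?UAX"
    using X act_unit_iso act_assoc_iso unfolding u_def a_def b_def p_def q_def r_def s_def Fo_def by auto
  have v: "v \<in> isos M ?AX ?UAX" unfolding v_def using o act_unit_iso by (intro M.minv) auto
  note minv_a = M.minv[OF iso(2), folded ai_def]
  have h: "e \<in> mors M ?AAX ?UX" "ai \<in> mors M ?FFX ?AAX" "k \<in> mors M ?UAX ?AAAX" 
    "\<alpha> \<in> mors M ?L ?R" "Ae \<in> mors M ?R ?AU" "kA \<in> mors M ?UA ?L"
    "u \<in> mors M ?UX X" "a \<in> mors M ?AAX ?FFX" "b \<in> mors M ?AAAX ?F3" "p \<in> mors M ?L ?AAAX"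
    "q \<in> mors M ?R ?AAX'" "r \<in> mors M ?AU ?AUX" "s \<in> mors M ?UA ?UAX" "v \<in> mors M ?AX ?UAX"
    using X o minv_a iso v A3 ev3 by (auto simp: e_def k_def \<alpha>_def Ae_def kA_def M.isos_hom)
  have Fh: "Fm ?UX X u \<in> mors M ?AUX ?AX" "Fm ?AAX ?UX e \<in> mors M ?AAX' ?AUX" "Fm ?FFX ?AAX ai \<in> mors M ?F3 ?AAX'"
    "Fm ?AAX ?FFX a \<in> mors M ?AAX' ?F3" using X o h by auto
  have n1: "Cmp M ?UA ?UAX ?AAAX k s = Cmp M ?UA ?L ?AAAX p kA"
    using act_assoc_natural[of U AA A A X X coev "Idn C A" "Idn M X"] X
    by (simp add: k_def s_def p_def kA_def act_id Fo_def)
  have n2: "Cmp M ?R ?AAX' ?AUX (Fm ?AAX ?UX e) q = Cmp M ?R ?AU ?AUX r Ae"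
    using act_assoc_natural[of A A AA U X X "Idn C A" ev "Idn M X"] X
    by (simp add: Fm_def e_def q_def r_def Ae_def Fo_def)
  have pent: "Cmp M ?L ?AAAX ?F3 b p = Cmp M ?L ?AAX' ?F3 (Fm ?AAX ?FFX a) (Cmp M ?L ?R ?AAX' q \<alpha>)"
    using act_pentagon[of A A A X] X by (simp add: Fm_def b_def p_def a_def q_def \<alpha>_def Fo_def)
  have aia: "Cmp M ?AAX' ?F3 ?AAX' (Fm ?FFX ?AAX ai) (Fm ?AAX ?FFX a) = Idn M ?AAX'"
    using minv_a o by (simp add: Fm_comp[symmetric] Fm_id)
  \<comment> \<open>The triangle composite without its outer unitors. Below, \<open>n1\<close>,
    \<open>pent\<close> and \<open>n2\<close> rewrite \<open>?Q s\<close> as \<open>r ?z\<close>,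
    where \<open>?z\<close> is the action of the zigzag and \<open>r\<close>, \<open>s\<close> are
    invertible.\<close>
  let ?Q = "Cmp M ?UAX ?AAX' ?AUX (Fm ?AAX ?UX e) (Cmp M ?UAX ?F3 ?AAX' (Fm ?FFX ?AAX ai) (Cmp M ?UAX ?AAAX ?F3 b k))"
  let ?z = "Cmp M ?UA ?R ?AU Ae (Cmp M ?UA ?L ?R \<alpha> kA)"
  have "Cmp M ?UA ?UAX ?AUX ?Q s = Cmp M ?UA ?AAX' ?AUX (Fm ?AAX ?UX e) (Cmp M ?UA ?F3 ?AAX' (Fm ?FFX ?AAX ai)
      (Cmp M ?UA ?AAAX ?F3 b (Cmp M ?UA ?UAX ?AAAX k s)))"
    using o h Fh by (simp add: M.comp_assoc_right)
  also have "\<dots> = Cmp M ?UA ?AAX' ?AUX (Fm ?AAX ?UX e) (Cmp M ?UA ?F3 ?AAX' (Fm ?FFX ?AAX ai)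
      (Cmp M ?UA ?L ?F3 (Cmp M ?L ?AAAX ?F3 b p) kA))"
    unfolding n1 using o h Fh by (simp add: M.comp_assoc_right)
  also have "\<dots> = Cmp M ?UA ?R ?AUX (Cmp M ?R ?AAX' ?AUX (Fm ?AAX ?UX e) q) (Cmp M ?UA ?L ?R \<alpha> kA)"
    unfolding pent using o h Fh aia by (simp add: M.comp_assoc_right M.comp_cancel)
  also have "\<dots> = Cmp M ?UA ?AU ?AUX r ?z"
    unfolding n2 using o h by (simp add: M.comp_assoc_right)
  finally have Qs: "Cmp M ?UA ?UAX ?AUX ?Q s = Cmp M ?UA ?AU ?AUX r ?z" .
  have "?z = act_mor M (tens_ob C U A) (tens_ob C A U) X X (Cmp C (tens_ob C U A) (tens_ob C AA A) (tens_ob C A U)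
        (Cmp C (tens_ob C AA A) (tens_ob C A AA) (tens_ob C A U)
          (tens_mor C A A AA U (Idn C A) ev) (associator C A A A))
        (tens_mor C U AA A A coev (Idn C A))) (Idn M X)"
    using X A3 ev3 unfolding Ae_def \<alpha>_def kA_def
    by (simp add: act_comp[symmetric] M.comp_id_left C.comp_assoc)
  then have "?z \<in> isos M ?UA ?AU"
    using zig X by (simp add: act_iso M.id_iso)
  then have rz: "Cmp M ?UA ?AU ?AUX r ?z \<in> isos M ?UA ?AUX" by (rule M.comp_iso[OF o(12,13,6) _ iso(6)])
  have Q: "?Q \<in> mors M ?UAX ?AUX" using o h Fh by (intro M.comp_closed)
  have "?Q = Cmp M ?UAX ?UA ?AUX (Cmp M ?UA ?UAX ?AUX ?Q s) (minv M ?UA ?UAX s)"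
    by (simp only: M.comp_assoc_right[OF o(4,12,4,6) M.minv(2)[OF iso(7)] h(13) Q] M.minv(4)[OF iso(7)] M.comp_id_right[OF o(4,6) Q])
  then have Q_iso: "?Q \<in> isos M ?UAX ?AUX"
    using M.comp_iso[OF o(4,12,6) M.minv(5)[OF iso(7)] rz] unfolding Qs[symmetric] by (elim ssubst)
  have "Fm ?UX X u \<in> isos M ?AUX ?AX"
    using act_iso[OF A A o(2) X C.id_iso[OF A] iso(1)] by (simp add: Fm_def Fo_def)
  then have "Cmp M ?AX ?AUX ?AX (Fm ?UX X u) (Cmp M ?AX ?UAX ?AUX ?Q v) \<in> isos M ?AX ?AX"
    by (rule M.comp_iso[OF o(1,6,1) M.comp_iso[OF o(1,4,6) v Q_iso]])
  also have "Cmp M ?AX ?AUX ?AX (Fm ?UX X u) (Cmp M ?AX ?UAX ?AUX ?Q v) =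
      Cmp M ?AX ?F3 ?AX (Fm (Fo (Fo X)) X (\<epsilon> X)) (\<eta> ?AX)"
  proof -
    have "Fm ?FFX X (\<epsilon> X) = Cmp M ?F3 ?AUX ?AX (Fm ?UX X u) (Cmp M ?F3 ?AAX' ?AUX (Fm ?AAX ?UX e) (Fm ?FFX ?AAX ai))"
      unfolding \<epsilon>_def u_def[symmetric] e_def[symmetric] a_def[symmetric] ai_def[symmetric]
      using X o h by (simp add: Fm_comp)
    moreover have "\<eta> ?AX = Cmp M ?AX ?AAAX ?F3 b (Cmp M ?AX ?UAX ?AAAX k v)"
      by (simp add: \<eta>_def b_def k_def v_def)
    ultimately show ?thesis using X o h Fh by (simp add: M.comp_assoc_right)
  qed
  finally show ?thesis .
qed

text \<open>The mirror image, with \<open>zag\<close>. The associator of \<open>A\<close> is now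
  passed in the reverse direction, which is why \<open>a'\<close> appears.\<close>

lemma \<epsilon>_\<eta>_iso':
  assumes X: "X \<in> Ob M"
  shows "Cmp M (Fo X) (Fo (Fo (Fo X))) (Fo X) (\<epsilon> (Fo X)) (Fm X (Fo (Fo X)) (\<eta> X)) \<in> isos M (Fo X) (Fo X)"
proof -
  let ?AX = "Fo X" and ?UX = "act_ob M U X" and ?AAX = "act_ob M AA X"
  let ?UAX = "act_ob M U ?AX" and ?AAAX = "act_ob M AA ?AX" and ?AUX = "Fo ?UX" and ?FFX = "Fo (Fo X)"
  let ?AAX' = "Fo ?AAX" and ?F3 = "Fo (Fo (Fo X))"
  let ?L = "act_ob M (tens_ob C AA A) X" and ?R = "act_ob M (tens_ob C A AA) X" 
  let ?UA = "act_ob M (tens_ob C U A) X" and ?AU = "act_ob M (tens_ob C A U) X"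
  have o: "?AX \<in> Ob M" "?UX \<in> Ob M" "?AAX \<in> Ob M" "?UAX \<in> Ob M" "?AAAX \<in> Ob M" "?AUX \<in> Ob M" "?FFX \<in> Ob M"
    "?AAX' \<in> Ob M" "?F3 \<in> Ob M" "?L \<in> Ob M" "?R \<in> Ob M" "?UA \<in> Ob M" "?AU \<in> Ob M" using X by auto
  define u where "u = minv M ?UX X (act_unit M X)"
  define e where "e = act_mor M AA U ?AX ?AX ev (Idn M ?AX)"
  define a where "a = act_assoc M A A X"
  define v where "v = act_unit M ?AX"
  define k where "k = act_mor M U AA X X coev (Idn M X)"
  define b where "b = act_assoc M A A ?AX"
  define bi where "bi = minv M ?AAAX ?F3 b"
  define p where "p = act_assoc M AA A X"
  define q where "q = act_assoc M A AA X"
  define r where "r = act_assoc M A U X"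
  define s where "s = act_assoc M U A X"
  define \<alpha> where "\<alpha> = act_mor M (tens_ob C AA A) (tens_ob C A AA) X X (associator C A A A) (Idn M X)"
  define \<alpha>' where "\<alpha>' = act_mor M (tens_ob C A AA) (tens_ob C AA A) X X a' (Idn M X)"
  define eA where "eA = act_mor M (tens_ob C AA A) (tens_ob C U A) X X (tens_mor C AA U A A ev (Idn C A)) (Idn M X)"
  define Ak where "Ak = act_mor M (tens_ob C A U) (tens_ob C A AA) X X (tens_mor C A A U AA (Idn C A) coev) (Idn M X)"
  note A3 = C.isos_hom[OF C.associator_iso[OF A A A]]
  note ev3 = tens_hom[OF A A _ _ C.id_closed[OF A] coev, simplified] tens_hom[OF _ _ A A ev C.id_closed[OF A], simplified]
  have iso: "act_unit M X \<in> isos M ?UX X" "a \<in> isos M ?AAX ?FFX" "b \<in> isos M ?AAAX ?F3" "p \<in> isos M ?L ?AAAX"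
    "q \<in> isos M ?R ?AAX'" "r \<in> isos M ?AU ?AUX" "s \<in> isos M ?UA ?UAX" "v \<in> isos M ?UAX ?AX"
    using X act_unit_iso act_assoc_iso unfolding v_def a_def b_def p_def q_def r_def s_def Fo_def by auto
  have u: "u \<in> isos M X ?UX" unfolding u_def by (rule M.minv[OF iso(1)])
  note minv_b = M.minv[OF iso(3), folded bi_def]
  have h: "e \<in> mors M ?AAAX ?UAX" "bi \<in> mors M ?F3 ?AAAX" "k \<in> mors M ?UX ?AAX" 
    "\<alpha> \<in> mors M ?L ?R" "eA \<in> mors M ?L ?UA" "Ak \<in> mors M ?AU ?R"
    "u \<in> mors M X ?UX" "a \<in> mors M ?AAX ?FFX" "b \<in> mors M ?AAAX ?F3" "p \<in> mors M ?L ?AAAX"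
    "q \<in> mors M ?R ?AAX'" "r \<in> mors M ?AU ?AUX" "s \<in> mors M ?UA ?UAX" "v \<in> mors M ?UAX ?AX" "\<alpha>' \<in> mors M ?R ?L"
    using X o minv_b iso u A3 ev3 by (auto simp: e_def k_def \<alpha>_def \<alpha>'_def eA_def Ak_def M.isos_hom)
  have Fh: "Fm X ?UX u \<in> mors M ?AX ?AUX" "Fm ?UX ?AAX k \<in> mors M ?AUX ?AAX'"
    "Fm ?AAX ?FFX a \<in> mors M ?AAX' ?F3" using X o h by auto
  have n1: "Cmp M ?L ?AAAX ?UAX e p = Cmp M ?L ?UA ?UAX s eA"
    using act_assoc_natural[of AA U A A X X ev "Idn C A" "Idn M X"] X
    by (simp add: e_def s_def p_def eA_def act_id Fo_def)
  have n2: "Cmp M ?AU ?AUX ?AAX' (Fm ?UX ?AAX k) r = Cmp M ?AU ?R ?AAX' q Ak"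
    using act_assoc_natural[of A A U AA X X "Idn C A" coev "Idn M X"] X
    by (simp add: Fm_def k_def q_def r_def Ak_def Fo_def)
  have pent: "Cmp M ?L ?AAAX ?F3 b p = Cmp M ?L ?AAX' ?F3 (Fm ?AAX ?FFX a) (Cmp M ?L ?R ?AAX' q \<alpha>)"
    using act_pentagon[of A A A X] X by (simp add: Fm_def b_def p_def a_def q_def \<alpha>_def Fo_def)
  have \<alpha>\<alpha>': "Cmp M ?R ?L ?R \<alpha> \<alpha>' = Idn M ?R"
    using X A3 assoc_a' by (simp add: \<alpha>_def \<alpha>'_def act_comp[symmetric] M.comp_id_left act_id)
  \<comment> \<open>The pentagon composed with \<open>\<alpha>'\<close> on the right, so that it can
    be read from \<open>?R\<close> instead of \<open>?L\<close>.\<close>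
  have "Cmp M ?R ?AAX' ?F3 (Fm ?AAX ?FFX a) q = Cmp M ?R ?L ?F3 (Cmp M ?L ?AAX' ?F3 (Fm ?AAX ?FFX a) (Cmp M ?L ?R ?AAX' q \<alpha>)) \<alpha>'"
    using o h Fh \<alpha>\<alpha>' by (simp add: M.comp_assoc_right M.comp_id_right)
  then have pent': "Cmp M ?R ?AAX' ?F3 (Fm ?AAX ?FFX a) q = Cmp M ?R ?AAAX ?F3 b (Cmp M ?R ?L ?AAAX p \<alpha>')"
    unfolding pent[symmetric] using o h by (simp add: M.comp_assoc_right)
  let ?Q = "Cmp M ?AUX ?AAAX ?UAX e (Cmp M ?AUX ?F3 ?AAAX bi (Cmp M ?AUX ?AAX' ?F3 (Fm ?AAX ?FFX a) (Fm ?UX ?AAX k)))"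
  let ?z = "Cmp M ?AU ?L ?UA eA (Cmp M ?AU ?R ?L \<alpha>' Ak)"
  have "Cmp M ?AU ?AUX ?UAX ?Q r = Cmp M ?AU ?AAAX ?UAX e (Cmp M ?AU ?F3 ?AAAX bi
      (Cmp M ?AU ?AAX' ?F3 (Fm ?AAX ?FFX a) (Cmp M ?AU ?AUX ?AAX' (Fm ?UX ?AAX k) r)))"
    using o h Fh by (simp add: M.comp_assoc_right)
  also have "\<dots> = Cmp M ?AU ?AAAX ?UAX e (Cmp M ?AU ?F3 ?AAAX bi
      (Cmp M ?AU ?R ?F3 (Cmp M ?R ?AAX' ?F3 (Fm ?AAX ?FFX a) q) Ak))"
    unfolding n2 using o h Fh by (simp add: M.comp_assoc_right)
  also have "\<dots> = Cmp M ?AU ?L ?UAX (Cmp M ?L ?AAAX ?UAX e p) (Cmp M ?AU ?R ?L \<alpha>' Ak)"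
    unfolding pent' using o h minv_b by (simp add: M.comp_assoc_right M.comp_cancel)
  also have "\<dots> = Cmp M ?AU ?UA ?UAX s ?z"
    unfolding n1 using o h by (simp add: M.comp_assoc_right)
  finally have Qr: "Cmp M ?AU ?AUX ?UAX ?Q r = Cmp M ?AU ?UA ?UAX s ?z" .
  have "?z = act_mor M (tens_ob C A U) (tens_ob C U A) X X (Cmp C (tens_ob C A U) (tens_ob C A AA) (tens_ob C U A)
        (Cmp C (tens_ob C A AA) (tens_ob C AA A) (tens_ob C U A) (tens_mor C AA U A A ev (Idn C A)) a')
        (tens_mor C A A U AA (Idn C A) coev)) (Idn M X)"
    using X A3 ev3 unfolding eA_def \<alpha>'_def Ak_def
    by (simp add: act_comp[symmetric] M.comp_id_left C.comp_assoc)
  then have "?z \<in> isos M ?AU ?UA"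
    using zag X by (simp add: act_iso M.id_iso)
  then have sz: "Cmp M ?AU ?UA ?UAX s ?z \<in> isos M ?AU ?UAX" by (rule M.comp_iso[OF o(13,12,4) _ iso(7)])
  have Q: "?Q \<in> mors M ?AUX ?UAX" using o h Fh by (intro M.comp_closed)
  have "?Q = Cmp M ?AUX ?AU ?UAX (Cmp M ?AU ?AUX ?UAX ?Q r) (minv M ?AU ?AUX r)"
    by (simp only: M.comp_assoc_right[OF o(6,13,6,4) M.minv(2)[OF iso(6)] h(12) Q] M.minv(4)[OF iso(6)] M.comp_id_right[OF o(6,4) Q])
  then have Q_iso: "?Q \<in> isos M ?AUX ?UAX"
    using M.comp_iso[OF o(6,13,4) M.minv(5)[OF iso(6)] sz] unfolding Qr[symmetric] by (elim ssubst)
  have "Fm X ?UX u \<in> isos M ?AX ?AUX"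
    using act_iso[OF A A X o(2) C.id_iso[OF A] u] by (simp add: Fm_def Fo_def)
  then have "Cmp M ?AX ?UAX ?AX v (Cmp M ?AX ?AUX ?UAX ?Q (Fm X ?UX u)) \<in> isos M ?AX ?AX"
    by (intro M.comp_iso[OF o(1,4,1) M.comp_iso[OF o(1,6,4) _ Q_iso] iso(8)])
  also have "Cmp M ?AX ?UAX ?AX v (Cmp M ?AX ?AUX ?UAX ?Q (Fm X ?UX u)) =
      Cmp M ?AX ?F3 ?AX (\<epsilon> ?AX) (Fm X (Fo (Fo X)) (\<eta> X))"
  proof -
    have "Fm X ?FFX (\<eta> X) = Cmp M ?AX ?AAX' ?F3 (Fm ?AAX ?FFX a) (Cmp M ?AX ?AUX ?AAX' (Fm ?UX ?AAX k) (Fm X ?UX u))"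
      unfolding \<eta>_def u_def[symmetric] k_def[symmetric] a_def[symmetric]
      using X o h by (simp add: Fm_comp)
    moreover have "\<epsilon> ?AX = Cmp M ?F3 ?UAX ?AX v (Cmp M ?F3 ?AAAX ?UAX e bi)"
      by (simp add: \<epsilon>_def b_def bi_def e_def v_def)
    ultimately show ?thesis using X o h Fh by (simp add: M.comp_assoc_right)
  qed
  finally show ?thesis .
qed

end

section \<open>Local objects and nilpotency of the radical\<close>

context linear_category
begin

lemma zero_object_iff: "zero_object C X \<longleftrightarrow> X \<in> Ob C \<and> Idn C X = zero_mor C X X"
proof (intro iffI conjI)
  assume *: "zero_object C X"
  then show X: "X \<in> Ob C" unfolding zero_object_def by (rule conjunct1)
  show "Idn C X = zero_mor C X X"
    using * X id_closed zero_closed unfolding zero_object_def by blast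
next
  assume *: "X \<in> Ob C \<and> Idn C X = zero_mor C X X"
  then have X: "X \<in> Ob C" by simp
  have 1: "f = zero_mor C X Y" if Y: "Y \<in> Ob C" and f: "f \<in> mors C X Y" for Y f
    using comp_id_right[OF X Y f] comp_zero_right[OF X X Y f] * by simp
  have 2: "f = zero_mor C Y X" if Y: "Y \<in> Ob C" and f: "f \<in> mors C Y X" for Y f
    using comp_id_left[OF Y X f] comp_zero_left[OF Y X X f] * by simp
  have "\<exists>!f. f \<in> mors C X Y" if "Y \<in> Ob C" for Y
    using zero_closed[OF X that] 1[OF that] by (intro ex1I[of _ "zero_mor C X Y"])
  moreover have "\<exists>!f. f \<in> mors C Y X" if "Y \<in> Ob C" for Y
    using zero_closed[OF that X] 2[OF that] by (intro ex1I[of _ "zero_mor C Y X"])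
  ultimately show "zero_object C X" using X unfolding zero_object_def by (intro conjI ballI)
qed

lemma local_iso:
  assumes X: "X \<in> Ob C" "Y \<in> Ob C" and loc: "local_endomorphism_ring C Y" and \<phi>: "\<phi> \<in> isos C Y X"
  shows "local_endomorphism_ring C X"
proof -
  obtain \<psi> where i: "\<phi> \<in> mors C Y X" "\<psi> \<in> mors C X Y" "\<psi> \<in> isos C X Y" "Cmp C Y X Y \<psi> \<phi> = Idn C Y" "Cmp C X Y X \<phi> \<psi> = Idn C X"
    using \<phi> by (rule isosE)
  let ?c = "\<lambda>f. Cmp C Y X Y \<psi> (Cmp C Y X X f \<phi>)"
  have iso: "?c f \<in> isos C Y Y \<longleftrightarrow> f \<in> isos C X X" if f: "f \<in> mors C X X" for f
  proof
    show "?c f \<in> isos C Y Y" if "f \<in> isos C X X" using comp_iso[OF X(2) X(1) X(2) comp_iso[OF X(2) X(1) X(1) \<phi> that] i(3)] .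
    assume "?c f \<in> isos C Y Y"
    from comp_iso[OF X(1) X(2) X(1) comp_iso[OF X(1) X(2) X(2) i(3) this] \<phi>]
    show "f \<in> isos C X X" using f X i by (simp add: comp_assoc_right comp_cancel comp_id_right)
  qed
  have "Cmp C Y X X (Idn C X) \<phi> = \<phi>" using X i by (simp add: comp_id_left)
  then have "?c (Idn C X) = Idn C Y" using i by simp
  then have "Idn C X \<noteq> zero_mor C X X"
    using local_id_nonzero[OF loc] X i by (auto simp: comp_zero_left comp_zero_right)
  moreover have "f \<oplus>\<^bsub>Mor C X X\<^esub> g \<notin> isos C X X"
    if f: "f \<in> mors C X X - isos C X X" and g: "g \<in> mors C X X - isos C X X" for f g
  proof -
    have "?c f \<oplus>\<^bsub>Mor C Y Y\<^esub> ?c g \<notin> isos C Y Y"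
      using loc f g X i iso[of f] iso[of g] unfolding local_endomorphism_ring_def by blast
    moreover have "?c (f \<oplus>\<^bsub>Mor C X X\<^esub> g) = ?c f \<oplus>\<^bsub>Mor C Y Y\<^esub> ?c g"
      using f g X i by (simp add: comp_add_left comp_add_right)
    ultimately show ?thesis using iso[of "f \<oplus>\<^bsub>Mor C X X\<^esub> g"] f g X by auto
  qed
  ultimately show ?thesis by (auto simp: local_endomorphism_ring_def)
qed

text \<open>The idempotent that projects to \<open>Y\<close> is the identity or zero, which makes
  \<open>Z\<close> or \<open>Y\<close> a zero object.\<close>

lemma local_indecomposable:
  assumes X: "X \<in> Ob C" and loc: "local_endomorphism_ring C X"
  shows "indecomposable C X"
  unfolding indecomposable_def
proof (intro conjI ballI impI)
  show "\<not> zero_object C X" using local_id_nonzero[OF loc] by (simp add: zero_object_iff)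
  fix Y Z assume Y: "Y \<in> Ob C" and Z: "Z \<in> Ob C" and ds: "direct_sum C [Y, Z] X"
  let ?Xs = "[Y, Z]"
  obtain \<iota> \<pi> where ip: "\<And>j. j < length ?Xs \<Longrightarrow> \<iota> j \<in> mors C (?Xs ! j) X" "\<And>j. j < length ?Xs \<Longrightarrow> \<pi> j \<in> mors C X (?Xs ! j)"
    "\<And>j. j < length ?Xs \<Longrightarrow> Cmp C (?Xs ! j) X (?Xs ! j) (\<pi> j) (\<iota> j) = Idn C (?Xs ! j)"
    "\<And>j k. j < length ?Xs \<Longrightarrow> k < length ?Xs \<Longrightarrow> j \<noteq> k \<Longrightarrow>
        Cmp C (?Xs ! j) X (?Xs ! k) (\<pi> k) (\<iota> j) = zero_mor C (?Xs ! j) (?Xs ! k)"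
    using ds by (rule direct_sumE) blast
  have m: "\<iota> 0 \<in> mors C Y X" "\<pi> 0 \<in> mors C X Y" "Cmp C Y X Y (\<pi> 0) (\<iota> 0) = Idn C Y"
    "\<iota> 1 \<in> mors C Z X" "\<pi> 1 \<in> mors C X Z" "Cmp C Z X Z (\<pi> 1) (\<iota> 1) = Idn C Z" "Cmp C Y X Z (\<pi> 1) (\<iota> 0) = zero_mor C Y Z"
    using ip(1-3)[of 0] ip(1-3)[of 1] ip(4)[of 0 1] by simp_all
  let ?e = "Cmp C X Y X (\<iota> 0) (\<pi> 0)"
  have "Cmp C X X X ?e ?e = ?e" using X Y m by (simp add: comp_assoc_right comp_cancel)
  then consider "?e = Idn C X" | "?e = zero_mor C X X" using local_idem[OF X loc, of ?e] X Y m by auto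
  then show "zero_object C Y \<or> zero_object C Z"
  proof cases
    case 1
    have "\<pi> 1 = Cmp C X X Z (\<pi> 1) ?e" unfolding 1 using X Z m by (simp add: comp_id_right)
    also have "\<dots> = zero_mor C X Z" using X Y Z m by (simp add: comp_assoc comp_zero_left)
    finally show ?thesis using m X Z by (auto simp: zero_object_iff comp_zero_left)
  next
    case 2
    have "Cmp C Y X Y (\<pi> 0) (Cmp C Y X X ?e (\<iota> 0)) = Idn C Y"
      using X Y m by (simp add: comp_assoc_right comp_cancel comp_id_right)
    then show ?thesis unfolding 2 using X Y m by (auto simp: zero_object_iff comp_zero_left comp_zero_right)
  qed
qed (use X in simp)

text \<open>Take one local summand \<open>Y\<close> of a Krull-Schmidt decomposition of
  \<open>X\<close>. Its complement is zero by indecomposability, so \<open>X\<close> is isomorphic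
  to \<open>Y\<close>.\<close>

lemma indecomposable_local:
  assumes KS: "krull_schmidt C" "idempotent_split C" and ind: "indecomposable C X"
  shows "local_endomorphism_ring C X"
proof -
  have X: "X \<in> Ob C" using ind by (simp add: indecomposable_def)
  obtain Xs where Xs: "set Xs \<subseteq> Ob C" "\<And>Y. Y \<in> set Xs \<Longrightarrow> local_endomorphism_ring C Y" "direct_sum C Xs X"
    using KS(1) X unfolding krull_schmidt_def by blast
  obtain \<iota> \<pi> where ip: "\<And>j. j < length Xs \<Longrightarrow> \<iota> j \<in> mors C (Xs ! j) X" "\<And>j. j < length Xs \<Longrightarrow> \<pi> j \<in> mors C X (Xs ! j)"
    "\<And>j. j < length Xs \<Longrightarrow> Cmp C (Xs ! j) X (Xs ! j) (\<pi> j) (\<iota> j) = Idn C (Xs ! j)"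
    "(\<Oplus>\<^bsub>Mor C X X\<^esub> j \<in> {..<length Xs}. Cmp C X (Xs ! j) X (\<iota> j) (\<pi> j)) = Idn C X"
    using Xs(3) by (rule direct_sumE) blast
  interpret A: abelian_group "Mor C X X" using X by (intro hom_abelian_group)
  have "Xs \<noteq> []"
    using ip(4) ind X by (auto simp: indecomposable_def zero_object_iff)
  then have len: "0 < length Xs" and "Xs ! 0 \<in> set Xs" by simp_all
  then obtain Y where Y: "Y = Xs ! 0" "Y \<in> Ob C" "local_endomorphism_ring C Y"
    using Xs(1,2) by blast
  define i p where "i = \<iota> 0" and "p = \<pi> 0"
  have m: "i \<in> mors C Y X" "p \<in> mors C X Y" "Cmp C Y X Y p i = Idn C Y"
    using ip(1-3)[OF len] by (simp_all add: Y i_def p_def)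
  let ?e = "Cmp C X Y X i p"
  let ?f = "Idn C X \<ominus>\<^bsub>Mor C X X\<^esub> ?e"
  have e: "?e \<in> mors C X X" "Cmp C X X X ?e ?e = ?e" using X Y m by (simp_all add: comp_assoc_right comp_cancel)
  have pf: "Cmp C X X Y p ?f = zero_mor C X Y" and fi: "Cmp C Y X X ?f i = zero_mor C Y X"
    using X Y m e abelian_group.minus_self[OF hom_abelian_group[OF X Y(2)]] abelian_group.minus_self[OF hom_abelian_group[OF Y(2) X]]
    by (simp_all add: comp_minus_left comp_minus_right comp_id_left comp_id_right comp_assoc_right comp_cancel)
  have "Cmp C X X X ?f ?f = Cmp C X X X ?f (Idn C X) \<ominus>\<^bsub>Mor C X X\<^esub> Cmp C X Y X (Cmp C Y X X ?f i) p"
    using X Y m e by (subst comp_minus_right) (simp_all only: comp_assoc closed)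
  then have ff: "Cmp C X X X ?f ?f = ?f" using X Y m e unfolding fi by (simp add: comp_zero_left A.minus_zero_right comp_id_right)
  \<comment> \<open>The complement of \<open>Y\<close>, obtained by splitting the idempotent
    \<open>1 - i p\<close>.\<close>
  then obtain Z r s where Z: "Z \<in> Ob C" "r \<in> mors C X Z" "s \<in> mors C Z X" "Cmp C X Z X s r = ?f" "Cmp C Z X Z r s = Idn C Z"
    using KS(2) X e unfolding idempotent_split_def by blast
  have ps: "Cmp C Z X Y p s = zero_mor C Z Y"
  proof -
    have "Cmp C Z X Y p s = Cmp C Z X Y (Cmp C X X Y p ?f) s"
      unfolding Z(4)[symmetric] using X Y m Z(1-3,5) by (simp add: comp_assoc_right comp_id_right)
    then show ?thesis unfolding pf using X Y Z by (simp add: comp_zero_left)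
  qed
  have ri: "Cmp C Y X Z r i = zero_mor C Y Z"
  proof -
    have "Cmp C Y X Z r i = Cmp C Y X Z r (Cmp C Y X X ?f i)"
      unfolding Z(4)[symmetric] using X Y m Z(1-3,5) by (simp add: comp_assoc_right comp_cancel)
    then show ?thesis unfolding fi using X Y Z by (simp add: comp_zero_right)
  qed
  have "direct_sum C [Y, Z] X"
    unfolding direct_sum_def
  proof (rule exI[of _ "\<lambda>j. if j = 0 then i else s"], rule exI[of _ "\<lambda>j. if j = 0 then p else r"],
      intro conjI allI impI)
    have "(\<Oplus>\<^bsub>Mor C X X\<^esub>j\<in>{0, Suc 0}. Cmp C X ([Y, Z] ! j) X (if j = 0 then i else s) (if j = 0 then p else r)) = ?e \<oplus>\<^bsub>Mor C X X\<^esub> ?f"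
      using X Z e by (simp add: A.finsum_insert)
    also have "\<dots> = Idn C X" using X e A.minus_add_cancel[of "Idn C X" ?e] by (simp add: A.a_comm)
    finally show "(\<Oplus>\<^bsub>Mor C X X\<^esub>j\<in>{..<length [Y, Z]}. Cmp C X ([Y, Z] ! j) X (if j = 0 then i else s) (if j = 0 then p else r)) = Idn C X"
      by (simp add: lessThan_Suc insert_commute)
  qed (use m Z ps ri in \<open>auto simp: less_Suc_eq nth_Cons'\<close>)
  then have "zero_object C Z"
    using ind Y Z local_id_nonzero by (auto simp: indecomposable_def zero_object_iff)
  then have "Idn C Z = zero_mor C Z Z" by (simp add: zero_object_iff)
  then have "s = zero_mor C Z X" using comp_id_right[OF Z(1) X Z(3)] comp_zero_right[OF Z(1) Z(1) X Z(3)] by metis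
  then have "?f = zero_mor C X X" using Z(4) comp_zero_left[OF X Z(1) X Z(2)] by metis
  then have "?e = Idn C X" using A.minus_eq_zero[OF id_closed[OF X] e(1)] by metis
  then have "i \<in> isos C Y X" by (rule isosI[OF m])
  then show ?thesis using local_iso[OF X Y(2,3)] by blast
qed

text \<open>Finite dimension makes the powers of \<open>f\<close> linearly dependent. Factoring out
  the lowest power that occurs gives \<open>f^m = f^m j\<close> with \<open>j\<close> radical, and
  \<open>1 - j\<close> is invertible.\<close>

lemma rad_nilpotent:
  assumes X: "X \<in> Ob C" and fd: "vectorspace.fin_dim class_ring (Mor C X X)" and f: "f \<in> J X X"
  shows "\<exists>n. cpow C X f n = zero_mor C X X"
proof -
  interpret A: abelian_group "Mor C X X" using X by (intro hom_abelian_group)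
  interpret V: vectorspace class_ring "Mor C X X" using X by (intro hom_vectorspace)
  let ?p = "cpow C X f"
  note fh [simp] = rad_hom[OF f]
  have p [simp]: "?p n \<in> mors C X X" for n using X by (induction n) auto
  have p_add: "?p (m + n) = Cmp C X X X (?p m) (?p n)" for m n
    using X by (induction n) (simp_all add: comp_id_right comp_assoc)
  have p_rad: "?p n \<in> J X X" if "n > 0" for n
  proof -
    from that obtain k where "n = Suc k" using gr0_implies_Suc by blast
    then show ?thesis using rad_comp_left[OF X X X f p[of k]] by simp
  qed
  have zero: "?p m = zero_mor C X X" if j: "j \<in> J X X" and eq: "?p m = Cmp C X X X (?p m) j" for m j
  proof -
    note jh = rad_hom[OF j]
    have "Idn C X \<ominus>\<^bsub>Mor C X X\<^esub> Cmp C X X X (Idn C X) j \<in> isos C X X"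
      using j X unfolding radical_def by blast
    then obtain u where u: "Idn C X \<ominus>\<^bsub>Mor C X X\<^esub> j \<in> mors C X X" "u \<in> mors C X X" "Cmp C X X X (Idn C X \<ominus>\<^bsub>Mor C X X\<^esub> j) u = Idn C X"
      using X jh by (auto simp: comp_id_left elim: isosE)
    have "Cmp C X X X (?p m) (Idn C X \<ominus>\<^bsub>Mor C X X\<^esub> j) = zero_mor C X X"
      using X jh eq[symmetric] by (simp add: comp_minus_right comp_id_right A.minus_self)
    then have "Cmp C X X X (Cmp C X X X (?p m) (Idn C X \<ominus>\<^bsub>Mor C X X\<^esub> j)) u = zero_mor C X X"
      using X u by (simp add: comp_zero_left)
    then show ?thesis using X u by (simp add: comp_assoc_right comp_id_right)
  qed
  show ?thesis
  \<comment> \<open>Linear dependence is a property of sets, so a repetition among the powers is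
    treated separately; it gives \<open>f^k = f^k f^(l - k)\<close> at once.\<close>
  proof (cases "inj ?p")
    case False
    then obtain k l where "k < l" "?p k = ?p l" unfolding inj_def by (metis nat_neq_iff)
    then show ?thesis using zero[OF p_rad[of "l - k"], of k] p_add[of k "l - k"] by auto
  next
    case True
    then have "infinite (range ?p)" by (simp add: range_inj_infinite)
    moreover have "range ?p \<subseteq> mors C X X" using p by blast
    ultimately have "V.lin_dep (range ?p)" using V.fin_dim_li_fin[OF fd] by blast
    then obtain B a v where B: "finite B" "B \<subseteq> range ?p" "V.lincomb a B = zero_mor C X X" "v \<in> B" "a v \<noteq> 0"
      unfolding V.lin_dep_def by (auto simp: class_ring_simps)
    define K where "K = {k. ?p k \<in> B \<and> a (?p k) \<noteq> 0}"
    define m where "m = (LEAST k. k \<in> K)"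
    have "\<exists>k. k \<in> K" using B by (auto simp: K_def)
    then have m: "m \<in> K" "\<And>k. k \<in> K \<Longrightarrow> m \<le> k" unfolding m_def by (auto intro: LeastI Least_le)
    have pm: "?p m \<in> B" "a (?p m) \<noteq> 0" using m by (auto simp: K_def)
    have "\<exists>q \<in> J X X. a w \<odot>\<^bsub>Mor C X X\<^esub> w = Cmp C X X X (?p m) q" if w: "w \<in> B - {?p m}" for w
    proof (cases "a w = 0")
      case True
      then show ?thesis using V.lmult_0[of w] B(2) w p X
        by (intro bexI[of _ "zero_mor C X X"]) (auto simp: class_ring_simps comp_zero_right rad_zero)
    next
      case False
      obtain k where k: "w = ?p k" using B(2) w by auto
      then have "k \<in> K" "k \<noteq> m" using False w by (auto simp: K_def)
      then have "m < k" using m(2)[of k] by simp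
      then have "w = Cmp C X X X (?p m) (?p (k - m))" "?p (k - m) \<in> J X X"
        using k p_add[of m "k - m"] p_rad by auto
      then show ?thesis using X p
        by (intro bexI[of _ "a w \<odot>\<^bsub>Mor C X X\<^esub> ?p (k - m)"]) (simp_all add: comp_smult_right rad_smult)
    qed
    then obtain q where q: "\<And>w. w \<in> B - {?p m} \<Longrightarrow> q w \<in> J X X"
      "\<And>w. w \<in> B - {?p m} \<Longrightarrow> a w \<odot>\<^bsub>Mor C X X\<^esub> w = Cmp C X X X (?p m) (q w)" by metis
    define j where "j = (\<Oplus>\<^bsub>Mor C X X\<^esub>w\<in>B - {?p m}. q w)"
    have "(\<Oplus>\<^bsub>Mor C X X\<^esub>w\<in>B - {?p m}. a w \<odot>\<^bsub>Mor C X X\<^esub> w) = (\<Oplus>\<^bsub>Mor C X X\<^esub>w\<in>B - {?p m}. Cmp C X X X (?p m) (q w))"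
      by (rule A.finsum_cong') (use q rad_hom X p in auto)
    also have "\<dots> = Cmp C X X X (?p m) j"
      unfolding j_def using q(1) rad_hom X B(1) by (intro comp_finsum_right[symmetric]) auto
    finally have j: "j \<in> J X X" "(\<Oplus>\<^bsub>Mor C X X\<^esub>w\<in>B - {?p m}. a w \<odot>\<^bsub>Mor C X X\<^esub> w) = Cmp C X X X (?p m) j"
      using rad_finsum[OF X X, of "B - {?p m}" q] q(1) B(1) by (auto simp: j_def)
    note jh = rad_hom[OF j(1)]
    have "V.lincomb a B = (\<Oplus>\<^bsub>Mor C X X\<^esub>w\<in>insert (?p m) (B - {?p m}). a w \<odot>\<^bsub>Mor C X X\<^esub> w)"
      using pm by (simp add: V.lincomb_def insert_absorb)
    also have "\<dots> = a (?p m) \<odot>\<^bsub>Mor C X X\<^esub> ?p m \<oplus>\<^bsub>Mor C X X\<^esub> Cmp C X X X (?p m) j"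
      using B p by (subst A.finsum_insert) (auto simp: j(2) X)
    finally have 0: "a (?p m) \<odot>\<^bsub>Mor C X X\<^esub> ?p m \<oplus>\<^bsub>Mor C X X\<^esub> Cmp C X X X (?p m) j = zero_mor C X X" using B(3) by simp
    \<comment> \<open>Scaling by minus the inverse of the leading coefficient brings the relation
      into the form \<open>f^m = f^m (c j)\<close> that \<open>zero\<close> expects.\<close>
    let ?c = "- inverse (a (?p m))"
    have "?c \<odot>\<^bsub>Mor C X X\<^esub> (a (?p m) \<odot>\<^bsub>Mor C X X\<^esub> ?p m \<oplus>\<^bsub>Mor C X X\<^esub> Cmp C X X X (?p m) j) =
        (?c * a (?p m)) \<odot>\<^bsub>Mor C X X\<^esub> ?p m \<oplus>\<^bsub>Mor C X X\<^esub> Cmp C X X X (?p m) (?c \<odot>\<^bsub>Mor C X X\<^esub> j)"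
      using X jh V.smult_assoc1[of ?c "a (?p m)" "?p m"] by (simp add: V.smult_r_distr comp_smult_right class_ring_simps)
    then have 1: "(- 1) \<odot>\<^bsub>Mor C X X\<^esub> ?p m \<oplus>\<^bsub>Mor C X X\<^esub> Cmp C X X X (?p m) (?c \<odot>\<^bsub>Mor C X X\<^esub> j) = zero_mor C X X"
      using 0 pm(2) V.smult_r_null[of ?c] by (simp add: class_ring_simps)
    have "(- 1) \<odot>\<^bsub>Mor C X X\<^esub> ?p m = \<ominus>\<^bsub>Mor C X X\<^esub> ?p m"
      using V.smult_minus_1[of "?p m"] by (simp add: class_ring_simps)
    with 1 have "?p m = Cmp C X X X (?p m) (?c \<odot>\<^bsub>Mor C X X\<^esub> j)"
      using X jh by (metis A.minus_equality A.minus_minus A.a_inv_closed closed(1) closed(5) p)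
    then show ?thesis using zero[of "?c \<odot>\<^bsub>Mor C X X\<^esub> j" m] j(1) X rad_smult by blast
  qed
qed

end

lemma (in linear_category) krull_schmidt_categoryI:
  assumes lf: "locally_finitary C"
    and ind: "\<And>i. indecomposable C (P i)"
    and inj: "\<And>i j. isomorphic C (P i) (P j) \<Longrightarrow> i = (j::nat)"
    and sur: "\<And>Y. indecomposable C Y \<Longrightarrow> \<exists>i. isomorphic C Y (P i)"
  shows "krull_schmidt_category C P"
proof
  have KS: "krull_schmidt C" "idempotent_split C" using lf by (simp_all add: locally_finitary_def)
  fix i j
  show P: "P i \<in> Ob C" for i using ind[of i] by (simp add: indecomposable_def)
  show "local_endomorphism_ring C (P i)" using indecomposable_local[OF KS ind] .
  show "isomorphic C (P i) (P j) \<Longrightarrow> i = j" by (rule inj)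
  show "\<exists>n. cpow C (P i) f n = zero_mor C (P i) (P i)" if "f \<in> radical C (P i) (P i)" for f
    using rad_nilpotent[OF P _ that] lf P by (simp add: locally_finitary_def)
  fix Z assume Z: "Z \<in> Ob C"
  obtain Xs where Xs: "set Xs \<subseteq> Ob C" "\<forall>X \<in> set Xs. local_endomorphism_ring C X" "direct_sum C Xs Z"
    using KS(1) Z unfolding krull_schmidt_def by blast
  have "\<exists>k. isomorphic C X (P k)" if "X \<in> set Xs" for X
    using sur[OF local_indecomposable] Xs(1,2) that by blast
  then show "\<exists>Xs. set Xs \<subseteq> Ob C \<and> (\<forall>X \<in> set Xs. \<exists>k. isomorphic C X (P k)) \<and> direct_sum C Xs Z" using Xs by blast
qed

section \<open>Objects whose action preserves the radical\<close>

context module_category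
begin

definition preserves_rad :: "'c \<Rightarrow> bool" where
  "preserves_rad A \<longleftrightarrow> A \<in> Ob C \<and> (\<forall>X \<in> Ob M. \<forall>Y \<in> Ob M. \<forall>f \<in> radical M X Y.
     act_mor M A A X Y (Idn C A) f \<in> radical M (act_ob M A X) (act_ob M A Y))"

lemma preserves_rad_unit: "preserves_rad (unit_ob C)"
  unfolding preserves_rad_def
proof (intro conjI ballI)
  let ?U = "unit_ob C"
  fix X Y f assume X: "X \<in> Ob M" and Y: "Y \<in> Ob M" and f: "f \<in> radical M X Y"
  let ?UX = "act_ob M ?U X" and ?UY = "act_ob M ?U Y" and ?Uf = "act_mor M ?U ?U X Y (Idn C ?U) f"
  note fh = M.rad_hom[OF f]
  note ux = M.minv[OF act_unit_iso[OF X]] and uy = M.minv[OF act_unit_iso[OF Y]]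
  have o: "?UX \<in> Ob M" "?UY \<in> Ob M" using X Y by auto
  have Uf: "?Uf \<in> mors M ?UX ?UY" using X Y fh by auto
  have "?Uf = Cmp M ?UX Y ?UY (minv M ?UY Y (act_unit M Y)) (Cmp M ?UX ?UY Y (act_unit M Y) ?Uf)"
    by (rule M.comp_cancel[OF uy(3) o(2) Y uy(1,2) o(1) Uf, symmetric])
  also have "\<dots> = Cmp M ?UX Y ?UY (minv M ?UY Y (act_unit M Y)) (Cmp M ?UX X Y f (act_unit M X))"
    using act_unit_natural[OF X Y fh] by simp
  also have "\<dots> \<in> radical M ?UX ?UY"
    by (rule M.rad_comp_left[OF o(1) Y o(2) M.rad_comp_right[OF o(1) X Y ux(1) f] uy(2)])
  finally show "?Uf \<in> radical M ?UX ?UY" .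
qed simp

lemma preserves_rad_tens:
  assumes A: "preserves_rad A" and B: "preserves_rad B"
  shows "preserves_rad (tens_ob C A B)"
proof -
  have O: "A \<in> Ob C" "B \<in> Ob C" using A B by (simp_all add: preserves_rad_def)
  show ?thesis
    unfolding preserves_rad_def
  proof (intro conjI ballI)
    fix X Y f assume X: "X \<in> Ob M" and Y: "Y \<in> Ob M" and f: "f \<in> radical M X Y"
    let ?T = "tens_ob C A B"
    let ?TX = "act_ob M ?T X" and ?TY = "act_ob M ?T Y" and ?Tf = "act_mor M ?T ?T X Y (Idn C ?T) f"
    let ?BX = "act_ob M B X" and ?BY = "act_ob M B Y" and ?Bf = "act_mor M B B X Y (Idn C B) f"
    let ?AX = "act_ob M A ?BX" and ?AY = "act_ob M A ?BY" and ?Af = "act_mor M A A ?BX ?BY (Idn C A) ?Bf"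
    note fh = M.rad_hom[OF f]
    have o: "?TX \<in> Ob M" "?TY \<in> Ob M" "?BX \<in> Ob M" "?BY \<in> Ob M" "?AX \<in> Ob M" "?AY \<in> Ob M" using X Y O by auto
    have "?Bf \<in> radical M ?BX ?BY" using B X Y f unfolding preserves_rad_def by blast
    then have Af: "?Af \<in> radical M ?AX ?AY" using A o unfolding preserves_rad_def by blast
    note ax = M.minv[OF act_assoc_iso[OF O X]] and ay = M.minv[OF act_assoc_iso[OF O Y]]
    have Tf: "?Tf \<in> mors M ?TX ?TY" using X Y O fh by auto
    have "?Tf = Cmp M ?TX ?AY ?TY (minv M ?TY ?AY (act_assoc M A B Y)) (Cmp M ?TX ?TY ?AY (act_assoc M A B Y) ?Tf)"
      by (rule M.comp_cancel[OF ay(3) o(2,6) ay(1,2) o(1) Tf, symmetric])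
    also have "Cmp M ?TX ?TY ?AY (act_assoc M A B Y) ?Tf = Cmp M ?TX ?AX ?AY ?Af (act_assoc M A B X)"
      using act_assoc_natural[OF O(1) O(1) O(2) O(2) X Y C.id_closed[OF O(1)] C.id_closed[OF O(2)] fh] O
      by (simp add: C.tens_id)
    finally have eq: "?Tf = Cmp M ?TX ?AY ?TY (minv M ?TY ?AY (act_assoc M A B Y)) (Cmp M ?TX ?AX ?AY ?Af (act_assoc M A B X))" .
    show "?Tf \<in> radical M ?TX ?TY"
      by (subst eq) (rule M.rad_comp_left[OF o(1,6,2) M.rad_comp_right[OF o(1,5,6) ax(1) Af] ay(2)])
  qed (use O in simp)
qed

text \<open>The action of \<open>i p\<close> on \<open>f\<close> is the action of \<open>B\<close>
  on \<open>f\<close> between the actions of \<open>p\<close> and \<open>i\<close> on identities. No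
  splitting \<open>p i = 1\<close> is involved, so it suffices to write the identity of
  \<open>A\<close> as a sum of such \<open>i p\<close>.\<close>

lemma act_factor_rad:
  assumes B: "preserves_rad B" and A: "A \<in> Ob C" and p: "p \<in> mors C A B" and i: "i \<in> mors C B A"
    and X: "X \<in> Ob M" "Y \<in> Ob M" and f: "f \<in> radical M X Y"
  shows "act_mor M A A X Y (Cmp C A B A i p) f \<in> radical M (act_ob M A X) (act_ob M A Y)"
proof -
  have BO: "B \<in> Ob C" using B by (simp add: preserves_rad_def)
  note fh = M.rad_hom[OF f]
  let ?Bf = "act_mor M B B X Y (Idn C B) f"
  have Bf: "?Bf \<in> radical M (act_ob M B X) (act_ob M B Y)" using B X f unfolding preserves_rad_def by blast
  have 1: "act_mor M A B X Y p f = Cmp M (act_ob M A X) (act_ob M B X) (act_ob M B Y) ?Bf (act_mor M A B X X p (Idn M X))"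
    using act_comp[OF A BO BO X(1) X(1) X(2) p C.id_closed[OF BO] M.id_closed[OF X(1)] fh] A BO p X fh
    by (simp add: C.comp_id_left M.comp_id_right)
  have "act_mor M A A X Y (Cmp C A B A i p) f =
      Cmp M (act_ob M A X) (act_ob M B Y) (act_ob M A Y) (act_mor M B A Y Y i (Idn M Y)) (act_mor M A B X Y p f)"
    using act_comp[OF A BO A X(1) X(2) X(2) p i fh M.id_closed[OF X(2)]] X fh by (simp add: M.comp_id_left)
  then show ?thesis
    unfolding 1 using X A BO p i Bf by (auto intro!: M.rad_comp_left[of _ "act_ob M B Y"] M.rad_comp_right[of _ "act_ob M B X"])
qed

text \<open>The local object \<open>P\<close> rules out the other alternative of simple
  transitivity: its identity is not radical.\<close>

lemma semi_simple_if_rad_preserved: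
  assumes st: "simple_transitive C M" and pr: "\<And>A. A \<in> Ob C \<Longrightarrow> preserves_rad A"
    and P: "P \<in> Ob M" "local_endomorphism_ring M P"
  shows "semi_simple M"
proof -
  have "invariant_ideal C M (radical M)"
    using M.rad_ideal pr unfolding invariant_ideal_def preserves_rad_def by blast
  then have "(\<forall>X \<in> Ob M. \<forall>Y \<in> Ob M. radical M X Y = {zero_mor M X Y}) \<or>
      (\<forall>X \<in> Ob M. \<forall>Y \<in> Ob M. radical M X Y = mors M X Y)"
    using st unfolding simple_transitive_def by blast
  moreover have "radical M P P \<noteq> mors M P P" using M.id_not_rad[OF P] M.id_closed[OF P(1)] by blast
  ultimately show ?thesis using P unfolding semi_simple_def by blast
qed

end

context self_dual_action
begin

lemma preserves_rad_self_dual: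
  assumes "krull_schmidt_category M P"
    and P0: "direct_sum M [P 0, P 1] (act_ob M A (P 0))"
    and PS: "\<And>i. direct_sum M [P i, P (Suc (Suc i))] (act_ob M A (P (Suc i)))"
  shows "preserves_rad A"
proof -
  interpret ks: krull_schmidt_category M P by fact
  \<comment> \<open>The natural families \<open>\<epsilon>\<close> and \<open>\<eta>\<close> also
    serve as \<open>\<kappa>\<close> and \<open>\<kappa>'\<close>.\<close>
  interpret T: T_infinity_self_dual_functor M P Fo Fm \<eta> \<epsilon> \<epsilon> \<eta>
  proof
    show "direct_sum M [P 0, P 1] (Fo (P 0))" "\<And>i. direct_sum M [P i, P (Suc (Suc i))] (Fo (P (Suc i)))"
      using P0 PS by (simp_all add: Fo_def)
    show "Fm X Y (f \<oplus>\<^bsub>Mor M X Y\<^esub> g) = Fm X Y f \<oplus>\<^bsub>Mor M (Fo X) (Fo Y)\<^esub> Fm X Y g"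
      if "X \<in> Ob M" "Y \<in> Ob M" "f \<in> mors M X Y" "g \<in> mors M X Y" for X Y f g
      using that by (intro linear_map.T_add[OF Fm_linear])
    show "Fm X Y (zero_mor M X Y) = zero_mor M (Fo X) (Fo Y)" if "X \<in> Ob M" "Y \<in> Ob M" for X Y
      using that by (intro linear_map.T0_is_0[OF Fm_linear])
  qed (simp_all add: Fm_comp Fm_id \<eta>_natural \<epsilon>_natural \<epsilon>_\<eta>_iso \<epsilon>_\<eta>_iso')
  show ?thesis using T.F_rad by (simp add: preserves_rad_def Fo_def Fm_def)
qed

end

section \<open>Finite dimensional representations of \<open>sl\<^sub>2\<close>\<close>

text \<open>One type contains the coordinate spaces of all dimensions, as functions vanishing from
  some index on; thus the theory of type-based vector spaces applies.\<close>

type_synonym cvec = "nat \<Rightarrow> complex"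

definition cscale :: "complex \<Rightarrow> cvec \<Rightarrow> cvec" (infixr "*\<^sub>C" 75) where
  "c *\<^sub>C x = (\<lambda>i. c * x i)"

lemma cscale_apply [simp]: "(c *\<^sub>C x) i = c * x i"
  by (simp add: cscale_def)

interpretation cvec: vector_space cscale
  by unfold_locales (auto simp: fun_eq_iff algebra_simps)

text \<open>Not an interpretation: it would make reassociation of products of complex numbers a simp rule.\<close>

lemma cvec_functional: "vector_space_pair cscale ((*) :: complex \<Rightarrow> complex \<Rightarrow> complex)"
  by unfold_locales (auto simp: algebra_simps)

abbreviation clinear :: "(cvec \<Rightarrow> cvec) \<Rightarrow> bool" where
  "clinear \<equiv> Vector_Spaces.linear cscale cscale"

lemma clinear_module_hom: "clinear T \<Longrightarrow> module_hom cscale cscale T"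
  by (simp add: module_hom_iff_linear)

lemmas clinear_add = module_hom.add[OF clinear_module_hom]
  and clinear_scale = module_hom.scale[OF clinear_module_hom]
  and clinear_diff = module_hom.diff[OF clinear_module_hom]
  and clinear_neg = module_hom.neg[OF clinear_module_hom]
  and clinear_zero = module_hom.zero[OF clinear_module_hom]
  and clinear_sum = module_hom.sum[OF clinear_module_hom]

lemma clinearI: "(\<And>x y. T (x + y) = T x + T y) \<Longrightarrow> (\<And>c x. T (c *\<^sub>C x) = c *\<^sub>C T x) \<Longrightarrow> clinear T"
  by unfold_locales

abbreviation functional :: "(cvec \<Rightarrow> complex) \<Rightarrow> bool" where
  "functional \<equiv> Vector_Spaces.linear cscale (*)"

lemma functionalI: "(\<And>x y. \<phi> (x + y) = \<phi> x + \<phi> y) \<Longrightarrow> (\<And>c x. \<phi> (c *\<^sub>C x) = c * \<phi> x) \<Longrightarrow> functional \<phi>"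
  by unfold_locales (auto simp: algebra_simps)

lemma functional_simps:
  assumes "functional \<phi>"
  shows "\<phi> (x + y) = \<phi> x + \<phi> y" "\<phi> (x - y) = \<phi> x - \<phi> y" "\<phi> (c *\<^sub>C x) = c * \<phi> x" "\<phi> 0 = 0"
    "\<phi> (sum g S) = (\<Sum>a\<in>S. \<phi> (g a))"
proof -
  have "module_hom cscale (*) \<phi>" using assms by (simp add: module_hom_iff_linear)
  then show "\<phi> (x + y) = \<phi> x + \<phi> y" "\<phi> (x - y) = \<phi> x - \<phi> y" "\<phi> (c *\<^sub>C x) = c * \<phi> x" "\<phi> 0 = 0"
    "\<phi> (sum g S) = (\<Sum>a\<in>S. \<phi> (g a))"
    by (simp_all add: module_hom.add module_hom.diff module_hom.scale module_hom.zero module_hom.sum)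
qed

section \<open>Highest weights for nilpotent sl2-triples\<close>

text \<open>The space \<open>cvec\<close> is infinite dimensional; nilpotency of \<open>E\<close>
  and \<open>F\<close> takes the place of finite dimension, and the eigenvalues of \<open>H\<close>
  are derived from it.\<close>

locale sl2_triple =
  fixes E F H :: "cvec \<Rightarrow> cvec" and N :: nat
  assumes linear: "clinear E" "clinear F" "clinear H"
    and EF: "E (F x) = F (E x) + H x"
    and HE: "H (E x) = E (H x) + 2 *\<^sub>C E x"
    and HF: "H (F x) = F (H x) - 2 *\<^sub>C F x"
    and nilpotent: "(E ^^ N) x = 0" "(F ^^ N) x = 0"
begin

lemmas E_simps = clinear_add[OF linear(1)] clinear_scale[OF linear(1)] clinear_diff[OF linear(1)] clinear_zero[OF linear(1)]
lemmas F_simps = clinear_add[OF linear(2)] clinear_scale[OF linear(2)] clinear_diff[OF linear(2)] clinear_zero[OF linear(2)]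
lemmas H_simps = clinear_add[OF linear(3)] clinear_scale[OF linear(3)] clinear_diff[OF linear(3)] clinear_zero[OF linear(3)]

lemma pow_linear:
  "(E ^^ k) (x + y) = (E ^^ k) x + (E ^^ k) y" "(E ^^ k) (c *\<^sub>C x) = c *\<^sub>C (E ^^ k) x" "(E ^^ k) 0 = 0"
  "(F ^^ k) (x + y) = (F ^^ k) x + (F ^^ k) y" "(F ^^ k) (c *\<^sub>C x) = c *\<^sub>C (F ^^ k) x" "(F ^^ k) 0 = 0"
  by (induction k) (simp_all add: E_simps F_simps)

lemma EH: "E (H x) = H (E x) - 2 *\<^sub>C E x"
  by (simp add: HE)

lemma H_E_pow: "H ((E ^^ k) x) = (E ^^ k) (H x) + (2 * of_nat k) *\<^sub>C (E ^^ k) x"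
proof (induction k)
  case (Suc k)
  have *: "a + (2 * of_nat k) *\<^sub>C b + 2 *\<^sub>C b = a + (2 * of_nat (Suc k)) *\<^sub>C b" for a b
    by (rule ext) (simp add: algebra_simps)
  show ?case
    by (simp only: funpow.simps comp_apply HE Suc E_simps *)
qed (simp add: fun_eq_iff)

lemma H_F_pow: "H ((F ^^ k) x) = (F ^^ k) (H x) - (2 * of_nat k) *\<^sub>C (F ^^ k) x"
proof (induction k)
  case (Suc k)
  have *: "a - (2 * of_nat k) *\<^sub>C b - 2 *\<^sub>C b = a - (2 * of_nat (Suc k)) *\<^sub>C b" for a b
    by (rule ext) (simp add: algebra_simps)
  show ?case
    by (simp only: funpow.simps comp_apply HF Suc F_simps *)
qed (simp add: fun_eq_iff)

text \<open>The classical commutator \<open>[E, F^(k+1)] = (k + 1) F^k (H - k)\<close>.\<close>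

lemma E_F_pow: "E ((F ^^ Suc k) x) = (F ^^ Suc k) (E x) + of_nat (Suc k) *\<^sub>C (F ^^ k) (H x) - (of_nat (Suc k) * of_nat k) *\<^sub>C (F ^^ k) x"
proof (induction k)
  case 0
  show ?case by (simp add: EF fun_eq_iff)
next
  case (Suc k)
  have *: "a + of_nat (Suc k) *\<^sub>C b - (of_nat (Suc k) * of_nat k) *\<^sub>C c + (b - (2 * of_nat (Suc k)) *\<^sub>C c) =
      a + of_nat (Suc (Suc k)) *\<^sub>C b - (of_nat (Suc (Suc k)) * of_nat (Suc k)) *\<^sub>C c" for a b c
    by (rule ext) (simp add: algebra_simps)
  have "E ((F ^^ Suc (Suc k)) x) = F (E ((F ^^ Suc k) x)) + H ((F ^^ Suc k) x)"
    by (simp only: funpow.simps comp_apply EF)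
  also have "\<dots> = (F ^^ Suc (Suc k)) (E x) + of_nat (Suc k) *\<^sub>C (F ^^ Suc k) (H x) - (of_nat (Suc k) * of_nat k) *\<^sub>C (F ^^ Suc k) x
      + ((F ^^ Suc k) (H x) - (2 * of_nat (Suc k)) *\<^sub>C (F ^^ Suc k) x)"
    unfolding Suc H_F_pow by (simp only: funpow.simps comp_apply F_simps)
  finally show ?case unfolding * .
qed

text \<open>The classical commutator \<open>[E^(k+1), F] = (k + 1) (H - k) E^k\<close>.\<close>

lemma E_pow_F: "(E ^^ Suc k) (F x) = F ((E ^^ Suc k) x) + of_nat (Suc k) *\<^sub>C H ((E ^^ k) x) - (of_nat (Suc k) * of_nat k) *\<^sub>C (E ^^ k) x"
proof (induction k)
  case 0
  show ?case by (simp add: EF fun_eq_iff)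
next
  case (Suc k)
  have *: "a + b + of_nat (Suc k) *\<^sub>C (b - 2 *\<^sub>C c) - (of_nat (Suc k) * of_nat k) *\<^sub>C c =
      a + of_nat (Suc (Suc k)) *\<^sub>C b - (of_nat (Suc (Suc k)) * of_nat (Suc k)) *\<^sub>C c" for a b c
    by (rule ext) (simp add: algebra_simps)
  have "(E ^^ Suc (Suc k)) (F x) = E ((E ^^ Suc k) (F x))" by simp
  also have "\<dots> = F ((E ^^ Suc (Suc k)) x) + H ((E ^^ Suc k) x) + of_nat (Suc k) *\<^sub>C (H ((E ^^ Suc k) x) - 2 *\<^sub>C (E ^^ Suc k) x)
      - (of_nat (Suc k) * of_nat k) *\<^sub>C (E ^^ Suc k) x"
    unfolding Suc by (simp only: E_simps EF EH funpow.simps comp_apply)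
  finally show ?case unfolding * .
qed

text \<open>The polynomial in \<open>H\<close> with the roots \<open>cs\<close>, kept as a list of
  linear factors so that eigenvectors can be found factor by factor.\<close>

fun shifts :: "complex list \<Rightarrow> cvec \<Rightarrow> cvec" where
  "shifts [] x = x"
| "shifts (c # cs) x = shifts cs (H x - c *\<^sub>C x)"

lemma shifts_linear: "shifts cs (x + y) = shifts cs x + shifts cs y" "shifts cs (c *\<^sub>C x) = c *\<^sub>C shifts cs x"
proof (induction cs arbitrary: x y)
  case (Cons a cs)
  have 1: "H (x + y) - a *\<^sub>C (x + y) = (H x - a *\<^sub>C x) + (H y - a *\<^sub>C y)" for x y
    unfolding H_simps by (rule ext) (simp add: algebra_simps)
  have 2: "H (c *\<^sub>C x) - a *\<^sub>C c *\<^sub>C x = c *\<^sub>C (H x - a *\<^sub>C x)" for x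
    unfolding H_simps by (rule ext) (simp add: algebra_simps)
  show "shifts (a # cs) (x + y) = shifts (a # cs) x + shifts (a # cs) y" "shifts (a # cs) (c *\<^sub>C x) = c *\<^sub>C shifts (a # cs) x" for x y
    unfolding shifts.simps 1 2 Cons.IH by (rule refl)+
qed simp_all

lemma shifts_commute: "shifts cs (H x - c *\<^sub>C x) = H (shifts cs x) - c *\<^sub>C shifts cs x"
proof (induction cs arbitrary: x)
  case (Cons a cs)
  have "H (H x - c *\<^sub>C x) - a *\<^sub>C (H x - c *\<^sub>C x) = H (H x - a *\<^sub>C x) - c *\<^sub>C (H x - a *\<^sub>C x)"
    unfolding H_simps by (rule ext) (simp add: algebra_simps)
  then show ?case unfolding shifts.simps Cons.IH[symmetric] by (rule arg_cong)
qed simp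

lemma shifts_eigenvector:
  assumes "H x = \<mu> *\<^sub>C x"
  shows "shifts cs x = (\<Prod>c\<leftarrow>cs. \<mu> - c) *\<^sub>C x"
proof (induction cs)
  case (Cons a cs)
  have 1: "H x - a *\<^sub>C x = (\<mu> - a) *\<^sub>C x" unfolding assms by (rule ext) (simp add: algebra_simps)
  have "(\<mu> - a) *\<^sub>C p *\<^sub>C x = ((\<mu> - a) * p) *\<^sub>C x" for p by simp
  then show ?case unfolding shifts.simps 1 shifts_linear Cons by simp
qed simp

text \<open>The last non-zero vector in the successive application of the factors
  \<open>H - c\<close> is an eigenvector. The predicate \<open>P\<close> keeps it inside a given
  \<open>H\<close>-stable set.\<close>

lemma eigenvector_exists:
  assumes "shifts cs x = 0" "x \<noteq> 0" "P x" "\<And>y c. P y \<Longrightarrow> P (H y - c *\<^sub>C y)"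
  shows "\<exists>u c. u \<noteq> 0 \<and> P u \<and> c \<in> set cs \<and> H u = c *\<^sub>C u"
  using assms(1-3)
proof (induction cs arbitrary: x)
  case (Cons a cs)
  show ?case
  proof (cases "H x - a *\<^sub>C x = 0")
    case True
    then have "H x = a *\<^sub>C x" by (simp only: right_minus_eq)
    then show ?thesis using Cons.prems(2,3) by (metis list.set_intros(1))
  next
    case False
    have "shifts cs (H x - a *\<^sub>C x) = 0" using Cons.prems(1) by (simp only: shifts.simps)
    then have "\<exists>u c. u \<noteq> 0 \<and> P u \<and> c \<in> set cs \<and> H u = c *\<^sub>C u"
      using Cons.IH[OF _ False assms(4)[OF Cons.prems(3)]] by blast
    then show ?thesis by (metis list.set_intros(2))
  qed
qed simp

lemma shifts_append: "shifts (as @ bs) x = shifts bs (shifts as x)"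
  by (induction as arbitrary: x) auto

text \<open>The list ends at 0 and excludes \<open>k\<close>, so \<open>shifts (downto k)\<close> is
  \<open>H (H - 1) ... (H - k + 1)\<close>.\<close>

fun downto :: "nat \<Rightarrow> complex list" where
  "downto 0 = []"
| "downto (Suc k) = of_nat k # downto k"

lemma set_downto: "set (downto k) = of_nat ` {..<k}"
  by (induction k) (auto simp: lessThan_Suc)

lemma ker_E_closed: "E w = 0 \<Longrightarrow> E (H w - c *\<^sub>C w) = 0"
proof -
  assume w: "E w = 0"
  have "E (H w) = 0" unfolding EH w H_simps by (simp add: fun_eq_iff)
  then show "E (H w - c *\<^sub>C w) = 0" unfolding E_simps w by (simp add: fun_eq_iff)
qed

text \<open>By \<open>E_F_pow\<close>, \<open>E F^(k+1) w = (k + 1) F^k (H - k) w\<close>, and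
  \<open>(H - k) w\<close> is again in the kernel of \<open>E\<close>.\<close>

lemma E_pow_F_pow: "E w = 0 \<Longrightarrow> (E ^^ k) ((F ^^ k) w) = fact k *\<^sub>C shifts (downto k) w"
proof (induction k arbitrary: w)
  case (Suc k)
  let ?w = "H w - of_nat k *\<^sub>C w"
  have "(E ^^ Suc k) ((F ^^ Suc k) w) = (E ^^ k) (E ((F ^^ Suc k) w))" by (simp only: funpow_Suc_right comp_apply)
  also have "E ((F ^^ Suc k) w) = (F ^^ k) (of_nat (Suc k) *\<^sub>C ?w)"
  proof -
    have "of_nat (Suc k) *\<^sub>C H w = of_nat (Suc k) *\<^sub>C ?w + (of_nat (Suc k) * of_nat k) *\<^sub>C w" by (rule ext) (simp add: algebra_simps)
    then have "of_nat (Suc k) *\<^sub>C (F ^^ k) (H w) = (F ^^ k) (of_nat (Suc k) *\<^sub>C ?w) + (of_nat (Suc k) * of_nat k) *\<^sub>C (F ^^ k) w"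
      by (metis pow_linear(4,5))
    then show ?thesis unfolding E_F_pow Suc.prems pow_linear by (metis add_0 add_diff_cancel_right')
  qed
  also have "(E ^^ k) \<dots> = of_nat (Suc k) *\<^sub>C fact k *\<^sub>C shifts (downto k) ?w"
    unfolding Suc.IH[OF ker_E_closed[OF Suc.prems]] pow_linear by (rule refl)
  finally show ?case by simp
qed (simp add: fun_eq_iff)

lemma cscale_eq_0: "c *\<^sub>C x = 0 \<longleftrightarrow> c = 0 \<or> x = 0"
  by (rule cvec.scale_eq_0_iff)

lemma highest_weights: "E w = 0 \<Longrightarrow> shifts (downto N) w = 0"
  using E_pow_F_pow[of w N] unfolding nilpotent pow_linear by (metis cscale_eq_0 fact_nonzero)

text \<open>The dual of \<open>E_pow_F_pow\<close>: functionals that vanish on the image of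
  \<open>F\<close> take the role of the kernel of \<open>E\<close>. This class is stable under
  composition with \<open>H - k\<close>, because \<open>[H, F] = - 2 F\<close>.\<close>

lemma functional_weights:
  assumes "functional \<phi>" "\<And>x. \<phi> (F x) = 0"
  shows "\<phi> ((E ^^ k) ((F ^^ k) x)) = fact k * \<phi> (shifts (downto k) x)"
  using assms
proof (induction k arbitrary: \<phi>)
  case (Suc k)
  note \<phi> = functional_simps[OF Suc.prems(1)]
  let ?\<psi> = "\<lambda>y. \<phi> (H y - of_nat k *\<^sub>C y)"
  have lin: "functional ?\<psi>"
    by (rule functionalI) (simp_all only: H_simps \<phi>, simp_all add: algebra_simps)
  have F: "?\<psi> (F y) = 0" for y
    by (simp only: HF \<phi> Suc.prems(2)) simp
  have "\<phi> ((E ^^ Suc k) ((F ^^ Suc k) x)) = \<phi> ((E ^^ Suc k) (F ((F ^^ k) x)))" by simp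
  also have "\<dots> = of_nat (Suc k) * ?\<psi> ((E ^^ k) ((F ^^ k) x))"
    unfolding E_pow_F by (simp only: \<phi> Suc.prems(2)) (simp add: algebra_simps)
  also have "\<dots> = fact (Suc k) * \<phi> (shifts (downto (Suc k)) x)"
    unfolding Suc.IH[OF lin F] shifts_commute[symmetric] by simp
  finally show ?case .
qed simp

lemma functional_weights_zero:
  assumes "functional \<phi>" "\<And>x. \<phi> (F x) = 0"
  shows "\<phi> (shifts (downto N) x) = 0"
  using functional_weights[OF assms, of N x] unfolding nilpotent pow_linear functional_simps[OF assms(1)] by simp

text \<open>The Chevalley involution; it yields statements on lowest weights from those on highest
  weights.\<close>

lemma sl2_triple_swap: "sl2_triple F E (\<lambda>x. - H x) N"
proof
  show "- H (x + y) = - H x + - H y" "- H (c *\<^sub>C x) = c *\<^sub>C (- H x)" for x y c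
    by (simp_all only: H_simps) (simp_all add: fun_eq_iff)
  show "F (E x) = E (F x) + - H x" for x by (simp only: EF) simp
  show "- H (F x) = F (- H x) + 2 *\<^sub>C F x" for x
    by (simp only: HF clinear_neg[OF linear(2)]) simp
  show "- H (E x) = E (- H x) - 2 *\<^sub>C E x" for x
    by (simp only: HE clinear_neg[OF linear(1)]) simp
qed (auto simp: nilpotent linear clinear_add clinear_scale)

end

context sl2_triple
begin

interpretation swap: sl2_triple F E "\<lambda>x. - H x" N
  by (rule sl2_triple_swap)

lemma swap_shifts_F: "swap.shifts cs (F x) = F (swap.shifts (map (\<lambda>c. c - 2) cs) x)"
proof (induction cs arbitrary: x)
  case (Cons c cs)
  have 1: "- H (F x) - c *\<^sub>C F x = F (- H x - (c - 2) *\<^sub>C x)"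
    by (simp only: HF F_simps clinear_neg[OF linear(2)]) (rule ext, simp add: algebra_simps)
  show ?case unfolding swap.shifts.simps list.map 1 Cons by (rule refl)
qed simp

text \<open>A vector \<open>a\<close> with \<open>F a = w\<close> can be chosen to have weight \<open>n + 2\<close>; then raising it contradicts
  \<open>E\<^sup>k\<^sup>+\<^sup>1 F a = 0\<close>.\<close>

lemma highest_weight_not_in_range_F:
  assumes w: "E w = 0" "H w = of_nat n *\<^sub>C w" "w = F a"
  shows "w = 0"
proof (rule ccontr)
  assume "w \<noteq> 0"
  let ?m = "of_nat n + 2 :: complex"
  \<comment> \<open>Up to sign, \<open>(H - m) a\<close> with \<open>m = n + 2\<close>, the weight
    that \<open>a\<close> ought to have. It is in the kernel of \<open>F\<close>, whose weights are
    known from the swapped triple.\<close>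
  define z where "z = - H a - (- ?m) *\<^sub>C a"
  have "F z = - (H (F a) - of_nat n *\<^sub>C F a)"
    unfolding z_def by (simp only: HF F_simps clinear_neg[OF linear(2)]) (rule ext, simp add: algebra_simps)
  then have "F z = 0" using w(2) unfolding w(3) by simp
  then have z: "swap.shifts (downto N) z = 0" by (rule swap.highest_weights)
  \<comment> \<open>The polynomial that kills \<open>z\<close> turns \<open>a\<close> into a vector
    of weight exactly \<open>n + 2\<close>.\<close>
  define b where "b = swap.shifts (downto N) a"
  have "- H b - (- ?m) *\<^sub>C b = 0"
    using swap.shifts_commute[of "downto N" a "- ?m"] z unfolding z_def b_def by metis
  then have "- H b i - (- ?m) * b i = 0" for i by (metis cscale_apply minus_apply uminus_apply zero_fun_apply)
  moreover have "x = y" if "- x - (- ?m) * c = 0" "y = ?m * c" for x y c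
  proof -
    have "x = ?m * c - (- x - (- ?m) * c)" by (simp add: algebra_simps)
    then show ?thesis unfolding that by simp
  qed
  ultimately have Hb: "H b = ?m *\<^sub>C b" by (intro ext) (metis cscale_apply)
  have "downto N = map (\<lambda>c. c - 2) (map (\<lambda>c. c + 2) (downto N))" by (simp add: comp_def)
  then have "F b = swap.shifts (map (\<lambda>c. c + 2) (downto N)) w" using swap_shifts_F w(3) by (metis b_def)
  also have "\<dots> = (\<Prod>c\<leftarrow>map (\<lambda>c. c + 2) (downto N). - of_nat n - c) *\<^sub>C w"
    using w(2) by (intro swap.shifts_eigenvector) (simp add: fun_eq_iff)
  finally obtain q where q: "F b = q *\<^sub>C w" "q = (\<Prod>c\<leftarrow>map (\<lambda>c. c + 2) (downto N). - of_nat n - c)" by blast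
  \<comment> \<open>The factors of \<open>q\<close> are \<open>- (n + k + 2)\<close>; hence
    \<open>F b\<close> is still a non-zero multiple of \<open>w\<close>.\<close>
  have "- of_nat n - (of_nat k + 2) \<noteq> (0::complex)" for k
  proof -
    have "- of_nat n - (of_nat k + 2) = - (of_nat (n + k + 2) :: complex)" by simp
    then show ?thesis by (metis neg_equal_0_iff_equal of_nat_eq_0_iff add_2_eq_Suc' nat.distinct(1))
  qed
  then have "q \<noteq> 0" unfolding q(2) prod_list_zero_iff by (auto simp: set_downto)
  then have "F b \<noteq> 0" unfolding q(1) cscale_eq_0 using \<open>w \<noteq> 0\<close> by blast
  then have b: "b \<noteq> 0" using F_simps(4) by blast
  have EFb: "E (F b) = 0" unfolding q(1) E_simps w(1) by (rule cvec.scale_zero_right)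
  define k where "k = (LEAST k. (E ^^ Suc k) b = 0)"
  have "(E ^^ Suc N) b = 0" unfolding funpow.simps comp_apply nilpotent E_simps ..
  then have k: "(E ^^ Suc k) b = 0" unfolding k_def by (rule LeastI)
  have k': "(E ^^ k) b \<noteq> 0"
  proof (cases k)
    case 0
    then show ?thesis using b by simp
  next
    case (Suc l)
    then have "l < k" by simp
    then show ?thesis using not_less_Least[of l "\<lambda>k. (E ^^ Suc k) b = 0"] unfolding k_def[symmetric] Suc by blast
  qed
  have 0: "(E ^^ Suc k) (F b) = 0" unfolding funpow_Suc_right comp_apply EFb by (rule pow_linear)
  \<comment> \<open>\<open>E^(k+1) F b\<close>, computed by \<open>E_pow_F\<close>; the coefficients
    add up to \<open>(k + 1) (n + k + 2)\<close>, which is positive.\<close>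
  have "0 + of_nat (Suc k) *\<^sub>C (?m *\<^sub>C (E ^^ k) b + (2 * of_nat k) *\<^sub>C (E ^^ k) b) - (of_nat (Suc k) * of_nat k) *\<^sub>C (E ^^ k) b = 0"
    using 0 unfolding E_pow_F k F_simps H_E_pow Hb pow_linear .
  moreover have "0 + of_nat (Suc k) *\<^sub>C (?m *\<^sub>C y + (2 * of_nat k) *\<^sub>C y) - (of_nat (Suc k) * of_nat k) *\<^sub>C y = of_nat (Suc k * (n + 2 + k)) *\<^sub>C y" for y
    by (rule ext) (simp add: algebra_simps)
  ultimately have "of_nat (Suc k * (n + 2 + k)) *\<^sub>C (E ^^ k) b = 0" by metis
  then show False using k' unfolding cscale_eq_0 of_nat_eq_0_iff by simp
qed

text \<open>The last non-zero power \<open>E^l x\<close> is in the kernel of \<open>E\<close>, where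
  \<open>H (H - 1) ... (H - N + 1)\<close> vanishes; so one of these factors has an eigenvector
  there.\<close>

lemma highest_weight_vector_exists:
  assumes x: "x \<noteq> 0" "P x" and E: "\<And>y. P y \<Longrightarrow> P (E y)" and H: "\<And>y c. P y \<Longrightarrow> P (H y - c *\<^sub>C y)"
  obtains w n where "w \<noteq> 0" "P w" "E w = 0" "H w = of_nat n *\<^sub>C w" "n < N"
proof -
  define k where "k = (LEAST k. (E ^^ k) x = 0)"
  have k: "(E ^^ k) x = 0" unfolding k_def by (rule LeastI[of _ N]) (rule nilpotent)
  then obtain l where l: "k = Suc l" using x(1) by (cases k) auto
  then have "l < k" by simp
  then have b: "(E ^^ l) x \<noteq> 0" "E ((E ^^ l) x) = 0"
    using not_less_Least[of l "\<lambda>k. (E ^^ k) x = 0"] k unfolding k_def[symmetric] l by auto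
  have "P ((E ^^ l) x)" using x(2) E by (induction l) auto
  then have "\<exists>u c. u \<noteq> 0 \<and> (P u \<and> E u = 0) \<and> c \<in> set (downto N) \<and> H u = c *\<^sub>C u"
    using b H ker_E_closed by (intro eigenvector_exists[OF highest_weights[OF b(2)]]) blast+
  then show thesis using that unfolding set_downto by blast
qed

text \<open>As \<open>w\<close> is not in the image of \<open>F\<close>, some functional
  \<open>g\<close> vanishes on that image but not at \<open>w\<close>. Composing \<open>g\<close>
  with a polynomial in \<open>H\<close> extracts its component of weight \<open>n\<close>.\<close>

lemma functional_exists:
  assumes w: "w \<noteq> 0" "E w = 0" "H w = of_nat n *\<^sub>C w" "n < N"
  obtains \<phi> where "functional \<phi>" "\<And>x. \<phi> (F x) = 0" "\<And>x. \<phi> (H x) = of_nat n * \<phi> x" "\<phi> w = 1"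
proof -
  have sub: "cvec.subspace (range F)"
  proof (rule cvec.subspaceI)
    show "0 \<in> range F" using rangeI[of F 0] unfolding F_simps .
    show "x + y \<in> range F" if "x \<in> range F" "y \<in> range F" for x y
      using that by (elim rangeE) (simp only: F_simps(1)[symmetric] rangeI)
    show "c *\<^sub>C x \<in> range F" if "x \<in> range F" for c x
      using that by (elim rangeE) (simp only: F_simps(2)[symmetric] rangeI)
  qed
  obtain B where B: "B \<subseteq> range F" "cvec.independent B" "range F \<subseteq> cvec.span B"
    using cvec.maximal_independent_subset[of "range F"] by blast
  have "cvec.span B \<subseteq> range F" using B(1) sub by (rule cvec.span_minimal)
  then have wB: "w \<notin> cvec.span B" using highest_weight_not_in_range_F[OF w(2,3)] w(1) by auto
  then have "cvec.independent (insert w B)" using B(2) by (rule cvec.independent_insertI)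
  then obtain g where g: "functional g" "\<forall>x\<in>insert w B. g x = (if x = w then 1 else 0)"
    using vector_space_pair.linear_independent_extend[OF cvec_functional, of "insert w B" "\<lambda>x. if x = w then 1 else 0"] by blast
  note gs = functional_simps[OF g(1)]
  have "w \<notin> B" using wB cvec.span_base by blast
  then have gB: "g x = 0" if "x \<in> B" for x using g(2) that by auto
  have "g x = 0" if "x \<in> cvec.span B" for x
    using that by (induction rule: cvec.span_induct_alt) (simp_all only: gs gB, simp)
  then have gF: "g (F x) = 0" for x using B(3) by blast
  \<comment> \<open>The root \<open>n\<close> occurs exactly once in \<open>downto N\<close>.
    Without it the polynomial is non-zero at \<open>n\<close>, with value \<open>p\<close>, and
    multiplying by \<open>H - n\<close> again gives one that \<open>g\<close> kills.\<close>
  obtain as bs where ab: "downto N = as @ of_nat n # bs" "of_nat n \<notin> set as"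
    using split_list_first[of "of_nat n" "downto N"] w(4) by (auto simp: set_downto)
  have "of_nat n \<notin> set bs"
  proof -
    have "distinct (downto k)" for k by (induction k) (auto simp: set_downto)
    then show ?thesis using ab by (metis distinct.simps(2) distinct_append)
  qed
  define p where "p = (\<Prod>c\<leftarrow>as @ bs. of_nat n - c)"
  have p: "p \<noteq> 0" using ab(2) \<open>of_nat n \<notin> set bs\<close> unfolding p_def prod_list_zero_iff by auto
  define \<phi> where "\<phi> x = g (shifts (as @ bs) x) / p" for x
  have "functional \<phi>"
    by (rule functionalI) (simp_all only: \<phi>_def shifts_linear gs, simp_all add: add_divide_distrib)
  moreover have "shifts cs (F x) = F (shifts (map (\<lambda>c. c + 2) cs) x)" for cs x
  proof (induction cs arbitrary: x)
    case (Cons c cs)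
    have 1: "H (F x) - c *\<^sub>C F x = F (H x - (c + 2) *\<^sub>C x)"
      by (simp only: HF F_simps) (rule ext, simp add: algebra_simps)
    show ?case unfolding shifts.simps list.map 1 Cons by (rule refl)
  qed simp
  then have "\<phi> (F x) = 0" for x by (simp add: \<phi>_def gF)
  moreover have "\<phi> (H x) = of_nat n * \<phi> x" for x
  proof -
    have "shifts (downto N) x = shifts bs (shifts as (H x - of_nat n *\<^sub>C x))"
      unfolding ab shifts_append shifts.simps shifts_commute ..
    then have "g (shifts (as @ bs) (H x - of_nat n *\<^sub>C x)) = 0"
      using functional_weights_zero[OF g(1) gF, of x] by (simp only: shifts_append)
    moreover have "H x = (H x - of_nat n *\<^sub>C x) + of_nat n *\<^sub>C x" by simp
    ultimately have "g (shifts (as @ bs) (H x)) = of_nat n * g (shifts (as @ bs) x)"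
      using shifts_linear gs(1,3) by (metis add_0)
    then show ?thesis by (simp add: \<phi>_def)
  qed
  moreover have "\<phi> w = 1"
    unfolding \<phi>_def shifts_eigenvector[OF w(3)] gs p_def[symmetric] using p g(2) by simp
  ultimately show thesis using that by blast
qed

end

section \<open>Homomorphisms from weight vectors and functionals\<close>

context sl2_triple
begin

text \<open>\<open>- (n + 2)\<close> is not a root of \<open>H (H - 1) ... (H - N + 1)\<close>; so
  no highest weight vector, and dually no functional vanishing on the image of \<open>F\<close>, has
  this weight.\<close>

lemma negative_weights_prod: "(\<Prod>c\<leftarrow>downto N. - (of_nat n + 2) - c) \<noteq> 0"
proof -
  have "- (of_nat n + 2) - of_nat k \<noteq> (0::complex)" for k
  proof -
    have "- (of_nat n + 2) - of_nat k = - (of_nat (n + k + 2) :: complex)" by simp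
    then show ?thesis by (metis neg_equal_0_iff_equal of_nat_eq_0_iff add_2_eq_Suc' nat.distinct(1))
  qed
  then show ?thesis unfolding prod_list_zero_iff by (auto simp: set_downto)
qed

lemma E_F_pow_highest:
  assumes v: "E v = 0" "H v = of_nat n *\<^sub>C v"
  shows "E ((F ^^ Suc i) v) = (of_nat (Suc i) * (of_nat n - of_nat i)) *\<^sub>C (F ^^ i) v"
proof -
  have *: "0 + a *\<^sub>C b *\<^sub>C x - (a * c) *\<^sub>C x = (a * (b - c)) *\<^sub>C x" for a b c x
    by (rule ext) (simp add: algebra_simps)
  have "E ((F ^^ Suc i) v) = 0 + of_nat (Suc i) *\<^sub>C of_nat n *\<^sub>C (F ^^ i) v - (of_nat (Suc i) * of_nat i) *\<^sub>C (F ^^ i) v"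
    unfolding E_F_pow v pow_linear ..
  then show ?thesis unfolding * .
qed

lemma H_F_pow_highest:
  assumes v: "H v = of_nat n *\<^sub>C v"
  shows "H ((F ^^ i) v) = (of_nat n - 2 * of_nat i) *\<^sub>C (F ^^ i) v"
  unfolding H_F_pow v pow_linear by (rule ext) (simp add: algebra_simps)

text \<open>\<open>F^(n+1) v\<close> is in the kernel of \<open>E\<close> and has the negative
  weight \<open>n - 2 (n + 1) = - (n + 2)\<close>.\<close>

lemma F_pow_highest_zero:
  assumes v: "E v = 0" "H v = of_nat n *\<^sub>C v"
  shows "(F ^^ Suc n) v = 0"
proof -
  let ?u = "(F ^^ Suc n) v"
  have "E ?u = 0" unfolding E_F_pow_highest[OF v] by (rule ext) simp
  then have "shifts (downto N) ?u = 0" by (rule highest_weights)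
  moreover have "H ?u = (- (of_nat n + 2)) *\<^sub>C ?u"
    unfolding H_F_pow_highest[OF v(2)] by (rule arg_cong[of _ _ "\<lambda>c. c *\<^sub>C ?u"]) simp
  ultimately show ?thesis
    using negative_weights_prod[of n] by (simp only: shifts_eigenvector cscale_eq_0) blast
qed

lemma functional_E_pow_F:
  assumes \<phi>: "functional \<phi>" "\<And>x. \<phi> (F x) = 0" "\<And>x. \<phi> (H x) = of_nat n * \<phi> x"
  shows "\<phi> ((E ^^ Suc i) (F x)) = of_nat (Suc i) * (of_nat n - of_nat i) * \<phi> ((E ^^ i) x)"
  unfolding E_pow_F functional_simps[OF \<phi>(1)] \<phi>(2,3) by (simp add: algebra_simps)

lemma functional_E_pow_H:
  assumes \<phi>: "functional \<phi>" "\<And>x. \<phi> (H x) = of_nat n * \<phi> x"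
  shows "\<phi> ((E ^^ i) (H x)) = (of_nat n - 2 * of_nat i) * \<phi> ((E ^^ i) x)"
proof -
  have "(E ^^ i) (H x) = H ((E ^^ i) x) - (2 * of_nat i) *\<^sub>C (E ^^ i) x" unfolding H_E_pow by simp
  then show ?thesis by (simp only: functional_simps[OF \<phi>(1)] \<phi>(2) left_diff_distrib)
qed

text \<open>The dual of \<open>F_pow_highest_zero\<close>: \<open>\<phi> E^(n+1)\<close> vanishes on
  the image of \<open>F\<close> and has weight \<open>- (n + 2)\<close>.\<close>

lemma functional_E_pow_zero:
  assumes \<phi>: "functional \<phi>" "\<And>x. \<phi> (F x) = 0" "\<And>x. \<phi> (H x) = of_nat n * \<phi> x"
  shows "\<phi> ((E ^^ Suc n) x) = 0"
proof -
  define \<psi> where "\<psi> x = \<phi> ((E ^^ Suc n) x)" for x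
  have \<psi>: "functional \<psi>"
    unfolding \<psi>_def by (rule functionalI) (simp_all only: pow_linear functional_simps[OF \<phi>(1)])
  have F: "\<psi> (F x) = 0" for x unfolding \<psi>_def functional_E_pow_F[OF \<phi>] by simp
  have H: "\<psi> (H x) = (- (of_nat n + 2)) * \<psi> x" for x
    unfolding \<psi>_def functional_E_pow_H[OF \<phi>(1,3)] by (simp add: algebra_simps)
  have "\<psi> (shifts cs x) = (\<Prod>c\<leftarrow>cs. - (of_nat n + 2) - c) * \<psi> x" for cs x
  proof (induction cs arbitrary: x)
    case (Cons c cs)
    have "\<psi> (H x - c *\<^sub>C x) = (- (of_nat n + 2) - c) * \<psi> x"
      unfolding functional_simps[OF \<psi>] H by (simp add: algebra_simps)
    then show ?case unfolding shifts.simps Cons by simp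
  qed simp
  from this[of "downto N" x] have "\<psi> x = 0"
    unfolding functional_weights_zero[OF \<psi> F] using negative_weights_prod[of n] by (metis mult_eq_0_iff)
  then show ?thesis by (simp add: \<psi>_def)
qed

end

text \<open>The homomorphism through the simple module of highest weight \<open>n\<close> given by a highest weight
  vector \<open>v\<close> of the target and a lowest weight functional \<open>\<phi>\<close> on the source; the coefficients are
  the inverses of those in \<open>E\<^sup>i F\<^sup>i v = i! n! / (n - i)! v\<close>.\<close>

definition weight_map :: "nat \<Rightarrow> (cvec \<Rightarrow> cvec) \<Rightarrow> (cvec \<Rightarrow> complex) \<Rightarrow> (cvec \<Rightarrow> cvec) \<Rightarrow> cvec \<Rightarrow> cvec \<Rightarrow> cvec" where
  "weight_map n E \<phi> F' v x = (\<Sum>i<Suc n. (fact (n - i) / (fact i * fact n) * \<phi> ((E ^^ i) x)) *\<^sub>C (F' ^^ i) v)"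

text \<open>The recursion that makes \<open>weight_map\<close> commute with \<open>E\<close> and
  \<open>F\<close>: \<open>(i + 1) (n - i)\<close> is the factor in \<open>E F^(i+1) v\<close> and
  in \<open>\<phi> E^(i+1) F\<close>.\<close>

lemma weight_coefficient:
  assumes "i < n"
  shows "fact (n - Suc i) / (fact (Suc i) * fact n) * (of_nat (Suc i) * (of_nat n - of_nat i)) = (fact (n - i) / (fact i * fact n) :: complex)"
proof -
  have "fact (n - i) = (of_nat n - of_nat i) * (fact (n - Suc i) :: complex)"
    using assms by (metis Suc_diff_Suc fact_Suc of_nat_diff less_imp_le)
  moreover have "(fact (Suc i) :: complex) = of_nat (Suc i) * fact i" by simp
  ultimately show ?thesis by (simp only:) (simp add: divide_simps del: of_nat_Suc)
qed

locale sl2_triple_pair = A: sl2_triple E F H N + B: sl2_triple E' F' H' N'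
  for E F H N E' F' H' N' +
  fixes n :: nat and \<phi> v
  assumes \<phi>: "functional \<phi>" "\<And>x. \<phi> (F x) = 0" "\<And>x. \<phi> (H x) = of_nat n * \<phi> x"
    and v: "E' v = 0" "H' v = of_nat n *\<^sub>C v"
begin

abbreviation "\<Psi> \<equiv> weight_map n E \<phi> F' v"

lemma \<Psi>_linear: "clinear \<Psi>"
proof (rule clinearI)
  show "\<Psi> (x + y) = \<Psi> x + \<Psi> y" for x y
    unfolding weight_map_def A.pow_linear functional_simps[OF \<phi>(1)] sum.distrib[symmetric]
    by (rule sum.cong) (simp_all add: distrib_left cvec.scale_left_distrib)
  show "\<Psi> (c *\<^sub>C x) = c *\<^sub>C \<Psi> x" for c x
    unfolding weight_map_def A.pow_linear functional_simps[OF \<phi>(1)] cvec.scale_sum_right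
    by (rule sum.cong) (simp_all add: mult_ac)
qed

lemma \<Psi>_E: "\<Psi> (E x) = E' (\<Psi> x)"
proof -
  have pow: "(E ^^ i) (E x) = (E ^^ Suc i) x" for i by (simp only: funpow_Suc_right comp_apply)
  \<comment> \<open>The last term vanishes since \<open>\<phi> E^(n+1) = 0\<close>. In
    \<open>E' (\<Psi> x)\<close> it is the first term that vanishes, as \<open>E' v = 0\<close>,
    which explains the shift of the index.\<close>
  have "\<Psi> (E x) = (\<Sum>i<n. (fact (n - i) / (fact i * fact n) * \<phi> ((E ^^ Suc i) x)) *\<^sub>C (F' ^^ i) v)"
    unfolding weight_map_def sum.lessThan_Suc pow A.functional_E_pow_zero[OF \<phi>] by (simp del: funpow.simps)
  also have "\<dots> = (\<Sum>i<n. (fact (n - Suc i) / (fact (Suc i) * fact n) * \<phi> ((E ^^ Suc i) x)) *\<^sub>C E' ((F' ^^ Suc i) v))"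
  proof (rule sum.cong)
    fix i assume "i \<in> {..<n}"
    then have i: "i < n" by simp
    show "(fact (n - i) / (fact i * fact n) * \<phi> ((E ^^ Suc i) x)) *\<^sub>C (F' ^^ i) v =
        (fact (n - Suc i) / (fact (Suc i) * fact n) * \<phi> ((E ^^ Suc i) x)) *\<^sub>C E' ((F' ^^ Suc i) v)"
      unfolding B.E_F_pow_highest[OF v] weight_coefficient[OF i, symmetric] cvec.scale_scale
      by (rule arg_cong[of _ _ "\<lambda>c. c *\<^sub>C _"]) (simp only: mult_ac)
  qed simp
  also have "\<dots> = E' (\<Psi> x)"
    unfolding weight_map_def clinear_sum[OF B.linear(1)] B.E_simps sum.lessThan_Suc_shift
    by (simp add: v B.E_simps del: funpow.simps(2) fact_Suc)
  finally show ?thesis .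
qed

lemma \<Psi>_F: "\<Psi> (F x) = F' (\<Psi> x)"
proof -
  have "F' (\<Psi> x) = (\<Sum>i<Suc n. (fact (n - i) / (fact i * fact n) * \<phi> ((E ^^ i) x)) *\<^sub>C (F' ^^ Suc i) v)"
    unfolding weight_map_def clinear_sum[OF B.linear(2)] B.F_simps by simp
  \<comment> \<open>Here the last term vanishes since \<open>F'^(n+1) v = 0\<close>, and in
    \<open>\<Psi> (F x)\<close> the first, as \<open>\<phi> F = 0\<close>.\<close>
  also have "\<dots> = (\<Sum>i<n. (fact (n - i) / (fact i * fact n) * \<phi> ((E ^^ i) x)) *\<^sub>C (F' ^^ Suc i) v)"
    unfolding sum.lessThan_Suc B.F_pow_highest_zero[OF v] by (simp del: funpow.simps)
  also have "\<dots> = (\<Sum>i<n. (fact (n - Suc i) / (fact (Suc i) * fact n) * \<phi> ((E ^^ Suc i) (F x))) *\<^sub>C (F' ^^ Suc i) v)"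
  proof (rule sum.cong)
    fix i assume "i \<in> {..<n}"
    then have i: "i < n" by simp
    show "(fact (n - i) / (fact i * fact n) * \<phi> ((E ^^ i) x)) *\<^sub>C (F' ^^ Suc i) v =
        (fact (n - Suc i) / (fact (Suc i) * fact n) * \<phi> ((E ^^ Suc i) (F x))) *\<^sub>C (F' ^^ Suc i) v"
      unfolding A.functional_E_pow_F[OF \<phi>] weight_coefficient[OF i, symmetric]
      by (rule arg_cong[of _ _ "\<lambda>c. c *\<^sub>C _"]) (simp only: mult_ac)
  qed simp
  also have "\<dots> = \<Psi> (F x)"
    unfolding weight_map_def sum.lessThan_Suc_shift by (simp add: \<phi> del: funpow.simps(2) fact_Suc)
  finally show ?thesis by simp
qed

lemma \<Psi>_H: "\<Psi> (H x) = H' (\<Psi> x)"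
  unfolding weight_map_def clinear_sum[OF B.linear(3)] B.H_simps A.functional_E_pow_H[OF \<phi>(1,3)]
    B.H_F_pow_highest[OF v(2)] cvec.scale_scale
  by (rule sum.cong) (simp_all only: mult_ac)

text \<open>Only the term \<open>i = 0\<close> survives, and its coefficient is
  \<open>n! / (0! n!) = 1\<close>.\<close>

lemma functional_\<Psi>:
  assumes \<psi>: "functional \<psi>" "\<And>x. \<psi> (F' x) = 0"
  shows "\<psi> (\<Psi> x) = \<phi> x * \<psi> v"
  unfolding weight_map_def sum.lessThan_Suc_shift
  by (simp add: functional_simps[OF \<psi>(1)] \<psi>(2) del: fact_Suc)

lemma \<Psi>_in:
  assumes P: "P v" "\<And>y. P y \<Longrightarrow> P (F' y)" "\<And>y z. P y \<Longrightarrow> P z \<Longrightarrow> P (y + z)" "\<And>y c. P y \<Longrightarrow> P (c *\<^sub>C y)"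
  shows "P (\<Psi> x)"
proof -
  have F: "P ((F' ^^ i) v)" for i using P(1,2) by (induction i) auto
  have "P 0" using P(4)[OF P(1), of 0] by simp
  then have "P (\<Sum>i<m. c i *\<^sub>C (F' ^^ i) v)" for m c
    using F P(3,4) by (induction m) (simp_all only: sum.lessThan_Suc lessThan_0 sum.empty)
  then show ?thesis unfolding weight_map_def .
qed

end

section \<open>Nilpotency of the raising and lowering operators\<close>

definition oscale :: "complex \<Rightarrow> (cvec \<Rightarrow> cvec) \<Rightarrow> cvec \<Rightarrow> cvec" where
  "oscale c T x = c *\<^sub>C T x"

interpretation cop: vector_space oscale
  by unfold_locales (auto simp: fun_eq_iff oscale_def algebra_simps)

text \<open>The powers of \<open>E\<close> are eigenvectors of \<open>ad H\<close> for distinct eigenvalues, hence linearly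
  independent unless they vanish.\<close>

lemma ad_eigenvector_nilpotent:
  assumes lin: "clinear E" "clinear H" and HE: "\<And>x. H (E x) = E (H x) + 2 *\<^sub>C E x"
    and T: "finite T" "\<And>k. E ^^ Suc k \<in> cop.span T"
  shows "\<exists>N. \<forall>x. (E ^^ N) x = 0"
proof (rule ccontr)
  assume "\<not> ?thesis"
  then have nz: "E ^^ N \<noteq> 0" for N by (metis zero_fun_apply)
  have H_pow: "H ((E ^^ k) x) = (E ^^ k) (H x) + (2 * of_nat k) *\<^sub>C (E ^^ k) x" for k x
  proof (induction k)
    case (Suc k)
    have *: "a + (2 * of_nat k) *\<^sub>C b + 2 *\<^sub>C b = a + (2 * of_nat (Suc k)) *\<^sub>C b" for a b
      by (rule ext) (simp add: algebra_simps)
    show ?case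
      by (simp only: funpow.simps comp_apply HE Suc clinear_add[OF lin(1)] clinear_scale[OF lin(1)] *)
  qed (simp add: fun_eq_iff)
  define ad where "ad c S x = H (S x) - S (H x) - c *\<^sub>C S x" for c S x
  \<comment> \<open>\<open>Z m\<close> kills the powers with exponents 1 to \<open>m\<close> and
    multiplies the next one by a non-zero number, so that one is not in their span.\<close>
  define Z where "Z m S = foldr (\<lambda>j. ad (2 * of_nat (Suc j))) [0..<m] S" for m S
  have ad_linear: "ad c (S + S') = ad c S + ad c S'" "ad c (oscale a S) = oscale a (ad c S)" for c a S S'
  proof -
    show "ad c (S + S') = ad c S + ad c S'"
    proof (rule ext)
      fix x
      have *: "a + b - (a' + b') - c *\<^sub>C (d + e) = (a - a' - c *\<^sub>C d) + (b - b' - c *\<^sub>C e)" for a b a' b' d e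
        by (rule ext) (simp add: algebra_simps)
      show "ad c (S + S') x = (ad c S + ad c S') x"
        unfolding ad_def plus_fun_apply[of S] plus_fun_apply[of "ad c S"] clinear_add[OF lin(2)] by (rule *)
    qed
    show "ad c (oscale a S) = oscale a (ad c S)"
      unfolding ad_def oscale_def clinear_scale[OF lin(2)] by (intro ext) (simp add: algebra_simps)
  qed
  have fold_linear: "foldr (\<lambda>j. ad (2 * of_nat (Suc j))) js (S + S') = foldr (\<lambda>j. ad (2 * of_nat (Suc j))) js S + foldr (\<lambda>j. ad (2 * of_nat (Suc j))) js S'"
     "foldr (\<lambda>j. ad (2 * of_nat (Suc j))) js (oscale a S) = oscale a (foldr (\<lambda>j. ad (2 * of_nat (Suc j))) js S)" for js a S S'
    by (induction js) (simp_all only: foldr.simps comp_apply id_apply ad_linear)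
  have ad_E: "ad c (E ^^ k) = oscale (2 * of_nat k - c) (E ^^ k)" for c k
    unfolding ad_def H_pow oscale_def by (intro ext) (simp add: algebra_simps)
  have fold_E: "foldr (\<lambda>j. ad (2 * of_nat (Suc j))) js (E ^^ Suc k) = oscale (\<Prod>j\<leftarrow>js. 2 * of_nat (Suc k) - 2 * of_nat (Suc j)) (E ^^ Suc k)" for js k
  proof (induction js)
    case (Cons j js)
    show ?case
      unfolding foldr.simps comp_apply Cons ad_linear ad_E cop.scale_scale list.map prod_list.Cons
      by (rule arg_cong[of _ _ "\<lambda>c. oscale c _"]) (rule mult.commute)
  qed (simp add: oscale_def fun_eq_iff)
  define B where "B m = (\<lambda>k. E ^^ Suc k) ` {..<m}" for m
  have notin: "E ^^ Suc m \<notin> cop.span (B m)" for m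
  proof
    have "Z m S = 0" if "S \<in> cop.span (B m)" for S
      using that
    proof (induction rule: cop.span_induct_alt)
      case base
      show ?case using fold_linear(2)[of "[0..<m]" 0 0] unfolding Z_def by (simp only: cop.scale_zero_left)
    next
      case (step c S S')
      obtain k where k: "S = E ^^ Suc k" "k < m" using step(1) by (auto simp: B_def)
      have "(\<Prod>j\<leftarrow>[0..<m]. 2 * of_nat (Suc k) - 2 * of_nat (Suc j)) = (0::complex)"
        unfolding prod_list_zero_iff using k(2) by auto
      then have "Z m S = 0" unfolding Z_def k(1) fold_E by (simp only: cop.scale_zero_left)
      then show ?case using step(2) unfolding Z_def fold_linear by (simp only: cop.scale_zero_right add_0)
    qed
    moreover assume "E ^^ Suc m \<in> cop.span (B m)"
    ultimately have "Z m (E ^^ Suc m) = 0" by blast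
    moreover have "2 * of_nat (Suc m) - 2 * of_nat (Suc j) \<noteq> (0::complex)" if "j < m" for j
      using that by simp
    then have "(\<Prod>j\<leftarrow>[0..<m]. 2 * of_nat (Suc m) - 2 * of_nat (Suc j)) \<noteq> (0::complex)"
      unfolding prod_list_zero_iff by auto
    ultimately show False unfolding Z_def fold_E cop.scale_eq_0_iff using nz by blast
  qed
  have B: "cop.independent (B m) \<and> card (B m) = m \<and> finite (B m)" for m
  proof (induction m)
    case 0
    show ?case by (simp add: B_def cop.independent_empty)
  next
    case (Suc m)
    have 1: "B (Suc m) = insert (E ^^ Suc m) (B m)" by (simp only: B_def lessThan_Suc image_insert)
    have "E ^^ Suc m \<notin> B m" using notin cop.span_base by blast
    then show ?case using Suc cop.independent_insertI[OF notin] unfolding 1 by simp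
  qed
  have "B m \<subseteq> cop.span T" for m using T(2) unfolding B_def by blast
  then have "card (B (Suc (card T))) \<le> card T" using cop.independent_span_bound[OF T(1)] B by blast
  then show False using B[of "Suc (card T)"] by simp
qed

section \<open>Matrices as operators, and the triple of a representation\<close>

text \<open>The operator ignores coordinates from \<open>dim_col A\<close> on and returns 0 from
  \<open>dim_row A\<close> on, so it is defined on all of \<open>cvec\<close>, and the sl2 relations
  hold there without side conditions.\<close>

definition mop :: "complex mat \<Rightarrow> cvec \<Rightarrow> cvec" where
  "mop A x = (\<lambda>i. if i < dim_row A then \<Sum>j<dim_col A. A $$ (i, j) * x j else 0)"

definition unitv :: "nat \<Rightarrow> cvec" where
  "unitv j = (\<lambda>i. if i = j then 1 else 0)"

definition supp :: "nat \<Rightarrow> cvec set" where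
  "supp n = {x. \<forall>i\<ge>n. x i = 0}"

definition mat_of :: "nat \<Rightarrow> nat \<Rightarrow> (cvec \<Rightarrow> cvec) \<Rightarrow> complex mat" where
  "mat_of m n T = mat m n (\<lambda>(i, j). T (unitv j) i)"

lemma mop_linear: "clinear (mop A)"
  by (rule clinearI)
    (auto simp: mop_def fun_eq_iff algebra_simps sum.distrib sum_distrib_left)

lemma mop_supp: "A \<in> carrier_mat m n \<Longrightarrow> mop A x \<in> supp m"
  by (auto simp: mop_def supp_def)

lemma mop_mult:
  assumes "A \<in> carrier_mat a b" "B \<in> carrier_mat b c"
  shows "mop (A * B) x = mop A (mop B x)"
proof (rule ext)
  fix i
  show "mop (A * B) x i = mop A (mop B x) i"
  proof (cases "i < a")
    case True
    have "mop (A * B) x i = (\<Sum>j<c. (\<Sum>k<b. A $$ (i, k) * B $$ (k, j)) * x j)"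
      using assms True by (simp add: mop_def scalar_prod_def atLeast0LessThan)
    also have "\<dots> = (\<Sum>j<c. \<Sum>k<b. A $$ (i, k) * (B $$ (k, j) * x j))"
      by (simp add: sum_distrib_right mult.assoc)
    also have "\<dots> = (\<Sum>k<b. \<Sum>j<c. A $$ (i, k) * (B $$ (k, j) * x j))"
      by (rule sum.swap)
    also have "\<dots> = mop A (mop B x) i"
      using assms True by (simp add: mop_def sum_distrib_left)
    finally show ?thesis .
  qed (use assms in \<open>simp add: mop_def\<close>)
qed

lemma mop_minus: "A \<in> carrier_mat m n \<Longrightarrow> B \<in> carrier_mat m n \<Longrightarrow> mop (A - B) x = mop A x - mop B x"
  by (auto simp: mop_def fun_eq_iff left_diff_distrib sum_subtractf)

lemma mop_smult: "mop (c \<cdot>\<^sub>m A) x = c *\<^sub>C mop A x"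
  by (auto simp: mop_def fun_eq_iff sum_distrib_left mult.assoc)

lemma mop_unitv: "j < dim_col A \<Longrightarrow> mop A (unitv j) = (\<lambda>i. if i < dim_row A then A $$ (i, j) else 0)"
  by (auto simp: mop_def unitv_def fun_eq_iff if_distrib[of "\<lambda>c. _ * c"] sum.delta cong: if_cong)

lemma unitv_supp: "j < n \<Longrightarrow> unitv j \<in> supp n"
  by (auto simp: unitv_def supp_def)

lemma mop_eqI:
  assumes "A \<in> carrier_mat m n" "B \<in> carrier_mat m n" "\<And>x. x \<in> supp n \<Longrightarrow> mop A x = mop B x"
  shows "A = B"
proof (rule eq_matI)
  fix i j assume "i < dim_row B" "j < dim_col B"
  then show "A $$ (i, j) = B $$ (i, j)"
    using assms(3)[OF unitv_supp, of j] assms(1,2) by (auto simp: mop_unitv fun_eq_iff split: if_splits)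
qed (use assms in auto)

lemma supp_expand: "x \<in> supp n \<Longrightarrow> x = (\<Sum>j<n. x j *\<^sub>C unitv j)"
proof (rule ext)
  fix i assume "x \<in> supp n"
  have "(\<Sum>j<m. x j *\<^sub>C unitv j) i = (if i < m then x i else 0)" for m
    by (induction m) (auto simp: unitv_def less_Suc_eq)
  then show "x i = (\<Sum>j<n. x j *\<^sub>C unitv j) i" using \<open>x \<in> supp n\<close> by (auto simp: supp_def)
qed

lemma supp_span: "supp n \<subseteq> cvec.span (unitv ` {..<n})"
proof
  fix x assume "x \<in> supp n"
  then have "x = (\<Sum>j<n. x j *\<^sub>C unitv j)" by (rule supp_expand)
  moreover have "(\<Sum>j<n. x j *\<^sub>C unitv j) \<in> cvec.span (unitv ` {..<n})"
    by (intro cvec.span_sum cvec.span_scale cvec.span_base) auto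
  ultimately show "x \<in> cvec.span (unitv ` {..<n})" by metis
qed

lemma supp_closed:
  "x \<in> supp n \<Longrightarrow> y \<in> supp n \<Longrightarrow> x + y \<in> supp n" "x \<in> supp n \<Longrightarrow> y \<in> supp n \<Longrightarrow> x - y \<in> supp n"
  "x \<in> supp n \<Longrightarrow> c *\<^sub>C x \<in> supp n" "0 \<in> supp n"
  by (auto simp: supp_def)

lemma mat_of_carrier: "mat_of m n T \<in> carrier_mat m n"
  by (simp add: mat_of_def)

lemma mop_mat_of:
  assumes T: "clinear T" "\<And>x. T x \<in> supp m" and x: "x \<in> supp n"
  shows "mop (mat_of m n T) x = T x"
proof (rule ext)
  fix i
  have "T x = (\<Sum>j<n. x j *\<^sub>C T (unitv j))"
    by (subst supp_expand[OF x]) (simp only: clinear_sum[OF T(1)] clinear_scale[OF T(1)])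
  moreover have "(\<Sum>j<k. x j *\<^sub>C T (unitv j)) i = (\<Sum>j<k. T (unitv j) i * x j)" for k
    by (induction k) auto
  ultimately have Tx: "T x i = (\<Sum>j<n. T (unitv j) i * x j)" by simp
  show "mop (mat_of m n T) x i = T x i"
  proof (cases "i < m")
    case True
    then show ?thesis by (simp add: mop_def mat_of_def Tx)
  next
    case False
    then show ?thesis using T(2)[of x] by (simp add: mop_def mat_of_def supp_def)
  qed
qed

definition sl2_e :: "complex mat" where "sl2_e = mat 2 2 (\<lambda>(i, j). if i = 0 \<and> j = 1 then 1 else 0)"
definition sl2_f :: "complex mat" where "sl2_f = mat 2 2 (\<lambda>(i, j). if i = 1 \<and> j = 0 then 1 else 0)"
definition sl2_h :: "complex mat" where "sl2_h = mat 2 2 (\<lambda>(i, j). if i = j then (if i = 0 then 1 else - 1) else 0)"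

lemma sl2_efh: "sl2_e \<in> sl2" "sl2_f \<in> sl2" "sl2_h \<in> sl2"
  by (auto simp: sl2_def sl2_e_def sl2_f_def sl2_h_def numeral_2_eq_2)

lemma sl2_brackets:
  "lie_bracket sl2_e sl2_f = sl2_h" "lie_bracket sl2_h sl2_e = 2 \<cdot>\<^sub>m sl2_e" "lie_bracket sl2_h sl2_f = (- 2) \<cdot>\<^sub>m sl2_f"
  by (rule eq_matI; auto simp: lie_bracket_def sl2_e_def sl2_f_def sl2_h_def scalar_prod_def numeral_2_eq_2 less_Suc_eq)+

lemma sl2_decompose:
  assumes "A \<in> sl2"
  shows "A = A $$ (0, 1) \<cdot>\<^sub>m sl2_e + A $$ (1, 0) \<cdot>\<^sub>m sl2_f + A $$ (0, 0) \<cdot>\<^sub>m sl2_h"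
proof -
  have "A $$ (1, 1) = - A $$ (0, 0)" using assms by (simp add: sl2_def numeral_2_eq_2 add_eq_0_iff)
  then show ?thesis
    using assms by (intro eq_matI) (auto simp: sl2_def sl2_e_def sl2_f_def sl2_h_def numeral_2_eq_2 less_Suc_eq)
qed

text \<open>The elementary matrices, as operators, are the finite set \<open>T\<close> for
  \<open>ad_eigenvector_nilpotent\<close>.\<close>

lemma matrix_span:
  assumes A: "A \<in> carrier_mat n n"
  shows "mop A \<in> cop.span ((\<lambda>(a, b) x i. if i = a then x b else 0) ` ({..<n} \<times> {..<n}))" (is "_ \<in> cop.span (?U ` ?I)")
proof -
  have app: "(\<Sum>p\<in>S. oscale (A $$ p) (?U p)) x i = (\<Sum>p\<in>S. A $$ p * ?U p x i)" if "finite S" for S x i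
    using that by (induction S) (auto simp: oscale_def)
  have "mop A = (\<Sum>p\<in>?I. oscale (A $$ p) (?U p))"
  proof (intro ext)
    fix x i
    have "(\<Sum>p\<in>?I. A $$ p * ?U p x i) = (\<Sum>a<n. \<Sum>b<n. A $$ (a, b) * (if i = a then x b else 0))"
      by (simp add: sum.cartesian_product case_prod_unfold)
    also have "\<dots> = (\<Sum>a<n. if a = i then \<Sum>b<n. A $$ (a, b) * x b else 0)"
      by (intro sum.cong) auto
    also have "\<dots> = mop A x i" using A by (simp add: mop_def)
    finally show "mop A x i = (\<Sum>p\<in>?I. oscale (A $$ p) (?U p)) x i" by (simp add: app)
  qed
  moreover have "(\<Sum>p\<in>?I. oscale (A $$ p) (?U p)) \<in> cop.span (?U ` ?I)"
    by (intro cop.span_sum cop.span_scale cop.span_base) auto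
  ultimately show ?thesis by metis
qed

text \<open>Positive powers only: the zeroth is the identity of \<open>cvec\<close>, which no matrix
  represents.\<close>

lemma mop_pow_in_span:
  assumes A: "A \<in> carrier_mat n n"
  shows "mop A ^^ Suc k \<in> cop.span ((\<lambda>(a, b) x i. if i = a then x b else 0) ` ({..<n} \<times> {..<n}))"
proof -
  have "\<exists>B \<in> carrier_mat n n. mop A ^^ Suc k = mop B"
  proof (induction k)
    case 0
    then show ?case using A by (auto simp: fun_eq_iff)
  next
    case (Suc k)
    then obtain B where B: "B \<in> carrier_mat n n" "mop A ^^ Suc k = mop B" by blast
    have "mop A ^^ Suc (Suc k) = mop (A * B)"
      by (rule ext) (simp only: funpow.simps(2)[of "Suc k"] comp_apply B(2) mop_mult[OF A B(1)])
    then show ?case using A B(1) by (intro bexI[of _ "A * B"]) auto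
  qed
  then show ?thesis using matrix_span by metis
qed

definition rep_e :: "sl2_rep \<Rightarrow> cvec \<Rightarrow> cvec" where "rep_e V = mop (snd V sl2_e)"
definition rep_f :: "sl2_rep \<Rightarrow> cvec \<Rightarrow> cvec" where "rep_f V = mop (snd V sl2_f)"
definition rep_h :: "sl2_rep \<Rightarrow> cvec \<Rightarrow> cvec" where "rep_h V = mop (snd V sl2_h)"

lemma rep_relations:
  assumes V: "V \<in> sl2_reps"
  shows "rep_e V (rep_f V x) = rep_f V (rep_e V x) + rep_h V x"
    "rep_h V (rep_e V x) = rep_e V (rep_h V x) + 2 *\<^sub>C rep_e V x"
    "rep_h V (rep_f V x) = rep_f V (rep_h V x) - 2 *\<^sub>C rep_f V x"
proof -
  let ?n = "fst V"
  note c = sl2_reps_carrier[OF V sl2_efh(1)] sl2_reps_carrier[OF V sl2_efh(2)] sl2_reps_carrier[OF V sl2_efh(3)]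
  have br: "mop (snd V A) (mop (snd V B) x) - mop (snd V B) (mop (snd V A) x) = mop (snd V (lie_bracket A B)) x"
    if "A \<in> sl2" "B \<in> sl2" for A B
  proof -
    note cc = sl2_reps_carrier[OF V that(1)] sl2_reps_carrier[OF V that(2)]
    have "mop (snd V (lie_bracket A B)) x = mop (snd V A * snd V B) x - mop (snd V B * snd V A) x"
      unfolding sl2_repsD(4)[OF V that] by (rule mop_minus[of _ ?n ?n]) (use cc in auto)
    then show ?thesis by (simp only: mop_mult[OF cc] mop_mult[OF cc(2,1)])
  qed
  show "rep_e V (rep_f V x) = rep_f V (rep_e V x) + rep_h V x"
    using br[OF sl2_efh(1,2)] unfolding sl2_brackets rep_e_def rep_f_def rep_h_def by (metis add.commute diff_add_cancel)
  show "rep_h V (rep_e V x) = rep_e V (rep_h V x) + 2 *\<^sub>C rep_e V x"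
    using br[OF sl2_efh(3,1)] unfolding sl2_brackets sl2_repsD(3)[OF V sl2_efh(1) sl2_efh(1)] mop_smult rep_e_def rep_h_def
    by (metis add.commute diff_add_cancel)
  have "rep_h V (rep_f V x) - rep_f V (rep_h V x) = (- 2) *\<^sub>C rep_f V x"
    using br[OF sl2_efh(3,2)] unfolding sl2_brackets sl2_repsD(3)[OF V sl2_efh(2) sl2_efh(2)] mop_smult rep_f_def rep_h_def .
  moreover have "a = b - 2 *\<^sub>C c" if "a - b = (- 2) *\<^sub>C c" for a b c
  proof -
    have "a = (a - b) + b" by simp
    then show ?thesis unfolding that by (simp add: fun_eq_iff)
  qed
  ultimately show "rep_h V (rep_f V x) = rep_f V (rep_h V x) - 2 *\<^sub>C rep_f V x" by blast
qed

lemma rep_linear: "clinear (rep_e V)" "clinear (rep_f V)" "clinear (rep_h V)"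
  by (simp_all add: rep_e_def rep_f_def rep_h_def mop_linear)

lemma rep_sl2_triple:
  assumes V: "V \<in> sl2_reps"
  shows "\<exists>N. sl2_triple (rep_e V) (rep_f V) (rep_h V) N"
proof -
  let ?T = "(\<lambda>(a, b) (x::cvec) i. if i = a then x b else 0) ` ({..<fst V} \<times> {..<fst V})"
  have "finite ?T" by simp
  note r = rep_relations[OF V]
  have "\<exists>N. \<forall>x. (rep_e V ^^ N) x = 0"
    by (rule ad_eigenvector_nilpotent[OF rep_linear(1,3) r(2) \<open>finite ?T\<close>])
      (use mop_pow_in_span[OF sl2_reps_carrier[OF V sl2_efh(1)]] in \<open>simp only: rep_e_def\<close>)
  then obtain N where N: "\<And>x. (rep_e V ^^ N) x = 0" by blast
  have "\<exists>N. \<forall>x. (rep_f V ^^ N) x = 0"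
  proof (rule ad_eigenvector_nilpotent[OF rep_linear(2) _ _ \<open>finite ?T\<close>])
    \<comment> \<open>With \<open>- H\<close> in place of \<open>H\<close>, the operator
      \<open>F\<close> has the eigenvalue 2 that the lemma on \<open>E\<close> asks for.\<close>
    show "clinear (\<lambda>x. - rep_h V x)"
      by (rule clinearI) (simp_all only: clinear_add[OF rep_linear(3)] clinear_scale[OF rep_linear(3)] minus_add_distrib cvec.scale_minus_right)
    show "- rep_h V (rep_f V x) = rep_f V (- rep_h V x) + 2 *\<^sub>C rep_f V x" for x
      unfolding r(3) clinear_neg[OF rep_linear(2)] by simp
  qed (use mop_pow_in_span[OF sl2_reps_carrier[OF V sl2_efh(2)]] in \<open>simp only: rep_f_def\<close>)
  then obtain N' where N': "\<And>x. (rep_f V ^^ N') x = 0" by blast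
  have "(rep_e V ^^ (N' + N)) x = 0" for x
    using N[of "(rep_e V ^^ N') x"] by (simp only: add.commute[of N' N] funpow_add comp_apply)
  moreover have "(rep_f V ^^ (N' + N)) x = 0" for x
    using N'[of "(rep_f V ^^ N) x"] by (simp only: funpow_add comp_apply)
  moreover note r rep_linear
  ultimately have "sl2_triple (rep_e V) (rep_f V) (rep_h V) (N' + N)"
    by (intro sl2_triple.intro)
  then show ?thesis ..
qed

lemma intertwiner_hom:
  assumes V: "V \<in> sl2_reps" and W: "W \<in> sl2_reps" and T: "clinear T" "\<And>x. T x \<in> supp (fst W)"
    and e: "\<And>x. T (rep_e V x) = rep_e W (T x)" and f: "\<And>x. T (rep_f V x) = rep_f W (T x)"
    and h: "\<And>x. T (rep_h V x) = rep_h W (T x)"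
  shows "mat_of (fst W) (fst V) T \<in> sl2_homs V W"
proof -
  let ?M = "mat_of (fst W) (fst V) T"
  have M: "?M \<in> carrier_mat (fst W) (fst V)" by (rule mat_of_carrier)
  have gen: "?M * snd V A = snd W A * ?M" if A: "A \<in> sl2" and comm: "\<And>x. T (mop (snd V A) x) = mop (snd W A) (T x)" for A
  proof (rule mop_eqI)
    note c = sl2_reps_carrier[OF V A] sl2_reps_carrier[OF W A]
    show "?M * snd V A \<in> carrier_mat (fst W) (fst V)" "snd W A * ?M \<in> carrier_mat (fst W) (fst V)" using M c by auto
    fix x assume x: "x \<in> supp (fst V)"
    show "mop (?M * snd V A) x = mop (snd W A * ?M) x"
      unfolding mop_mult[OF M c(1)] mop_mult[OF c(2) M] mop_mat_of[OF T x] mop_mat_of[OF T mop_supp[OF c(1)]] by (rule comm)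
  qed
  have "?M * snd V A = snd W A * ?M" if A: "A \<in> sl2" for A
  proof -
    let ?a = "A $$ (0, 1)" and ?b = "A $$ (1, 0)" and ?c = "A $$ (0, 0)"
    have s: "?a \<cdot>\<^sub>m sl2_e \<in> sl2" "?b \<cdot>\<^sub>m sl2_f \<in> sl2" "?c \<cdot>\<^sub>m sl2_h \<in> sl2" "?a \<cdot>\<^sub>m sl2_e + ?b \<cdot>\<^sub>m sl2_f \<in> sl2"
      using sl2_efh by (auto intro: sl2_smult sl2_add)
    have dec: "snd U A = ?a \<cdot>\<^sub>m snd U sl2_e + ?b \<cdot>\<^sub>m snd U sl2_f + ?c \<cdot>\<^sub>m snd U sl2_h" if U: "U \<in> sl2_reps" for U
      using arg_cong[OF sl2_decompose[OF A], of "snd U"]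
      unfolding sl2_repsD(2)[OF U s(4) s(3)] sl2_repsD(2)[OF U s(1,2)] sl2_repsD(3)[OF U sl2_efh(1) sl2_efh(1)]
        sl2_repsD(3)[OF U sl2_efh(2) sl2_efh(2)] sl2_repsD(3)[OF U sl2_efh(3) sl2_efh(3)] .
    have g: "?M * snd V sl2_e = snd W sl2_e * ?M" "?M * snd V sl2_f = snd W sl2_f * ?M" "?M * snd V sl2_h = snd W sl2_h * ?M"
      using gen[OF sl2_efh(1)] gen[OF sl2_efh(2)] gen[OF sl2_efh(3)] e f h by (simp_all add: rep_e_def rep_f_def rep_h_def)
    note cV = sl2_reps_carrier[OF V sl2_efh(1)] sl2_reps_carrier[OF V sl2_efh(2)] sl2_reps_carrier[OF V sl2_efh(3)]
    note cW = sl2_reps_carrier[OF W sl2_efh(1)] sl2_reps_carrier[OF W sl2_efh(2)] sl2_reps_carrier[OF W sl2_efh(3)]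
    have "?M * snd V A = ?a \<cdot>\<^sub>m (?M * snd V sl2_e) + ?b \<cdot>\<^sub>m (?M * snd V sl2_f) + ?c \<cdot>\<^sub>m (?M * snd V sl2_h)"
      unfolding dec[OF V] using M cV
      by (simp add: mult_add_distrib_mat[of _ "fst W" "fst V" _ "fst V"] mult_smult_distrib[of _ "fst W" "fst V" _ "fst V"])
    also have "\<dots> = snd W A * ?M"
      unfolding dec[OF W] g using M cW
      by (simp add: add_mult_distrib_mat[of _ "fst W" "fst W" _ _ "fst V"] mult_smult_assoc_mat[of _ "fst W" "fst W" _ "fst V"])
    finally show ?thesis .
  qed
  then show ?thesis using M by (simp add: sl2_homs_def)
qed

section \<open>Tensor powers of L(1)\<close>

fun tensor_power :: "nat \<Rightarrow> sl2_rep" where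
  "tensor_power 0 = (1, \<lambda>A \<in> sl2. 0\<^sub>m 1 1)"
| "tensor_power (Suc n) = sl2_tensor sl2_L1 (tensor_power n)"

lemma tensor_power_rep: "tensor_power n \<in> sl2_reps"
  by (induction n) (simp_all add: sl2_unit_rep[simplified] sl2_tensor_rep sl2_L1_rep)

lemma tensor_power_dim: "fst (tensor_power n) > 0"
  by (induction n) (simp_all add: sl2_tensor_def sl2_L1_def)

text \<open>Column 0 describes the action on the first basis vector, a highest weight vector; row 0
  describes the first coordinate as a functional. In the lexicographic basis, index 0 means index 0
  in both tensor factors.\<close>

lemma tensor_power_first:
  assumes "i < fst (tensor_power n)"
  shows "snd (tensor_power n) sl2_e $$ (i, 0) = 0" "snd (tensor_power n) sl2_f $$ (0, i) = 0"
    "snd (tensor_power n) sl2_h $$ (i, 0) = (if i = 0 then of_nat n else 0)"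
    "snd (tensor_power n) sl2_h $$ (0, i) = (if i = 0 then of_nat n else 0)"
  using assms
proof (induction n arbitrary: i)
  case 0
  {
    case 1 then show ?case using sl2_efh by simp
  next
    case 2 then show ?case using sl2_efh by simp
  next
    case 3 then show ?case using sl2_efh by simp
  next
    case 4 then show ?case using sl2_efh by simp
  }
next
  case (Suc n)
  let ?d = "fst (tensor_power n)"
  have d: "?d > 0" by (rule tensor_power_dim)
  have entry: "snd (tensor_power (Suc n)) A $$ (i, j) =
      A $$ (i div ?d, j div ?d) * (if i mod ?d = j mod ?d then 1 else 0) + (if i div ?d = j div ?d then 1 else 0) * snd (tensor_power n) A $$ (i mod ?d, j mod ?d)"
    if "A \<in> sl2" "i < 2 * ?d" "j < 2 * ?d" for A i j
  proof -
    have c: "A \<in> carrier_mat 2 2" "snd (tensor_power n) A \<in> carrier_mat ?d ?d"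
      using that(1) sl2_reps_carrier[OF tensor_power_rep that(1)] by (auto simp: sl2_def)
    have m: "i div ?d < 2" "j div ?d < 2" "i mod ?d < ?d" "j mod ?d < ?d"
      using that d by (auto intro: less_mult_imp_div_less)
    show ?thesis using that c m d by (simp add: sl2_tensor_def sl2_L1_def)
  qed
  have split: "i = 0 \<longleftrightarrow> i div ?d = 0 \<and> i mod ?d = 0" for i by (metis div_mult_mod_eq mult_0 add_0 div_0 mod_0)
  {
    case 1
    then have i: "i < 2 * ?d" by (simp add: sl2_tensor_def sl2_L1_def)
    then have "i div ?d < 2" by (rule less_mult_imp_div_less)
    then show ?case
      using entry[OF sl2_efh(1) i, of 0] Suc(1)[of "i mod ?d"] d by (simp add: sl2_e_def)
  next
    case 2
    then have i: "i < 2 * ?d" by (simp add: sl2_tensor_def sl2_L1_def)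
    then have "i div ?d < 2" by (rule less_mult_imp_div_less)
    then show ?case
      using entry[OF sl2_efh(2) _ i, of 0] Suc(2)[of "i mod ?d"] d by (simp add: sl2_f_def)
  next
    case 3
    then have i: "i < 2 * ?d" by (simp add: sl2_tensor_def sl2_L1_def)
    then have "i div ?d < 2" by (rule less_mult_imp_div_less)
    then show ?case
      using entry[OF sl2_efh(3) i, of 0] Suc(3)[of "i mod ?d"] d split[of i] by (auto simp: sl2_h_def)
  next
    case 4
    then have i: "i < 2 * ?d" by (simp add: sl2_tensor_def sl2_L1_def)
    then have "i div ?d < 2" by (rule less_mult_imp_div_less)
    then show ?case
      using entry[OF sl2_efh(3) _ i, of 0] Suc(4)[of "i mod ?d"] d split[of i] by (auto simp: sl2_h_def)
  }
qed

text \<open>\<open>unitv 0\<close> and the coordinate at 0 satisfy what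
  \<open>sl2_triple_pair\<close> requires of \<open>v\<close> and \<open>\<phi>\<close>. Hence
  \<open>weight_map\<close> gives homomorphisms into and out of the tensor power, with no need for
  the simple module itself.\<close>

lemma tensor_power_highest:
  "rep_e (tensor_power n) (unitv 0) = 0" "rep_h (tensor_power n) (unitv 0) = of_nat n *\<^sub>C unitv 0"
  "rep_f (tensor_power n) x 0 = 0" "rep_h (tensor_power n) x 0 = of_nat n * x 0"
proof -
  let ?T = "tensor_power n"
  note c = sl2_reps_carrier[OF tensor_power_rep sl2_efh(1), of n] sl2_reps_carrier[OF tensor_power_rep sl2_efh(2), of n]
    sl2_reps_carrier[OF tensor_power_rep sl2_efh(3), of n]
  note d = tensor_power_dim[of n]
  show "rep_e ?T (unitv 0) = 0" "rep_h ?T (unitv 0) = of_nat n *\<^sub>C unitv 0"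
    using c d tensor_power_first(1,3)[of _ n] mop_unitv[of 0 "snd ?T sl2_e"] mop_unitv[of 0 "snd ?T sl2_h"]
    by (auto simp: rep_e_def rep_h_def) (auto simp: fun_eq_iff unitv_def)
  show "rep_f ?T x 0 = 0"
    using c d tensor_power_first(2)[of _ n] by (auto simp: rep_f_def mop_def)
  have "(\<Sum>j<fst ?T. snd ?T sl2_h $$ (0, j) * x j) = (\<Sum>j<fst ?T. if j = 0 then of_nat n * x 0 else 0)"
    using tensor_power_first(4)[of _ n] by (intro sum.cong) auto
  then show "rep_h ?T x 0 = of_nat n * x 0"
    using c d by (simp add: rep_h_def mop_def)
qed

section \<open>Complete reducibility\<close>

text \<open>The two-sided ideal of maps factoring through finite sums of tensor powers, written as
  sums to avoid direct sums of modules.\<close>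

inductive_set tensor_maps :: "sl2_rep \<Rightarrow> sl2_rep \<Rightarrow> complex mat set" for V W where
  factor: "f \<in> sl2_homs V (tensor_power n) \<Longrightarrow> g \<in> sl2_homs (tensor_power n) W \<Longrightarrow> g * f \<in> tensor_maps V W"
| add: "f \<in> tensor_maps V W \<Longrightarrow> g \<in> tensor_maps V W \<Longrightarrow> f + g \<in> tensor_maps V W"

lemma hom_rep:
  assumes V: "V \<in> sl2_reps" "W \<in> sl2_reps" and D: "D \<in> sl2_homs V W"
  shows "rep_e W (mop D x) = mop D (rep_e V x)" "rep_f W (mop D x) = mop D (rep_f V x)" "rep_h W (mop D x) = mop D (rep_h V x)"
proof -
  have "mop (snd W A) (mop D x) = mop D (mop (snd V A) x)" if A: "A \<in> sl2" for A
  proof -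
    note c = sl2_homsD[OF D] sl2_reps_carrier[OF V(1) A] sl2_reps_carrier[OF V(2) A]
    have "D * snd V A = snd W A * D" using D A by (simp add: sl2_homs_def)
    then show ?thesis by (simp only: mop_mult[OF c(1,2), symmetric] mop_mult[OF c(3,1), symmetric])
  qed
  then show "rep_e W (mop D x) = mop D (rep_e V x)" "rep_f W (mop D x) = mop D (rep_f V x)" "rep_h W (mop D x) = mop D (rep_h V x)"
    using sl2_efh by (simp_all only: rep_e_def rep_f_def rep_h_def)
qed

lemma rep_supp: "V \<in> sl2_reps \<Longrightarrow> rep_e V x \<in> supp (fst V)" "V \<in> sl2_reps \<Longrightarrow> rep_f V x \<in> supp (fst V)"
    "V \<in> sl2_reps \<Longrightarrow> rep_h V x \<in> supp (fst V)"
  using mop_supp[OF sl2_reps_carrier] sl2_efh by (auto simp: rep_e_def rep_f_def rep_h_def)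

text \<open>One step of splitting off simple summands.  The image of \<open>D\<close> contains a highest weight vector
  \<open>w\<close>; a functional \<open>\<phi>\<close> as above gives an endomorphism \<open>g f\<close> through a tensor power whose image lies
  in that of \<open>D\<close> and with \<open>\<phi> g f = \<phi>\<close>.  Hence \<open>\<phi>\<close> vanishes on the image of \<open>D - g f D\<close>, but not at \<open>w\<close>.\<close>

lemma split_off:
  assumes V: "V \<in> sl2_reps" and D: "D \<in> sl2_homs V V" "D \<noteq> 0\<^sub>m (fst V) (fst V)"
  obtains f n g w \<phi> where "f \<in> sl2_homs V (tensor_power n)" "g \<in> sl2_homs (tensor_power n) V"
    "w \<in> mop D ` supp (fst V)" "w \<noteq> 0" "functional \<phi>" "\<phi> w = 1"
    "\<forall>x. mop (g * (f * D)) x \<in> mop D ` supp (fst V)"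
    "\<forall>x. \<phi> (mop (D - g * (f * D)) x) = 0"
proof -
  let ?S = "supp (fst V)"
  let ?P = "\<lambda>y. y \<in> mop D ` ?S"
  have Dc: "D \<in> carrier_mat (fst V) (fst V)" using D(1) by (rule sl2_homsD)
  obtain N where "sl2_triple (rep_e V) (rep_f V) (rep_h V) N" using rep_sl2_triple[OF V] by blast
  then interpret V: sl2_triple "rep_e V" "rep_f V" "rep_h V" N .
  note lin = mop_linear[of D]
  have zero: "mop (0\<^sub>m (fst V) (fst V)) x = 0" for x by (auto simp: mop_def fun_eq_iff)
  obtain x0 where x0: "x0 \<in> ?S" "mop D x0 \<noteq> 0"
    using mop_eqI[OF Dc zero_carrier_mat[of "fst V" "fst V"]] D(2) unfolding zero by blast
  have P_e: "?P (rep_e V y)" if "?P y" for y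
    using that by (elim imageE) (simp only: hom_rep(1)[OF V V D(1)], rule imageI, rule rep_supp[OF V])
  have P_f: "?P (rep_f V y)" if "?P y" for y
    using that by (elim imageE) (simp only: hom_rep(2)[OF V V D(1)], rule imageI, rule rep_supp[OF V])
  have P_add: "?P (y + z)" if "?P y" "?P z" for y z
    using that by (elim imageE) (simp only: clinear_add[OF lin, symmetric] supp_closed imageI)
  have P_scale: "?P (c *\<^sub>C y)" if "?P y" for y c
    using that by (elim imageE) (simp only: clinear_scale[OF lin, symmetric] supp_closed imageI)
  have P_h: "?P (rep_h V y - c *\<^sub>C y)" if "?P y" for y c
    using that by (elim imageE)
      (simp only: hom_rep(3)[OF V V D(1)] clinear_scale[OF lin, symmetric] clinear_diff[OF lin, symmetric] supp_closed rep_supp[OF V] imageI)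
  obtain w n where w: "w \<noteq> 0" "?P w" "rep_e V w = 0" "rep_h V w = of_nat n *\<^sub>C w" "n < N"
    using V.highest_weight_vector_exists[of "mop D x0" ?P] x0 P_e P_h by blast
  obtain \<phi> where \<phi>: "functional \<phi>" "\<And>x. \<phi> (rep_f V x) = 0" "\<And>x. \<phi> (rep_h V x) = of_nat n * \<phi> x" "\<phi> w = 1"
    using V.functional_exists[OF w(1,3,4,5)] by blast
  define T where "T = tensor_power n"
  have TR: "T \<in> sl2_reps" unfolding T_def by (rule tensor_power_rep)
  obtain N' where "sl2_triple (rep_e T) (rep_f T) (rep_h T) N'" using rep_sl2_triple[OF TR] by blast
  then interpret T: sl2_triple "rep_e T" "rep_f T" "rep_h T" N' .
  note hw = tensor_power_highest[of n, folded T_def]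
  have y: "functional (\<lambda>x. x 0)" by (rule functionalI) auto
  \<comment> \<open>\<open>A\<close> gives a homomorphism from \<open>V\<close> to the tensor power
    by means of \<open>\<phi>\<close>, and \<open>B\<close> one back by means of
    \<open>w\<close>.\<close>
  interpret A: sl2_triple_pair "rep_e V" "rep_f V" "rep_h V" N "rep_e T" "rep_f T" "rep_h T" N' n \<phi> "unitv 0"
    by (rule sl2_triple_pair.intro[OF V.sl2_triple_axioms T.sl2_triple_axioms], rule sl2_triple_pair_axioms.intro)
      (fact \<phi>(1) \<phi>(2) \<phi>(3) hw(1) hw(2))+
  interpret B: sl2_triple_pair "rep_e T" "rep_f T" "rep_h T" N' "rep_e V" "rep_f V" "rep_h V" N n "\<lambda>x. x 0" w
    by (rule sl2_triple_pair.intro[OF T.sl2_triple_axioms V.sl2_triple_axioms], rule sl2_triple_pair_axioms.intro)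
      (fact y hw(3) hw(4) w(3) w(4))+
  have As: "A.\<Psi> x \<in> supp (fst T)" for x
    by (rule A.\<Psi>_in[of "\<lambda>y. y \<in> supp (fst T)"])
      (use unitv_supp[OF tensor_power_dim] supp_closed rep_supp[OF TR] in \<open>simp_all only: T_def\<close>)
  have BP: "?P (B.\<Psi> x)" for x
    by (rule B.\<Psi>_in[of ?P]) (fact w(2) P_f P_add P_scale)+
  have "?P z \<Longrightarrow> z \<in> ?S" for z using mop_supp[OF Dc] by blast
  then have Bs: "B.\<Psi> x \<in> ?S" for x using BP by blast
  define f where "f = mat_of (fst T) (fst V) A.\<Psi>"
  define g where "g = mat_of (fst V) (fst T) B.\<Psi>"
  have f: "f \<in> sl2_homs V T" unfolding f_def
    by (rule intertwiner_hom[OF V TR A.\<Psi>_linear As A.\<Psi>_E A.\<Psi>_F A.\<Psi>_H])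
  have g: "g \<in> sl2_homs T V" unfolding g_def
    by (rule intertwiner_hom[OF TR V B.\<Psi>_linear Bs B.\<Psi>_E B.\<Psi>_F B.\<Psi>_H])
  note fc = sl2_homsD[OF f] and gc = sl2_homsD[OF g]
  have gfD: "mop (g * (f * D)) x = B.\<Psi> (A.\<Psi> (mop D x))" for x
  proof -
    have "mop (g * (f * D)) x = mop g (mop f (mop D x))"
      by (simp only: mop_mult[OF gc mult_carrier_mat[OF fc Dc]] mop_mult[OF fc Dc])
    also have "mop f (mop D x) = A.\<Psi> (mop D x)"
      unfolding f_def by (rule mop_mat_of[OF A.\<Psi>_linear As mop_supp[OF Dc]])
    also have "mop g \<dots> = B.\<Psi> (A.\<Psi> (mop D x))"
      unfolding g_def by (rule mop_mat_of[OF B.\<Psi>_linear Bs As])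
    finally show ?thesis .
  qed
  \<comment> \<open>\<open>functional_\<Psi>\<close> twice: applied to \<open>\<phi>\<close> it
    leaves the coordinate at 0 times \<open>\<phi> w = 1\<close>, and that coordinate of
    \<open>A.\<Psi> u\<close> is \<open>\<phi> u\<close>.\<close>
  have "\<phi> (B.\<Psi> (A.\<Psi> u)) = \<phi> u" for u
  proof -
    have "\<phi> (B.\<Psi> (A.\<Psi> u)) = A.\<Psi> u 0 * \<phi> w" by (rule B.functional_\<Psi>[OF \<phi>(1,2)])
    also have "A.\<Psi> u 0 = \<phi> u * unitv 0 0"
      by (rule A.functional_\<Psi>[OF y hw(3)])
    finally show ?thesis using \<phi>(4) by (simp add: unitv_def)
  qed
  then have "\<phi> (mop (D - g * (f * D)) x) = 0" for x
    using mop_minus[OF Dc mult_carrier_mat[OF gc mult_carrier_mat[OF fc Dc]]]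
    by (simp only: gfD functional_simps[OF \<phi>(1)]) simp
  then show thesis using that[OF f[unfolded T_def] g[unfolded T_def] w(2,1) \<phi>(1,4)] gfD BP by (simp add: T_def)
qed

text \<open>\<open>split_off\<close> is iterated from \<open>D = 1\<close>. While
  \<open>1 - D\<close> stays in \<open>tensor_maps\<close>, the vectors \<open>w\<close> accumulate
  in an independent set \<open>B\<close> whose span meets the image of \<open>D\<close> only in 0.
  More than \<open>fst V\<close> of them cannot exist, so \<open>D\<close> becomes 0.\<close>

theorem id_in_tensor_maps:
  assumes V: "V \<in> sl2_reps"
  shows "1\<^sub>m (fst V) \<in> tensor_maps V V"
proof -
  let ?n = "fst V"
  let ?S = "supp ?n"
  have zero: "0\<^sub>m ?n ?n \<in> tensor_maps V V"
  proof -
    have "0\<^sub>m m ?n \<in> sl2_homs V (tensor_power 0)" if "m = 1" for m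
      using that by (auto simp: sl2_homs_def left_mult_zero_mat[OF sl2_reps_carrier[OF V]] right_mult_zero_mat[OF sl2_reps_carrier[OF V]])
    moreover have "0\<^sub>m ?n m \<in> sl2_homs (tensor_power 0) V" if "m = 1" for m
      using that by (auto simp: sl2_homs_def left_mult_zero_mat[OF sl2_reps_carrier[OF V]] right_mult_zero_mat[OF sl2_reps_carrier[OF V]])
    ultimately have "0\<^sub>m ?n 1 * 0\<^sub>m 1 ?n \<in> tensor_maps V V" by (intro tensor_maps.factor[of _ _ 0]) blast+
    then show ?thesis by simp
  qed
  have "\<exists>D \<in> sl2_homs V V. 1\<^sub>m ?n - D \<in> tensor_maps V V \<and> (D = 0\<^sub>m ?n ?n \<or>
      (\<exists>B. finite B \<and> cvec.independent B \<and> card B = m \<and> B \<subseteq> ?S \<and> (\<forall>x \<in> ?S. mop D x \<in> cvec.span B \<longrightarrow> mop D x = 0)))" for m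
  proof (induction m)
    case 0
    have "1\<^sub>m ?n - 1\<^sub>m ?n = (0\<^sub>m ?n ?n :: complex mat)" by auto
    then have "1\<^sub>m ?n - 1\<^sub>m ?n \<in> tensor_maps V V" using zero by (simp only:)
    moreover have "\<forall>x \<in> ?S. mop (1\<^sub>m ?n) x \<in> cvec.span {} \<longrightarrow> mop (1\<^sub>m ?n) x = 0"
      unfolding cvec.span_empty by blast
    ultimately show ?case
      using sl2_homs_one[OF V] cvec.independent_empty card.empty finite.emptyI by blast
  next
    case (Suc m)
    then obtain D where D: "D \<in> sl2_homs V V" "1\<^sub>m ?n - D \<in> tensor_maps V V" and alt: "D = 0\<^sub>m ?n ?n \<or>
      (\<exists>B. finite B \<and> cvec.independent B \<and> card B = m \<and> B \<subseteq> ?S \<and> (\<forall>x \<in> ?S. mop D x \<in> cvec.span B \<longrightarrow> mop D x = 0))" by blast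
    show ?case
    proof (cases "D = 0\<^sub>m ?n ?n")
      case True
      then show ?thesis using D by blast
    next
      case False
      then obtain B where B: "finite B" "cvec.independent B" "card B = m" "B \<subseteq> ?S"
        "\<And>x. x \<in> ?S \<Longrightarrow> mop D x \<in> cvec.span B \<Longrightarrow> mop D x = 0" using alt by blast
      obtain f n g w \<phi> where s: "f \<in> sl2_homs V (tensor_power n)" "g \<in> sl2_homs (tensor_power n) V"
        "w \<in> mop D ` ?S" "w \<noteq> 0" "functional \<phi>" "\<phi> w = 1"
        "\<forall>x. mop (g * (f * D)) x \<in> mop D ` ?S" "\<forall>x. \<phi> (mop (D - g * (f * D)) x) = 0"
        using split_off[OF V D(1) False] .
      let ?K = "g * (f * D)" and ?D = "D - g * (f * D)"
      note c = sl2_homsD[OF D(1)] sl2_homsD[OF s(1)] sl2_homsD[OF s(2)]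
      have fD: "f * D \<in> sl2_homs V (tensor_power n)" using sl2_homs_comp[OF V V tensor_power_rep D(1) s(1)] .
      then have K: "?K \<in> sl2_homs V V" "?K \<in> tensor_maps V V"
        using sl2_homs_comp[OF V tensor_power_rep V _ s(2)] tensor_maps.factor s(2) by auto
      note Kc = sl2_homsD[OF K(1)]
      interpret VV: vectorspace class_ring "Mor sl2_mod V V" by (rule sl2_homs_vectorspace[OF V V])
      have neg: "(- 1) \<cdot>\<^sub>m ?K \<in> sl2_homs V V" using VV.smult_closed[of "- 1" ?K] K(1) by (simp add: class_ring_simps)
      have "D + (- 1) \<cdot>\<^sub>m ?K \<in> sl2_homs V V" using VV.a_closed[of D "(- 1) \<cdot>\<^sub>m ?K"] D(1) neg by simp
      moreover have "D + (- 1) \<cdot>\<^sub>m ?K = ?D" using c(1) Kc by (intro eq_matI) auto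
      ultimately have D': "?D \<in> sl2_homs V V" by simp
      have "1\<^sub>m ?n - ?D = (1\<^sub>m ?n - D) + ?K" using c(1) Kc by (intro eq_matI) auto
      then have 1: "1\<^sub>m ?n - ?D \<in> tensor_maps V V" using tensor_maps.add[OF D(2) K(2)] by simp
      obtain x0 where x0: "x0 \<in> ?S" "w = mop D x0" using s(3) by blast
      then have w: "w \<notin> cvec.span B" using B(5) s(4) by blast
      have img: "z \<in> cvec.span B \<Longrightarrow> z = 0" if "z \<in> mop D ` ?S" for z using that B(5) by blast
      have "mop ?D x = 0" if x: "x \<in> ?S" and sp: "mop ?D x \<in> cvec.span (insert w B)" for x
      proof -
        \<comment> \<open>This difference lies in the span of \<open>B\<close> and also in the image
          of \<open>D\<close>, which contains the image of \<open>?K\<close> and \<open>w\<close>;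
          hence it is 0. Then \<open>\<phi>\<close>, which vanishes on the image of
          \<open>?D\<close> but not at \<open>w\<close>, forces \<open>k = 0\<close>.\<close>
        obtain k where k: "mop ?D x - k *\<^sub>C w \<in> cvec.span B" using sp unfolding cvec.span_breakdown_eq by blast
        obtain z where z: "z \<in> ?S" "mop ?K x = mop D z" using s(7) by blast
        have "mop ?D x - k *\<^sub>C w = mop D (x - z - k *\<^sub>C x0)"
          unfolding clinear_diff[OF mop_linear] clinear_scale[OF mop_linear] x0(2) z(2)[symmetric] mop_minus[OF c(1) Kc] ..
        moreover have "x - z - k *\<^sub>C x0 \<in> ?S" using x z(1) x0(1) by (intro supp_closed)
        ultimately have "mop ?D x - k *\<^sub>C w = 0" using img k by (metis imageI)
        then have eq: "mop ?D x = k *\<^sub>C w" by simp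
        then have "k = 0" using s(8)[rule_format, of x] s(6) unfolding eq functional_simps[OF s(5)] by simp
        then show ?thesis unfolding eq by simp
      qed
      moreover have "w \<notin> B" using w cvec.span_base by blast
      then have "finite (insert w B)" "cvec.independent (insert w B)" "card (insert w B) = Suc m" "insert w B \<subseteq> ?S"
        using B(1,3,4) cvec.independent_insertI[OF w B(2)] mop_supp[OF c(1)] x0(2) by auto
      ultimately show ?thesis using D' 1 by blast
    qed
  qed
  from this[of "Suc ?n"] obtain D where D: "D \<in> sl2_homs V V" "1\<^sub>m ?n - D \<in> tensor_maps V V" and alt: "D = 0\<^sub>m ?n ?n \<or>
      (\<exists>B. finite B \<and> cvec.independent B \<and> card B = Suc ?n \<and> B \<subseteq> ?S)" by blast
  have "\<not> (finite B \<and> cvec.independent B \<and> card B = Suc ?n \<and> B \<subseteq> ?S)" for B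
  proof
    assume B: "finite B \<and> cvec.independent B \<and> card B = Suc ?n \<and> B \<subseteq> ?S"
    then have "card B \<le> card (unitv ` {..<?n})"
      using cvec.independent_span_bound[of "unitv ` {..<?n}" B] supp_span by blast
    also have "\<dots> \<le> ?n" using card_image_le[of "{..<?n}" unitv] by simp
    finally show False using B by simp
  qed
  then have "D = 0\<^sub>m ?n ?n" using alt by blast
  moreover have "1\<^sub>m ?n - 0\<^sub>m ?n ?n = (1\<^sub>m ?n :: complex mat)" by auto
  ultimately show ?thesis using D(2) by simp
qed

section \<open>Self-duality of L(1)\<close>

text \<open>The invariant antisymmetric tensor; in the lexicographic basis, indices 1 and 2 are the
  two mixed tensors. \<open>L1_ev\<close> is the determinant form.\<close>

definition L1_coev :: "complex mat" where
  "L1_coev = mat 4 1 (\<lambda>(i, j). if i = 1 then 1 else if i = 2 then - 1 else 0)"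
definition L1_ev :: "complex mat" where
  "L1_ev = mat 1 4 (\<lambda>(i, j). if j = 1 then 1 else if j = 2 then - 1 else 0)"

lemma less_4_cases: "(i::nat) < 4 \<longleftrightarrow> i = 0 \<or> i = 1 \<or> i = 2 \<or> i = 3"
  by auto

lemma sum_4: "(\<Sum>k = 0..<4::nat. f k) = f 0 + f 1 + f 2 + (f 3 :: complex)"
  by (simp add: eval_nat_numeral)

lemma L1_coev_hom: "L1_coev \<in> sl2_homs (1, \<lambda>A \<in> sl2. 0\<^sub>m 1 1) (sl2_tensor sl2_L1 sl2_L1)"
proof -
  have "L1_coev * 0\<^sub>m 1 1 = (kronecker A (1\<^sub>m 2) + kronecker (1\<^sub>m 2) A) * L1_coev" (is "?l = ?r") if "A \<in> sl2" for A
  proof (rule eq_matI)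
    have A: "A \<in> carrier_mat 2 2" "A $$ (1, 1) = - A $$ (0, 0)"
      using that by (auto simp: sl2_def numeral_2_eq_2 add_eq_0_iff)
    show "dim_row ?l = dim_row ?r" "dim_col ?l = dim_col ?r" using A by (simp_all add: L1_coev_def)
    fix i j assume "i < dim_row ?r" "j < dim_col ?r"
    then have "i < 4" "j = 0" using A by (simp_all add: L1_coev_def)
    then show "?l $$ (i, j) = ?r $$ (i, j)"
      unfolding less_4_cases by (elim disjE) (use A in \<open>simp_all add: L1_coev_def scalar_prod_def sum_4\<close>)
  qed
  then show ?thesis by (auto simp: sl2_homs_def sl2_tensor_def sl2_L1_def L1_coev_def)
qed

lemma L1_ev_hom: "L1_ev \<in> sl2_homs (sl2_tensor sl2_L1 sl2_L1) (1, \<lambda>A \<in> sl2. 0\<^sub>m 1 1)"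
proof -
  have "L1_ev * (kronecker A (1\<^sub>m 2) + kronecker (1\<^sub>m 2) A) = 0\<^sub>m 1 1 * L1_ev" (is "?l = ?r") if "A \<in> sl2" for A
  proof (rule eq_matI)
    have A: "A \<in> carrier_mat 2 2" "A $$ (1, 1) = - A $$ (0, 0)"
      using that by (auto simp: sl2_def numeral_2_eq_2 add_eq_0_iff)
    show "dim_row ?l = dim_row ?r" "dim_col ?l = dim_col ?r" using A by (simp_all add: L1_ev_def)
    fix i j assume "i < dim_row ?r" "j < dim_col ?r"
    then have "j < 4" "i = 0" using A by (simp_all add: L1_ev_def)
    then show "?l $$ (i, j) = ?r $$ (i, j)"
      unfolding less_4_cases by (elim disjE) (use A in \<open>simp_all add: L1_ev_def scalar_prod_def sum_4\<close>)
  qed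
  then show ?thesis by (auto simp: sl2_homs_def sl2_tensor_def sl2_L1_def L1_ev_def)
qed

lemma sum_8: "(\<Sum>k = 0..<8::nat. f k) = f 0 + f 1 + f 2 + f 3 + f 4 + f 5 + f 6 + (f 7 :: complex)"
  by (simp add: eval_nat_numeral)

text \<open>The result is minus the identity, as in \<open>L1_zag\<close>. A sign in
  \<open>L1_coev\<close> would remove it from both, but invertibility is all that
  \<open>self_dual_action\<close> asks.\<close>

lemma L1_zig: "kronecker (1\<^sub>m 2) L1_ev * kronecker L1_coev (1\<^sub>m 2) = (- 1) \<cdot>\<^sub>m 1\<^sub>m 2" (is "?l = ?r")
proof (rule eq_matI)
  fix i j assume "i < dim_row ?r" "j < dim_col ?r"
  then have "i = 0 \<or> i = 1" "j = 0 \<or> j = 1" by auto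
  then show "?l $$ (i, j) = ?r $$ (i, j)"
    by (elim disjE) (simp_all add: L1_ev_def L1_coev_def scalar_prod_def sum_8)
qed (simp_all add: L1_ev_def L1_coev_def)

lemma L1_zag: "kronecker L1_ev (1\<^sub>m 2) * kronecker (1\<^sub>m 2) L1_coev = (- 1) \<cdot>\<^sub>m 1\<^sub>m 2" (is "?l = ?r")
proof (rule eq_matI)
  fix i j assume "i < dim_row ?r" "j < dim_col ?r"
  then have "i = 0 \<or> i = 1" "j = 0 \<or> j = 1" by auto
  then show "?l $$ (i, j) = ?r $$ (i, j)"
    by (elim disjE) (simp_all add: L1_ev_def L1_coev_def scalar_prod_def sum_8)
qed (simp_all add: L1_ev_def L1_coev_def)

section \<open>The radical of a module category of type \<open>T\<^sub>\<infinity>\<close>\<close>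

text \<open>The induction treats any \<open>a\<close> in \<open>tensor_maps\<close> in place of the
  identity: \<open>act_factor_rad\<close> handles maps through one tensor power, and additivity of
  the action in its first argument handles sums.\<close>

lemma preserves_rad_sl2:
  fixes X :: "(sl2_rep, complex mat, 'o, 'm) mod_cat"
  assumes M: "module_category sl2_mod X"
    and L1: "module_category.preserves_rad sl2_mod X sl2_L1"
    and A: "A \<in> sl2_reps"
  shows "module_category.preserves_rad sl2_mod X A"
proof -
  interpret module_category sl2_mod X by (rule M)
  have pow: "preserves_rad (tensor_power n)" for n
  proof (induction n)
    case 0
    then show ?case using preserves_rad_unit by simp
  next
    case (Suc n)
    then show ?case using preserves_rad_tens[OF L1 Suc] by simp
  qed
  have "a \<in> sl2_homs A A \<and> act_mor X A A U V a f \<in> radical X (act_ob X A U) (act_ob X A V)"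
    if a: "a \<in> tensor_maps A A" and U: "U \<in> Ob X" "V \<in> Ob X" and f: "f \<in> radical X U V" for a U V f
    using a
  proof (induction rule: tensor_maps.induct)
    case (factor p n i)
    then show ?case
      using act_factor_rad[OF pow, of A p n i U V f] A U f sl2_homs_comp[OF A tensor_power_rep A] by simp
  next
    case (add a b)
    have "a + b \<in> sl2_homs A A"
      using C.add_closed[of A A a b] add A by simp
    moreover have "act_mor X A A U V (a + b) f =
        act_mor X A A U V a f \<oplus>\<^bsub>Mor X (act_ob X A U) (act_ob X A V)\<^esub> act_mor X A A U V b f"
      using linear_map.T_add[OF act_linear_left[of A A U V f], of a b] A U M.rad_hom[OF f] add by simp
    ultimately show ?case
      using add M.rad_add[of "act_ob X A U" "act_ob X A V"] A U by simp
  qed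
  then show ?thesis
    using id_in_tensor_maps[OF A] A unfolding preserves_rad_def by simp
qed

text \<open>\<open>1\<^sub>m 8\<close> is the inverse associator: in lexicographic bases associators
  are identity matrices, here of size \<open>2^3\<close>. The zigzags thus reduce to
  \<open>L1_zig\<close> and \<open>L1_zag\<close>.\<close>

lemma self_dual_action_L1:
  fixes X :: "(sl2_rep, complex mat, 'o, 'm) mod_cat"
  assumes "module_category sl2_mod X"
  shows "self_dual_action sl2_mod X sl2_L1 L1_coev L1_ev (1\<^sub>m 8)"
proof -
  interpret module_category sl2_mod X by fact
  have dim: "fst sl2_L1 = 2" by (simp add: sl2_L1_def)
  note T = sl2_tensor_rep[OF sl2_L1_rep sl2_L1_rep]
  have c: "L1_ev \<in> carrier_mat 1 4" "L1_coev \<in> carrier_mat 4 1" by (simp_all add: L1_ev_def L1_coev_def)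
  have unit: "sl2_tensor (1, \<lambda>A \<in> sl2. 0\<^sub>m 1 1) sl2_L1 = sl2_L1" "sl2_tensor sl2_L1 (1, \<lambda>A \<in> sl2. 0\<^sub>m 1 1) = sl2_L1"
    by (rule sl2_tensor_unit[OF sl2_L1_rep])+
  have "1\<^sub>m 2 \<in> sl2_homs sl2_L1 sl2_L1" using sl2_homs_one[OF sl2_L1_rep] by (simp add: dim)
  then have "(- 1) \<cdot>\<^sub>m 1\<^sub>m 2 \<in> sl2_homs sl2_L1 sl2_L1"
    using C.smult_closed[of sl2_L1 sl2_L1 "1\<^sub>m 2" "- 1"] sl2_L1_rep by simp
  moreover have "((- 1) \<cdot>\<^sub>m 1\<^sub>m 2) * ((- 1) \<cdot>\<^sub>m 1\<^sub>m 2) = (1\<^sub>m 2 :: complex mat)"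
    by (rule eq_matI) (auto simp: scalar_prod_def numeral_2_eq_2 less_Suc_eq)
  ultimately have iso: "(- 1) \<cdot>\<^sub>m 1\<^sub>m 2 \<in> isos sl2_mod sl2_L1 sl2_L1"
    by (intro C.isosI[of _ _ _ "(- 1) \<cdot>\<^sub>m 1\<^sub>m 2"]) (simp_all add: dim)
  have k: "kronecker (1\<^sub>m 2) L1_ev \<in> carrier_mat 2 8" "kronecker L1_ev (1\<^sub>m 2) \<in> carrier_mat 2 8"
    using kronecker_carrier[OF one_carrier_mat[of 2] c(1)] kronecker_carrier[OF c(1) one_carrier_mat[of 2]] by simp_all
  have d3: "fst (sl2_tensor sl2_L1 (sl2_tensor sl2_L1 sl2_L1)) = 8" by (simp add: sl2_tensor_def dim)
  show ?thesis
  proof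
    show "sl2_L1 \<in> Ob sl2_mod" by (simp add: sl2_L1_rep)
    show "L1_coev \<in> mors sl2_mod (unit_ob sl2_mod) (tens_ob sl2_mod sl2_L1 sl2_L1)" using L1_coev_hom by simp
    show "L1_ev \<in> mors sl2_mod (tens_ob sl2_mod sl2_L1 sl2_L1) (unit_ob sl2_mod)" using L1_ev_hom by simp
    show "1\<^sub>m 8 \<in> mors sl2_mod (tens_ob sl2_mod sl2_L1 (tens_ob sl2_mod sl2_L1 sl2_L1)) (tens_ob sl2_mod (tens_ob sl2_mod sl2_L1 sl2_L1) sl2_L1)"
      using sl2_homs_one[OF sl2_tensor_rep[OF sl2_L1_rep T]] sl2_tensor_assoc[OF sl2_L1_rep sl2_L1_rep sl2_L1_rep] d3 by simp
  qed (simp_all add: dim d3 unit[simplified] right_mult_one_mat[OF k(1)] right_mult_one_mat[OF k(2)] L1_zig L1_zag iso)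
qed

theorem proposition22:
  fixes X :: "(sl2_rep, complex mat, 'o, 'm) mod_cat"
  assumes "module_category sl2_mod X"
    and "locally_finitary X"
    and "admissible X"
    and "simple_transitive sl2_mod X"
    and "type_T_infinity X"
  shows "semi_simple X"
proof -
  obtain P :: "nat \<Rightarrow> 'o" where P: "\<And>i. indecomposable X (P i)" "\<And>i j. isomorphic X (P i) (P j) \<Longrightarrow> i = j"
    "\<And>Y. indecomposable X Y \<Longrightarrow> \<exists>i. isomorphic X Y (P i)"
    "direct_sum X [P 0, P 1] (act_ob X sl2_L1 (P 0))"
    "\<And>i. i \<ge> 1 \<Longrightarrow> direct_sum X [P (i - 1), P (i + 1)] (act_ob X sl2_L1 (P i))"
    using assms(5) unfolding type_T_infinity_def by blast
  interpret self_dual_action sl2_mod X sl2_L1 L1_coev L1_ev "1\<^sub>m 8"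
    by (rule self_dual_action_L1[OF assms(1)])
  interpret P: krull_schmidt_category X P
    using M.krull_schmidt_categoryI[OF assms(2) P(1-3)] .
  have "direct_sum X [P i, P (Suc (Suc i))] (act_ob X sl2_L1 (P (Suc i)))" for i
    using P(5)[of "Suc i"] by simp
  then have "preserves_rad sl2_L1"
    using preserves_rad_self_dual[OF P.krull_schmidt_category_axioms P(4)] by blast
  then have "preserves_rad A" if "A \<in> Ob sl2_mod" for A
    using preserves_rad_sl2[OF assms(1)] that by simp
  then show ?thesis
    using semi_simple_if_rad_preserved[OF assms(4) _ P.P_ob P.P_local] by blast
qed

end
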